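(* Let $r\ge 2$ and $n\ge 1$. The Foulkes characters $\phi_0,\phi_1,\ldots,\phi_n$ of $G_n=G(r,1,n)$ result from applying the Gram--Schmidt process (with normalization), with respect to the inner product $[\,\cdot\,,\,\cdot\,]$ on $\mathrm{CF}_\ell(G_n)$, to the characters $1^{\ell},(r+1)^{\ell},(2r+1)^{\ell},\ldots,(rn+1)^{\ell}$ taken in this order, where $k^{\ell}$ denotes the function $x\mapsto k^{\ell(x)}$ on $G_n$.
   Context: Fix an integer $r>1$, a primitive $r$-th root of unity $\zeta$, and $Z=\langle\zeta\rangle$. $G_n=G(r,1,n)$ is the group of $n\times n$ complex matrices with exactly one nonzero entry in each row and column, all nonzero entries lying in $Z$. Each $x\in G_n$ is $x=D A_\pi$ with $D$ diagonal and $A_\pi=(\delta_{i\pi(j)})$, $\pi\in S_n$. The type of $x$ is the $r$-tuple of partitions $\lambda=(\lambda^0,\ldots,\lambda^{r-1})$, where the parts of $\lambda^j$ are the lengths of the cycles $(i_1\,i_2\,\ldots\,i_k)$ of $\pi$ with $x_{i_1i_2}x_{i_2i_3}\cdots x_{i_ki_1}=\zeta^j$; conjugacy classes correspond to types, and $K_\lambda$ is the class of elements of type $\lambda$. $\ell(x)$ is the number of parts of $\lambda^0$ (equivalently $\ell(x)=\dim\ker(x-1)$), and $C_i=\{x\in G_n\mid\ell(x)=i\}$, $0\le i\le n$. $\mathrm{CF}_\ell(G_n)$ is the complex vector space of functions $G_n\to\mathbb{C}$ depending only on $\ell$; $\vartheta(C_i)$ is the common value of such a $\vartheta$ on $C_i$.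 The Foulkes characters $\phi_0,\ldots,\phi_n$ of $G_n$ are given by $\phi_i(x)=\sum_{j=0}^{n}(-1)^{i-j}\binom{n+1}{i-j}(rj+1)^{\ell(x)}$, with $\binom{a}{b}=0$ for $b<0$. The inner product is $[\vartheta,\psi]=\frac{1}{|G_n|}\sum_{i,j=0}^{n}\vartheta(C_i)\overline{\psi(C_j)}\mu(C_i,C_j)$, with $\mu$ as follows. For a sequence $\mathfrak a=(K_1,\ldots,K_m)$ of conjugacy classes of $G_n$, let $\mu_{\mathfrak a}(C_i,C_j)=\mathbf{E}\,|k_1k_2\cdots k_m C_i\cap C_j|$, where $k_1,\ldots,k_m$ are independent and $k_u$ is uniformly random in $K_u$. Let $\mathfrak a_1=(K_{((n),\emptyset,\ldots,\emptyset)},K_{((n),\emptyset,\ldots,\emptyset)})$, $\mathfrak a_2=(K_{((n),\emptyset,\ldots,\emptyset)},K_{(\emptyset,(n),\emptyset,\ldots,\emptyset)})$, $\mathfrak a_3=(K_{((n),\emptyset,\ldots,\emptyset)},K_{((n-1),(1),\emptyset,\ldots,\emptyset)})$, $\mathfrak a_4=(K_{((n),\emptyset,\ldots,\emptyset)},K_{((n),\emptyset,\ldots,\emptyset)},K_{((n-1,1),\emptyset,\ldots,\emptyset)},K_{((n-1,1),\emptyset,\ldots,\emptyset)})$, $\mathfrak a_5=(K_{((n),\emptyset,\ldots,\emptyset)},K_{((n),\emptyset,\ldots,\emptyset)},K_{((n-1),(1),\emptyset,\ldots,\emptyset)},K_{((n-1,1),\emptyset,\ldots,\emptyset)})$, and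 $\mu_i=\mu_{\mathfrak a_i}$. If $n=1$, $\mu=\frac{2}{r}\mu_1+\frac{r-2}{r}\mu_2$. If $n\ge 2$, $\mu=\frac1r\mu_1+\frac{r-2}{2r}\mu_2+\frac14\mu_3+\frac1{2r}\mu_4+\frac{r-2}{4r}\mu_5$. *)

theory Defs
  imports
    "HOL-Combinatorics.Orbits"
    "HOL-Combinatorics.Permutations"
    "HOL-Probability.Probability_Mass_Function"
    "Jordan_Normal_Form.Matrix"
begin

text \<open>
  Rows and columns are indexed by \<open>{..<n}\<close>. Throughout, \<open>\<zeta>\<close> stands for a fixed primitive
  \<open>r\<close>-th root of unity, which is an explicit parameter because types depend on its choice.
\<close>

definition primitive_root_of_unity :: "nat \<Rightarrow> complex \<Rightarrow> bool" where
  "primitive_root_of_unity r \<zeta> \<longleftrightarrow> 0 < r \<and> \<zeta> ^ r = 1 \<and> (\<forall>k. 0 < k \<and> k < r \<longrightarrow> \<zeta> ^ k \<noteq> 1)"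

definition Gn :: "nat \<Rightarrow> complex \<Rightarrow> complex mat set" where
  "Gn n \<zeta> = {x \<in> carrier_mat n n.
     (\<forall>i<n. \<exists>!j. j < n \<and> x $$ (i, j) \<noteq> 0) \<and>
     (\<forall>j<n. \<exists>!i. i < n \<and> x $$ (i, j) \<noteq> 0) \<and>
     (\<forall>i<n. \<forall>j<n. x $$ (i, j) \<noteq> 0 \<longrightarrow> x $$ (i, j) \<in> range (\<lambda>k::nat. \<zeta> ^ k))}"

definition permutation_matrix :: "nat \<Rightarrow> (nat \<Rightarrow> nat) \<Rightarrow> complex mat" where
  "permutation_matrix n \<pi> = mat n n (\<lambda>(i, j). if i = \<pi> j then 1 else 0)"

definition perm_of :: "nat \<Rightarrow> complex mat \<Rightarrow> nat \<Rightarrow> nat" where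
  "perm_of n x = (THE \<pi>. \<pi> permutes {..<n} \<and>
     (\<exists>D \<in> carrier_mat n n. diagonal_mat D \<and> x = D * permutation_matrix n \<pi>))"

text \<open>Cycles are represented by their supports; fixed points are cycles of length 1.\<close>

definition cycles_of :: "nat \<Rightarrow> complex mat \<Rightarrow> nat set set" where
  "cycles_of n x = orbit (perm_of n x) ` {..<n}"

text \<open>
  The only nonzero entry in column \<open>i\<close> of \<open>x = D A\<^sub>\<pi>\<close> is at \<open>(\<pi> i, i)\<close>. Hence the cyclic product
  \<open>x\<^bsub>i\<^sub>1i\<^sub>2\<^esub> x\<^bsub>i\<^sub>2i\<^sub>3\<^esub> \<cdots> x\<^bsub>i\<^sub>ki\<^sub>1\<^esub>\<close> along a cycle, with the cycle written so that its factors are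
  nonzero (\<open>\<pi> i\<^sub>2 = i\<^sub>1\<close>, \<open>\<pi> i\<^sub>3 = i\<^sub>2\<close>, \dots), has exactly the factors below.
\<close>

definition cycle_product :: "nat \<Rightarrow> complex mat \<Rightarrow> nat set \<Rightarrow> complex" where
  "cycle_product n x C = (\<Prod>i\<in>C. x $$ (perm_of n x i, i))"

text \<open>Partitions are multisets of positive parts; a type is a list of \<open>r\<close> partitions.\<close>

definition type_of :: "nat \<Rightarrow> nat \<Rightarrow> complex \<Rightarrow> complex mat \<Rightarrow> nat multiset list" where
  "type_of r n \<zeta> x =
     map (\<lambda>j. image_mset card (mset_set {C \<in> cycles_of n x. cycle_product n x C = \<zeta> ^ j})) [0..<r]"

definition conj_class :: "nat \<Rightarrow> nat \<Rightarrow> complex \<Rightarrow> nat multiset list \<Rightarrow> complex mat set" where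
  "conj_class r n \<zeta> lam = {x \<in> Gn n \<zeta>. type_of r n \<zeta> x = lam}"

definition ell :: "nat \<Rightarrow> nat \<Rightarrow> complex \<Rightarrow> complex mat \<Rightarrow> nat" where
  "ell r n \<zeta> x = size (type_of r n \<zeta> x ! 0)"

definition Cset :: "nat \<Rightarrow> nat \<Rightarrow> complex \<Rightarrow> nat \<Rightarrow> complex mat set" where
  "Cset r n \<zeta> i = {x \<in> Gn n \<zeta>. ell r n \<zeta> x = i}"

text \<open>
  A function on \<open>G\<^sub>n\<close> is represented by a total function on matrices whose values outside \<open>Gn n \<zeta>\<close>
  are irrelevant.
\<close>

definition CF_ell :: "nat \<Rightarrow> nat \<Rightarrow> complex \<Rightarrow> (complex mat \<Rightarrow> complex) set" where
  "CF_ell r n \<zeta> = {f. \<forall>x\<in>Gn n \<zeta>. \<forall>y\<in>Gn n \<zeta>. ell r n \<zeta> x = ell r n \<zeta> y \<longrightarrow> f x = f y}"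

definition value_on :: "(complex mat \<Rightarrow> complex) \<Rightarrow> complex mat set \<Rightarrow> complex" where
  "value_on f C = (THE c. \<forall>x\<in>C. f x = c)"

definition pow_ell :: "nat \<Rightarrow> nat \<Rightarrow> complex \<Rightarrow> nat \<Rightarrow> complex mat \<Rightarrow> complex" where
  "pow_ell r n \<zeta> k x = of_nat k ^ ell r n \<zeta> x"

text \<open>The guard \<open>j \<le> i\<close> implements the convention that \<open>a choose b\<close> is 0 for \<open>b < 0\<close>.\<close>

definition foulkes :: "nat \<Rightarrow> nat \<Rightarrow> complex \<Rightarrow> nat \<Rightarrow> complex mat \<Rightarrow> complex" where
  "foulkes r n \<zeta> i x =
     (\<Sum>j=0..n. if j \<le> i
        then (- 1) ^ (i - j) * of_nat (Suc n choose (i - j)) * of_nat (r * j + 1) ^ ell r n \<zeta> x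
        else 0)"

text \<open>\<open>indep_uniform [K\<^sub>1, \<dots>, K\<^sub>m]\<close> is the law of independent uniform draws \<open>[k\<^sub>1, \<dots>, k\<^sub>m]\<close>.\<close>

primrec indep_uniform :: "'a set list \<Rightarrow> 'a list pmf" where
  "indep_uniform [] = return_pmf []"
| "indep_uniform (K # Ks) =
     map_pmf (\<lambda>(k, ks). k # ks) (pair_pmf (pmf_of_set K) (indep_uniform Ks))"

definition mu_seq ::
    "nat \<Rightarrow> complex mat set list \<Rightarrow> complex mat set \<Rightarrow> complex mat set \<Rightarrow> real" where
  "mu_seq n Ks A B =
     measure_pmf.expectation (indep_uniform Ks)
       (\<lambda>ks. real (card ((\<lambda>c. foldr (*) ks (1\<^sub>m n) * c) ` A \<inter> B)))"

text \<open>\<open>Kpad r n \<zeta> [\<lambda>\<^sup>0, \<dots>, \<lambda>\<^sup>m]\<close> pads the type with empty partitions up to length \<open>r\<close>.\<close>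

definition Kpad :: "nat \<Rightarrow> nat \<Rightarrow> complex \<Rightarrow> nat multiset list \<Rightarrow> complex mat set" where
  "Kpad r n \<zeta> lam = conj_class r n \<zeta> (lam @ replicate (r - length lam) {#})"

definition seq1 :: "nat \<Rightarrow> nat \<Rightarrow> complex \<Rightarrow> complex mat set list" where
  "seq1 r n \<zeta> = [Kpad r n \<zeta> [{#n#}], Kpad r n \<zeta> [{#n#}]]"

definition seq2 :: "nat \<Rightarrow> nat \<Rightarrow> complex \<Rightarrow> complex mat set list" where
  "seq2 r n \<zeta> = [Kpad r n \<zeta> [{#n#}], Kpad r n \<zeta> [{#}, {#n#}]]"

definition seq3 :: "nat \<Rightarrow> nat \<Rightarrow> complex \<Rightarrow> complex mat set list" where
  "seq3 r n \<zeta> = [Kpad r n \<zeta> [{#n#}], Kpad r n \<zeta> [{#n - 1#}, {#1#}]]"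

definition seq4 :: "nat \<Rightarrow> nat \<Rightarrow> complex \<Rightarrow> complex mat set list" where
  "seq4 r n \<zeta> = [Kpad r n \<zeta> [{#n#}], Kpad r n \<zeta> [{#n#}],
                 Kpad r n \<zeta> [{#n - 1, 1#}], Kpad r n \<zeta> [{#n - 1, 1#}]]"

definition seq5 :: "nat \<Rightarrow> nat \<Rightarrow> complex \<Rightarrow> complex mat set list" where
  "seq5 r n \<zeta> = [Kpad r n \<zeta> [{#n#}], Kpad r n \<zeta> [{#n#}],
                 Kpad r n \<zeta> [{#n - 1#}, {#1#}], Kpad r n \<zeta> [{#n - 1, 1#}]]"

definition mu ::
    "nat \<Rightarrow> nat \<Rightarrow> complex \<Rightarrow> complex mat set \<Rightarrow> complex mat set \<Rightarrow> real" where
  "mu r n \<zeta> A B =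
     (if n = 1 then
        2 / real r * mu_seq n (seq1 r n \<zeta>) A B
        + (real r - 2) / real r * mu_seq n (seq2 r n \<zeta>) A B
      else
        1 / real r * mu_seq n (seq1 r n \<zeta>) A B
        + (real r - 2) / (2 * real r) * mu_seq n (seq2 r n \<zeta>) A B
        + 1 / 4 * mu_seq n (seq3 r n \<zeta>) A B
        + 1 / (2 * real r) * mu_seq n (seq4 r n \<zeta>) A B
        + (real r - 2) / (4 * real r) * mu_seq n (seq5 r n \<zeta>) A B)"

definition ell_inner ::
    "nat \<Rightarrow> nat \<Rightarrow> complex \<Rightarrow> (complex mat \<Rightarrow> complex) \<Rightarrow> (complex mat \<Rightarrow> complex) \<Rightarrow> complex" where
  "ell_inner r n \<zeta> f g =
     1 / of_nat (card (Gn n \<zeta>)) *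
     (\<Sum>i=0..n. \<Sum>j=0..n. value_on f (Cset r n \<zeta> i) * cnj (value_on g (Cset r n \<zeta> j))
        * of_real (mu r n \<zeta> (Cset r n \<zeta> i) (Cset r n \<zeta> j)))"

text \<open>
  \<open>V\<close> is a space of complex functions on \<open>S\<close>; linear in the first argument. Functions are compared
  on \<open>S\<close> only.
\<close>

definition inner_product_on ::
    "'a set \<Rightarrow> ('a \<Rightarrow> complex) set \<Rightarrow> (('a \<Rightarrow> complex) \<Rightarrow> ('a \<Rightarrow> complex) \<Rightarrow> complex) \<Rightarrow> bool" where
  "inner_product_on S V ip \<longleftrightarrow>
     (\<forall>f\<in>V. \<forall>g\<in>V. \<forall>h\<in>V. ip (\<lambda>x. f x + g x) h = ip f h + ip g h) \<and>
     (\<forall>c. \<forall>f\<in>V. \<forall>h\<in>V. ip (\<lambda>x. c * f x) h = c * ip f h) \<and>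
     (\<forall>f\<in>V. \<forall>g\<in>V. ip g f = cnj (ip f g)) \<and>
     (\<forall>f\<in>V. Im (ip f f) = 0 \<and> 0 \<le> Re (ip f f)) \<and>
     (\<forall>f\<in>V. ip f f = 0 \<longrightarrow> (\<forall>x\<in>S. f x = 0))"

text \<open>
  Gram--Schmidt with normalization: the \<open>k\<close>-th output is \<open>u / \<parallel>u\<parallel>\<close>, where \<open>u\<close> is \<open>v k\<close> minus its
  projections onto the earlier outputs. It depends on \<open>v 0, \<dots>, v k\<close> only.
\<close>

function gram_schmidt_seq ::
    "(('a \<Rightarrow> complex) \<Rightarrow> ('a \<Rightarrow> complex) \<Rightarrow> complex) \<Rightarrow> (nat \<Rightarrow> 'a \<Rightarrow> complex) \<Rightarrow> nat \<Rightarrow> 'a \<Rightarrow> complex"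
where
  "gram_schmidt_seq ip v k =
     (let u = (\<lambda>x. v k x - (\<Sum>i<k. ip (v k) (gram_schmidt_seq ip v i) * gram_schmidt_seq ip v i x))
      in (\<lambda>x. u x / of_real (sqrt (Re (ip u u)))))"
  by pat_completeness auto
termination
  by (relation "Wellfounded.measure (\<lambda>(ip, v, k). k)") auto

declare gram_schmidt_seq.simps [simp del]

end

theory Submission
  imports Defs "HOL-Computational_Algebra.Polynomial_FPS"
begin

text \<open>
  The Gram matrix of the functions \<open>(r k + 1)\<^sup>\<ell>\<close> is
  \<open>[(r k + 1)\<^sup>\<ell>, (r l + 1)\<^sup>\<ell>] = (\<Sum>b\<le>n. (n + k - b choose n) (n + l - b choose n))\<close>. This is a Cholesky
  factorization, and inverting the triangular factor gives the coefficients of the Foulkes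
  characters.

  To compute the Gram matrix, sum over the nonzero entries first. The function \<open>(r k + 1)\<^sup>\<ell>\<close> is a
  product over the cycles of the underlying permutation \<open>\<pi>\<close>, so summing it against a character of
  the product of all entries leaves \<open>(k + 1)\<^bsup>cyc \<pi>\<^esup>\<close> for the trivial character and
  \<open>k\<^bsup>cyc \<pi>\<^esup>\<close> for each of the others. What remains are averages over full cycles \<open>c\<close> in the
  symmetric group. Removing one point at a time (cut and join) gives
  \<open>\<Sum>\<^sub>c \<Sum>\<^sub>q q\<^bsup>cyc (c \<pi>)\<^esup> s\<^sup>q = (n - 1)! s G\<^sub>\<pi>(s) / (1 - s)\<^bsup>n+2\<^esup>\<close>, where \<open>G\<^sub>\<pi>(s)\<close> is the
  product of \<open>1 - s\<^sup>m\<close> over the cycle lengths \<open>m\<close> of \<open>\<pi>\<close>. The polynomials \<open>G\<^sub>\<pi>(s) / (1 - s)\<close>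
  generate the hook characters of the symmetric group, and their orthogonality evaluates the terms
  with two full cycles. A product of an \<open>n\<close>-cycle and an \<open>(n - 1)\<close>-cycle is uniform on the odd
  permutations, which evaluates the other three terms.
\<close>

section \<open>Orbits of permutations\<close>

text \<open>The factor \<open>(n + k - b choose n)\<close> has n + 1 columns, but two full cycles
  only see the n hooks. The trivial character of the entry product yields the columns b = 0, ..., n
  - 1 and every other character the columns b = 1, ..., n, since replacing k + 1 by k shifts b by
  one. For n = 1 the two ranges complement each other. For larger n their average lacks half of
  column 0 and half of column n. These columns are the contributions of the trivial and the sign
  character of the symmetric group, which are all that survives when a permutation is made uniform
  on a coset of the alternating group; this is the task of the (n - 1)-cycles. The first and second
  sequence, and likewise the fourth and fifth, are weighted 2 to r - 2: this gives the r - 1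
  nontrivial characters of the entry product together the same weight as the trivial one. A
  complication at n = 2 is that an (n - 1)-cycle is the identity and does not determine its fixed
  point, which is therefore carried along as a marking.\<close>

abbreviation tr :: "'a \<Rightarrow> 'a \<Rightarrow> 'a \<Rightarrow> 'a" where "tr \<equiv> Transposition.transpose"

abbreviation pinv :: "('a \<Rightarrow> 'a) \<Rightarrow> 'a \<Rightarrow> 'a" where "pinv \<equiv> inv_into UNIV"

definition orbits :: "('a \<Rightarrow> 'a) \<Rightarrow> 'a set \<Rightarrow> 'a set set" where
  "orbits p A = orbit p ` A"

lemma self_in_orbit:
  assumes "p permutes A" "finite A"
  shows "x \<in> orbit p x"
proof -
  have "permutation p" using assms permutation_permutes by blast
  then show ?thesis by (rule permutation_self_in_orbit)
qed

lemma orbit_eq_iff: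
  assumes "p permutes A" "finite A"
  shows "orbit p x = orbit p y \<longleftrightarrow> x \<in> orbit p y"
proof
  assume "orbit p x = orbit p y"
  then show "x \<in> orbit p y" using self_in_orbit[OF assms, of x] by simp
next
  assume x: "x \<in> orbit p y"
  have y: "y \<in> orbit p x" by (rule orbit_swap[OF self_in_orbit[OF assms] x])
  show "orbit p x = orbit p y"
  proof (intro equalityI subsetI)
    show "z \<in> orbit p y" if "z \<in> orbit p x" for z using that x by (rule orbit_trans)
    show "z \<in> orbit p x" if "z \<in> orbit p y" for z using that y by (rule orbit_trans)
  qed
qed

lemma orbit_disjoint:
  assumes "p permutes A" "finite A" "orbit p x \<noteq> orbit p y"
  shows "orbit p x \<inter> orbit p y = {}"
proof (rule ccontr)
  assume "\<not> ?thesis"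
  then obtain z where "z \<in> orbit p x" "z \<in> orbit p y" by blast
  then have "orbit p z = orbit p x" "orbit p z = orbit p y"
    using orbit_eq_iff[OF assms(1,2)] by blast+
  with assms(3) show False by simp
qed

lemma orbits_disjoint:
  assumes "p permutes A" "finite A" "O1 \<in> orbits p A" "O2 \<in> orbits p A" "O1 \<noteq> O2"
  shows "O1 \<inter> O2 = {}"
  using assms orbit_disjoint[OF assms(1,2)] unfolding orbits_def by blast

lemma orbit_subset_carrier:
  assumes "p permutes A" "x \<in> A"
  shows "orbit p x \<subseteq> A"
  using assms by (rule permutes_orbit_subset)

lemma Union_orbits:
  assumes "p permutes A" "finite A"
  shows "\<Union> (orbits p A) = A"
  using orbit_subset_carrier[OF assms(1)] self_in_orbit[OF assms] unfolding orbits_def by blast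

lemma finite_orbits: "finite A \<Longrightarrow> finite (orbits p A)"
  by (simp add: orbits_def)

lemma finite_orbit_mem:
  assumes "p permutes A" "finite A" "C \<in> orbits p A"
  shows "finite C"
  by (rule finite_subset[OF Union_upper[OF assms(3)]]) (simp add: Union_orbits assms)

lemma orbits_nonempty_mem: "C \<in> orbits p A \<Longrightarrow> C \<noteq> {}"
  by (auto simp: orbits_def orbit_nonempty)

lemma orbits_mem_eq:
  assumes "p permutes A" "finite A" "C \<in> orbits p A" "x \<in> C"
  shows "orbit p x = C"
  using assms orbit_eq_iff[OF assms(1,2)] by (auto simp: orbits_def)

text \<open>The cycle is parametrised by the exponents 0, ..., m - 1, so that cutting it amounts to
  cutting an interval of exponents.\<close>

lemma orbit_cycle:
  assumes "p permutes A" "finite A"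
  shows "(p ^^ card (orbit p a)) a = a"
    and "orbit p a = (\<lambda>t. (p ^^ t) a) ` {..<card (orbit p a)}"
    and "inj_on (\<lambda>t. (p ^^ t) a) {..<card (orbit p a)}"
    and "0 < card (orbit p a)"
proof -
  let ?m = "funpow_dist1 p a a"
  have s: "a \<in> orbit p a" by (rule self_in_orbit[OF assms])
  have o: "orbit p a = (\<lambda>t. (p ^^ t) a) ` {0..<?m}"
    by (rule orbit_conv_funpow_dist1[OF s])
  have i: "inj_on (\<lambda>t. (p ^^ t) a) {0..<?m}"
    by (rule inj_on_funpow_dist1[OF s])
  have c: "card (orbit p a) = ?m" by (subst o) (simp add: card_image[OF i])
  show "(p ^^ card (orbit p a)) a = a" unfolding c by (rule funpow_dist1_prop[OF s])
  show "orbit p a = (\<lambda>t. (p ^^ t) a) ` {..<card (orbit p a)}"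
    unfolding c using o by (simp only: atLeast0LessThan)
  show "inj_on (\<lambda>t. (p ^^ t) a) {..<card (orbit p a)}"
    unfolding c using i by (simp only: atLeast0LessThan)
  show "0 < card (orbit p a)" unfolding c by simp
qed

section \<open>Cycles after multiplication by a transposition\<close>

lemma funpow_pred: "0 < m \<Longrightarrow> (f ^^ m) a = f ((f ^^ (m - 1)) a)"
  by (cases m) auto

lemma funpow_eq_on_segment:
  assumes "\<And>t. t < k \<Longrightarrow> f ((p ^^ t) a) = (p ^^ Suc t) a" "t \<le> k"
  shows "(f ^^ t) a = (p ^^ t) a"
  using assms(2)
proof (induction t)
  case (Suc t)
  then have "(f ^^ Suc t) a = f ((p ^^ t) a)" by simp
  also have "\<dots> = (p ^^ Suc t) a" by (rule assms(1)) (use Suc.prems in simp)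
  finally show ?case .
qed simp

lemma orbit_image_funpow:
  assumes "(f ^^ k) x = x" "0 < k"
  shows "orbit f x = (\<lambda>t. (f ^^ t) x) ` {..<k}"
  by (subst orbit_altdef_bounded[OF assms]) auto

text \<open>\<open>tr a j\<close> changes only the two arrows of \<open>p\<close> that end in
  \<open>a\<close> or \<open>j\<close>. On the walk from \<open>a\<close>, the arrow into
  \<open>j\<close> is bent back to \<open>a\<close>; on the walk from \<open>j\<close>, the arrow
  into \<open>a\<close> is bent back to \<open>j\<close>. So the arc of exponents below
  \<open>i\<close> and the arc from \<open>i\<close> on close up separately.\<close>

lemma orbit_tr_split:
  assumes p: "p permutes A" "finite A" and i: "0 < i" "i < card (orbit p a)"
  defines "j \<equiv> (p ^^ i) a" and "m \<equiv> card (orbit p a)"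
  shows "orbit (tr a j \<circ> p) a = (\<lambda>t. (p ^^ t) a) ` {..<i}"
    and "orbit (tr a j \<circ> p) j = (\<lambda>t. (p ^^ t) a) ` {i..<m}"
proof -
  note oc = orbit_cycle[OF p, of a, folded m_def]
  let ?f = "tr a j \<circ> p"
  have im: "i < m" using i by (simp add: m_def)
  have ne: "(p ^^ s) a \<noteq> (p ^^ t) a" if "s < m" "t < m" "s \<noteq> t" for s t
    using inj_onD[OF oc(3), of s t] that by auto
  have step: "?f ((p ^^ t) a) = (p ^^ Suc t) a" if "Suc t < m" "Suc t \<noteq> i" for t
  proof -
    have "(p ^^ Suc t) a \<noteq> a" using ne[of "Suc t" 0] that im by auto
    moreover have "(p ^^ Suc t) a \<noteq> j" using ne[of "Suc t" i] that im by (simp add: j_def)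
    ultimately show ?thesis by (simp add: Transposition.transpose_def)
  qed
  have A: "(?f ^^ t) a = (p ^^ t) a" if "t \<le> i - 1" for t
    by (rule funpow_eq_on_segment[of "i - 1"]) (use step i im that in auto)
  have pa: "p ((p ^^ (i - 1)) a) = j"
    using i by (cases i) (auto simp: j_def)
  have Ai: "(?f ^^ i) a = a"
  proof -
    have "(?f ^^ i) a = ?f ((?f ^^ (i - 1)) a)" by (rule funpow_pred[OF i(1)])
    also have "\<dots> = a" using A[of "i - 1"] pa by simp
    finally show ?thesis .
  qed
  show "orbit ?f a = (\<lambda>t. (p ^^ t) a) ` {..<i}"
    unfolding orbit_image_funpow[OF Ai i(1)] using A by (intro image_cong) auto
  have B: "(?f ^^ t) j = (p ^^ t) j" if "t \<le> m - i - 1" for t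
  proof (rule funpow_eq_on_segment[of "m - i - 1"])
    fix t assume t: "t < m - i - 1"
    have e: "(p ^^ t) j = (p ^^ (t + i)) a" for t by (simp add: j_def funpow_add)
    show "?f ((p ^^ t) j) = (p ^^ Suc t) j"
      unfolding e using step[of "t + i"] t by simp
  qed (use that in auto)
  have Bm: "(?f ^^ (m - i)) j = j"
  proof -
    have "(?f ^^ (m - i)) j = ?f ((?f ^^ (m - i - 1)) j)" by (rule funpow_pred) (use im in simp)
    also have "(?f ^^ (m - i - 1)) j = (p ^^ (m - 1)) a"
      using B[of "m - i - 1"] im by (simp add: j_def flip: funpow_add comp_apply[of "p ^^ _" "p ^^ _"])
    also have "p ((p ^^ (m - 1)) a) = a" using oc(1) oc(4) by (cases m) auto
    then have "?f ((p ^^ (m - 1)) a) = j" by simp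
    finally show ?thesis .
  qed
  have "orbit ?f j = (\<lambda>t. (?f ^^ t) j) ` {..<m - i}"
    by (rule orbit_image_funpow[OF Bm]) (use im in simp)
  also have "\<dots> = (\<lambda>t. (p ^^ (t + i)) a) ` {..<m - i}"
    using B by (intro image_cong) (auto simp: j_def funpow_add)
  also have "\<dots> = (\<lambda>t. (p ^^ t) a) ` ((\<lambda>t. t + i) ` {..<m - i})"
    by (simp add: image_image)
  also have "(\<lambda>t. t + i) ` {..<m - i} = {i..<m}"
    using im image_add_atLeastLessThan'[of i 0 "m - i"] by (simp add: atLeast0LessThan)
  finally show "orbit ?f j = (\<lambda>t. (p ^^ t) a) ` {i..<m}" .
qed

text \<open>The arrow that closes the cycle of \<open>a\<close> is redirected to \<open>j\<close>
  and the one that closes the cycle of \<open>j\<close> is redirected to \<open>a\<close>, so the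
  walk from \<open>a\<close> runs through both cycles before it returns.\<close>

lemma orbit_tr_join:
  assumes p: "p permutes A" "finite A" and aj: "a \<notin> orbit p j"
  shows "orbit (tr a j \<circ> p) a = orbit p a \<union> orbit p j"
proof -
  define m where "m = card (orbit p a)"
  define k where "k = card (orbit p j)"
  note oa = orbit_cycle[OF p, of a, folded m_def]
  note oj = orbit_cycle[OF p, of j, folded k_def]
  let ?f = "tr a j \<circ> p"
  have ja: "j \<notin> orbit p a" using aj orbit_eq_iff[OF p] self_in_orbit[OF p] by metis
  have inO: "(p ^^ t) x \<in> orbit p x" for t x
    by (intro funpow_in_orbit self_in_orbit[OF p])
  have nea: "(p ^^ t) a \<noteq> a" if "t < m" "0 < t" for t
    using inj_onD[OF oa(3), of t 0] oa(4) that by auto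
  have nej: "(p ^^ t) j \<noteq> j" if "t < k" "0 < t" for t
    using inj_onD[OF oj(3), of t 0] oj(4) that by auto
  have A: "(?f ^^ t) a = (p ^^ t) a" if "t \<le> m - 1" for t
  proof (rule funpow_eq_on_segment[of "m - 1"])
    fix t assume t: "t < m - 1"
    then have "(p ^^ Suc t) a \<noteq> a" "(p ^^ Suc t) a \<noteq> j"
      using nea[of "Suc t"] ja inO[of "Suc t" a] by auto
    then show "?f ((p ^^ t) a) = (p ^^ Suc t) a" by (simp add: Transposition.transpose_def)
  qed (rule that)
  have Am: "(?f ^^ m) a = j"
  proof -
    have "(?f ^^ m) a = ?f ((?f ^^ (m - 1)) a)" by (rule funpow_pred[OF oa(4)])
    also have "\<dots> = tr a j (p ((p ^^ (m - 1)) a))" using A[of "m - 1"] by simp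
    also have "p ((p ^^ (m - 1)) a) = a" using oa(1,4) by (cases m) auto
    also have "tr a j a = j" by simp
    finally show ?thesis .
  qed
  have B: "(?f ^^ t) j = (p ^^ t) j" if "t \<le> k - 1" for t
  proof (rule funpow_eq_on_segment[of "k - 1"])
    fix t assume t: "t < k - 1"
    then have "(p ^^ Suc t) j \<noteq> j" "(p ^^ Suc t) j \<noteq> a"
      using nej[of "Suc t"] aj inO[of "Suc t" j] by auto
    then show "?f ((p ^^ t) j) = (p ^^ Suc t) j" by (simp add: Transposition.transpose_def)
  qed (rule that)
  have Bk: "(?f ^^ k) j = a"
  proof -
    have "(?f ^^ k) j = ?f ((?f ^^ (k - 1)) j)" by (rule funpow_pred[OF oj(4)])
    also have "\<dots> = tr a j (p ((p ^^ (k - 1)) j))" using B[of "k - 1"] by simp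
    also have "p ((p ^^ (k - 1)) j) = j" using oj(1,4) by (cases k) auto
    also have "tr a j j = a" by simp
    finally show ?thesis .
  qed
  have C: "(?f ^^ (t + m)) a = (?f ^^ t) j" for t
  proof -
    have "(?f ^^ (t + m)) a = (?f ^^ t) ((?f ^^ m) a)" by (subst funpow_add) (rule comp_apply)
    then show ?thesis unfolding Am .
  qed
  have km: "(?f ^^ (k + m)) a = a" using C[of k] Bk by (rule trans)
  have "orbit ?f a = (\<lambda>t. (?f ^^ t) a) ` {..<k + m}"
    by (rule orbit_image_funpow[OF km]) (use oa(4) in simp)
  also have "{..<k + m} = {..<m} \<union> (\<lambda>t. t + m) ` {..<k}"
  proof -
    have "(\<lambda>t. t + m) ` {..<k} = {m..<k + m}"
      using image_add_atLeastLessThan'[of m 0 k] by (simp add: atLeast0LessThan)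
    then show ?thesis by auto
  qed
  also have "(\<lambda>t. (?f ^^ t) a) ` \<dots> = (\<lambda>t. (?f ^^ t) a) ` {..<m} \<union> (\<lambda>t. (?f ^^ (t + m)) a) ` {..<k}"
    by (simp only: image_Un image_image)
  also have "(\<lambda>t. (?f ^^ t) a) ` {..<m} = orbit p a"
    unfolding oa(2) using A by (intro image_cong) auto
  also have "(\<lambda>t. (?f ^^ (t + m)) a) ` {..<k} = orbit p j"
    unfolding oj(2) C using B by (intro image_cong) auto
  finally show ?thesis .
qed

lemma orbit_tr_other:
  assumes p: "p permutes A" "finite A" and x: "a \<notin> orbit p x" "j \<notin> orbit p x"
  shows "orbit (tr a j \<circ> p) x = orbit p x"
proof -
  define k where "k = card (orbit p x)"
  note ox = orbit_cycle[OF p, of x, folded k_def]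
  have "(p ^^ Suc t) x \<in> orbit p x" for t
    by (intro funpow_in_orbit self_in_orbit[OF p])
  then have st: "(tr a j \<circ> p) ((p ^^ t) x) = (p ^^ Suc t) x" for t
    using x by (auto simp: Transposition.transpose_def)
  have f: "((tr a j \<circ> p) ^^ t) x = (p ^^ t) x" for t
    by (rule funpow_eq_on_segment[of t, OF st]) auto
  show ?thesis unfolding orbit_altdef f ..
qed

lemma tr_comp_permutes:
  assumes "p permutes A" "a \<in> A" "j \<in> A"
  shows "(tr a j \<circ> p) permutes A"
  using assms by (intro permutes_compose permutes_swap_id) auto

lemma orbits_tr_join:
  assumes p: "p permutes A" "finite A" and A: "a \<in> A" "j \<in> A" and aj: "a \<notin> orbit p j"
  shows "orbits (tr a j \<circ> p) A = insert (orbit p a \<union> orbit p j) (orbits p A - {orbit p a, orbit p j})"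
    (is "?L = ?R")
proof -
  let ?f = "tr a j \<circ> p"
  have f: "?f permutes A" by (rule tr_comp_permutes[OF p(1) A])
  have J: "orbit ?f x = orbit p a \<union> orbit p j" if "x \<in> orbit p a \<union> orbit p j" for x
    using that orbit_tr_join[OF p aj] orbit_eq_iff[OF f p(2), of x a] by simp
  have O: "orbit ?f x = orbit p x" if "x \<notin> orbit p a \<union> orbit p j" for x
  proof (rule orbit_tr_other[OF p])
    show "a \<notin> orbit p x" "j \<notin> orbit p x"
      using that orbit_eq_iff[OF p, of x a] orbit_eq_iff[OF p, of x j]
        orbit_eq_iff[OF p, of a x] orbit_eq_iff[OF p, of j x] by auto
  qed
  have "?L \<subseteq> ?R"
  proof
    fix C assume "C \<in> ?L"
    then obtain x where x: "x \<in> A" "C = orbit ?f x" by (auto simp: orbits_def)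
    show "C \<in> ?R"
    proof (cases "x \<in> orbit p a \<union> orbit p j")
      case True then show ?thesis using J x by simp
    next
      case False
      then have "orbit p x \<noteq> orbit p a" "orbit p x \<noteq> orbit p j"
        using orbit_eq_iff[OF p] by auto
      then show ?thesis using O[OF False] x by (auto simp: orbits_def)
    qed
  qed
  moreover have "?R \<subseteq> ?L"
  proof
    fix C assume "C \<in> ?R"
    then consider "C = orbit p a \<union> orbit p j" | "C \<in> orbits p A" "C \<noteq> orbit p a" "C \<noteq> orbit p j"
      by auto
    then show "C \<in> ?L"
    proof cases
      case 1 then show ?thesis using orbit_tr_join[OF p aj] A by (auto simp: orbits_def)
    next
      case 2
      then obtain x where x: "x \<in> A" "C = orbit p x" by (auto simp: orbits_def)
      then have "x \<notin> orbit p a \<union> orbit p j" using 2 orbit_eq_iff[OF p] by auto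
      then show ?thesis using O x by (auto simp: orbits_def)
    qed
  qed
  ultimately show ?thesis by blast
qed

lemma orbits_tr_split:
  assumes p: "p permutes A" "finite A" and a: "a \<in> A" and i: "0 < i" "i < card (orbit p a)"
  defines "B1 \<equiv> (\<lambda>t. (p ^^ t) a) ` {..<i}" and "B2 \<equiv> (\<lambda>t. (p ^^ t) a) ` {i..<card (orbit p a)}"
  shows "orbits (tr a ((p ^^ i) a) \<circ> p) A = {B1, B2} \<union> (orbits p A - {orbit p a})" (is "?L = ?R")
    and "B1 \<inter> B2 = {}" "B1 \<union> B2 = orbit p a" "card B1 = i" "card B2 = card (orbit p a) - i"
proof -
  define j where "j = (p ^^ i) a"
  let ?f = "tr a j \<circ> p"
  note oc = orbit_cycle[OF p, of a]
  have jO: "j \<in> orbit p a" unfolding j_def by (intro funpow_in_orbit self_in_orbit[OF p])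
  have jA: "j \<in> A" using jO orbit_subset_carrier[OF p(1) a] by blast
  have f: "?f permutes A" by (rule tr_comp_permutes[OF p(1) a jA])
  have B1: "orbit ?f a = B1" and B2: "orbit ?f j = B2"
    using orbit_tr_split[OF p i] by (simp_all add: B1_def B2_def j_def)
  show un: "B1 \<union> B2 = orbit p a"
  proof -
    have "{..<i} \<union> {i..<card (orbit p a)} = {..<card (orbit p a)}" using i by auto
    from oc(2)[folded this, unfolded image_Un] show ?thesis
      unfolding B1_def B2_def by (rule sym)
  qed
  show "B1 \<inter> B2 = {}"
  proof -
    have "B1 \<inter> B2 = (\<lambda>t. (p ^^ t) a) ` ({..<i} \<inter> {i..<card (orbit p a)})"
      unfolding B1_def B2_def by (rule inj_on_image_Int[OF oc(3), symmetric]) (use i in auto)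
    also have "{..<i} \<inter> {i..<card (orbit p a)} = {}" by auto
    finally show ?thesis by simp
  qed
  show "card B1 = i" unfolding B1_def
    using card_image[OF inj_on_subset[OF oc(3), of "{..<i}"]] i by simp
  show "card B2 = card (orbit p a) - i"
  proof -
    have "{i..<card (orbit p a)} \<subseteq> {..<card (orbit p a)}" by auto
    from card_image[OF inj_on_subset[OF oc(3) this]] show ?thesis unfolding B2_def by simp
  qed
  have O: "orbit ?f x = orbit p x" if "x \<notin> orbit p a" for x
  proof (rule orbit_tr_other[OF p])
    show "a \<notin> orbit p x" using that orbit_eq_iff[OF p, of x a] orbit_eq_iff[OF p, of a x] by auto
    show "j \<notin> orbit p x"
      using that jO orbit_eq_iff[OF p, of j a] orbit_eq_iff[OF p, of j x] self_in_orbit[OF p, of x] by auto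
  qed
  have "?L \<subseteq> ?R"
  proof
    fix C assume "C \<in> ?L"
    then obtain x where x: "x \<in> A" "C = orbit ?f x" by (auto simp: orbits_def j_def)
    show "C \<in> ?R"
    proof (cases "x \<in> orbit p a")
      case True
      then have "x \<in> orbit ?f a \<or> x \<in> orbit ?f j" using un B1 B2 by blast
      then have "orbit ?f x = orbit ?f a \<or> orbit ?f x = orbit ?f j" using orbit_eq_iff[OF f p(2)] by blast
      then show ?thesis using x B1 B2 by blast
    next
      case False
      then have "orbit p x \<noteq> orbit p a" using orbit_eq_iff[OF p] by auto
      then show ?thesis using O[OF False] x by (auto simp: orbits_def)
    qed
  qed
  moreover have "?R \<subseteq> ?L"
  proof
    fix C assume "C \<in> ?R"
    then consider "C = B1" | "C = B2" | "C \<in> orbits p A" "C \<noteq> orbit p a"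
      by auto
    then show "C \<in> ?L"
    proof cases
      case 1 then show ?thesis using B1 a by (auto simp: orbits_def j_def)
    next
      case 2 then show ?thesis using B2 jA by (auto simp: orbits_def j_def)
    next
      case 3
      then obtain x where x: "x \<in> A" "C = orbit p x" by (auto simp: orbits_def)
      then have "x \<notin> orbit p a" using 3 orbit_eq_iff[OF p] by auto
      then show ?thesis using O x by (auto simp: orbits_def j_def)
    qed
  qed
  ultimately show "?L = ?R" by blast
qed

section \<open>Cycle counts and products over cycles\<close>

definition cyc :: "('a \<Rightarrow> 'a) \<Rightarrow> 'a set \<Rightarrow> nat" where
  "cyc p A = card (orbits p A)"

definition orbit_prod :: "(nat \<Rightarrow> 'b::comm_ring_1) \<Rightarrow> ('a \<Rightarrow> 'a) \<Rightarrow> 'a set \<Rightarrow> 'b" where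
  "orbit_prod w p A = (\<Prod>C\<in>orbits p A. w (card C))"

text \<open>On a singleton this is the identity, which starts the inductions below; the empty set
  has no full cycle.\<close>

definition full_cycles :: "'a set \<Rightarrow> ('a \<Rightarrow> 'a) set" where
  "full_cycles A = {c. c permutes A \<and> cyc c A = 1}"

lemma cyc_pos: "finite A \<Longrightarrow> A \<noteq> {} \<Longrightarrow> 0 < cyc p A"
  by (auto simp: cyc_def orbits_def card_gt_0_iff)

lemma finite_full_cycles: "finite A \<Longrightarrow> finite (full_cycles A)"
  unfolding full_cycles_def by (rule finite_subset[OF _ finite_permutations]) auto

section \<open>Adding a point to a permutation, as a fixed point or inside a cycle\<close>

lemma orbits_insert_fixed:
  assumes "p permutes A" "z \<notin> A"
  shows "orbits p (insert z A) = insert {z} (orbits p A)" "{z} \<notin> orbits p A"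
proof -
  have "orbit p z = {z}" using assms by (simp add: orbit_eq_singleton_iff permutes_not_in)
  then show "orbits p (insert z A) = insert {z} (orbits p A)" by (simp add: orbits_def)
  have "z \<notin> C" if "C \<in> orbits p A" for C
    using that orbit_subset_carrier[OF assms(1)] assms(2) unfolding orbits_def by blast
  then show "{z} \<notin> orbits p A" by blast
qed

lemma cyc_insert_fixed:
  assumes "p permutes A" "finite A" "z \<notin> A"
  shows "cyc p (insert z A) = Suc (cyc p A)"
  using orbits_insert_fixed[OF assms(1,3)] finite_orbits[OF assms(2)] by (simp add: cyc_def)

lemma orbit_prod_insert_fixed:
  assumes "p permutes A" "finite A" "z \<notin> A"
  shows "orbit_prod w p (insert z A) = w 1 * orbit_prod w p A"
  using orbits_insert_fixed[OF assms(1,3)] finite_orbits[OF assms(2)] by (simp add: orbit_prod_def)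

lemma orbits_insert_tr:
  assumes p: "p permutes A" "finite A" and z: "z \<notin> A" and b: "b \<in> A"
  shows "orbits (tr z b \<circ> p) (insert z A) = insert (insert z (orbit p b)) (orbits p A - {orbit p b})"
    and "insert z (orbit p b) \<notin> orbits p A" "z \<notin> orbit p b"
proof -
  have p': "p permutes insert z A" using p(1) by (rule permutes_imp_permutes_insert)
  have oz: "orbit p z = {z}" using p(1) z by (simp add: orbit_eq_singleton_iff permutes_not_in)
  show zb: "z \<notin> orbit p b" using orbit_subset_carrier[OF p(1) b] z by blast
  show "insert z (orbit p b) \<notin> orbits p A" using Union_orbits[OF p] z by blast
  have "orbits (tr z b \<circ> p) (insert z A) =
      insert (orbit p z \<union> orbit p b) (orbits p (insert z A) - {orbit p z, orbit p b})"
    by (rule orbits_tr_join[OF p']) (use zb b p(2) in auto)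
  then show "orbits (tr z b \<circ> p) (insert z A) = insert (insert z (orbit p b)) (orbits p A - {orbit p b})"
    using orbits_insert_fixed[OF p(1) z] oz by auto
qed

lemma orbit_in_orbits: "b \<in> A \<Longrightarrow> orbit p b \<in> orbits p A"
  by (simp add: orbits_def)

lemma orbit_prod_insert_tr:
  assumes p: "p permutes A" "finite A" and z: "z \<notin> A" and b: "b \<in> A"
  shows "orbit_prod w (tr z b \<circ> p) (insert z A) =
    w (Suc (card (orbit p b))) * (\<Prod>C\<in>orbits p A - {orbit p b}. w (card C))"
proof -
  note o = orbits_insert_tr[OF p z b]
  have "finite (orbit p b)" by (rule finite_orbit_mem[OF p orbit_in_orbits[OF b]])
  then have "card (insert z (orbit p b)) = Suc (card (orbit p b))" using o(3) by simp
  moreover have "insert z (orbit p b) \<notin> orbits p A - {orbit p b}" using o(2) by blast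
  ultimately show ?thesis
    unfolding orbit_prod_def o(1) using finite_orbits[OF p(2)] by (subst prod.insert) auto
qed

lemma cyc_insert_tr:
  assumes p: "p permutes A" "finite A" and z: "z \<notin> A" and b: "b \<in> A"
  shows "cyc (tr z b \<circ> p) (insert z A) = cyc p A"
proof -
  note o = orbits_insert_tr[OF p z b]
  have "insert z (orbit p b) \<notin> orbits p A - {orbit p b}" using o(2) by blast
  then have "cyc (tr z b \<circ> p) (insert z A) = Suc (card (orbits p A - {orbit p b}))"
    unfolding cyc_def o(1) using finite_orbits[OF p(2)] by (subst card_insert_disjoint) auto
  also have "\<dots> = cyc p A"
    unfolding cyc_def by (rule card.remove[symmetric]) (use finite_orbits[OF p(2)] orbit_in_orbits[OF b] in auto)
  finally show ?thesis .
qed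

lemma orbits_conj:
  assumes s: "s permutes A"
  shows "orbits (s \<circ> p \<circ> pinv s) A = (\<lambda>C. s ` C) ` orbits p A"
proof -
  have pw: "((s \<circ> p \<circ> pinv s) ^^ t) (s x) = s ((p ^^ t) x)" for t x
    by (induction t) (auto simp: permutes_inverses[OF s])
  have o: "orbit (s \<circ> p \<circ> pinv s) (s x) = s ` orbit p x" for x
    unfolding orbit_altdef by (auto simp only: pw)
  have "orbits (s \<circ> p \<circ> pinv s) A = orbits (s \<circ> p \<circ> pinv s) (s ` A)"
    by (simp add: permutes_image[OF s])
  also have "\<dots> = (\<lambda>C. s ` C) ` orbits p A"
    unfolding orbits_def image_image by (intro image_cong refl o)
  finally show ?thesis .
qed

lemma cyc_conj:
  assumes s: "s permutes A"
  shows "cyc (s \<circ> p \<circ> pinv s) A = cyc p A"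
  unfolding cyc_def orbits_conj[OF s]
  by (rule card_image) (use inj_image_eq_iff[OF permutes_inj[OF s]] in \<open>auto intro!: inj_onI\<close>)

lemma cyc_comp_commute:
  assumes "q permutes A"
  shows "cyc (p \<circ> q) A = cyc (q \<circ> p) A"
proof -
  have "q \<circ> p = q \<circ> (p \<circ> q) \<circ> pinv q"
    by (rule ext) (simp add: permutes_inverses[OF assms])
  then show ?thesis using cyc_conj[OF assms, of "p \<circ> q"] by simp
qed

lemma orbits_inv: "p permutes A \<Longrightarrow> finite A \<Longrightarrow> orbits (pinv p) A = orbits p A"
  unfolding orbits_def using orbit_inv_eq permutation_permutes by (metis (no_types, lifting) image_cong)

lemma cyc_inv: "p permutes A \<Longrightarrow> finite A \<Longrightarrow> cyc (pinv p) A = cyc p A"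
  by (simp add: cyc_def orbits_inv)

lemma inv_in_full_cycles: "finite A \<Longrightarrow> c \<in> full_cycles A \<Longrightarrow> pinv c \<in> full_cycles A"
  by (auto simp: full_cycles_def cyc_inv permutes_inv)

text \<open>A permutation of \<open>insert z A\<close> is uniquely \<open>tr z b\<close> after a
  permutation of \<open>A\<close>. The choice \<open>b = z\<close> leaves \<open>z\<close> fixed,
  which is a second cycle because \<open>A\<close> is nonempty; every other \<open>b\<close> threads
  \<open>z\<close> into an existing cycle and keeps the number of cycles.\<close>

lemma sum_full_cycles_insert:
  assumes A: "finite A" "A \<noteq> {}" "z \<notin> A"
  shows "(\<Sum>c\<in>full_cycles (insert z A). f c) = (\<Sum>b\<in>A. \<Sum>c\<in>full_cycles A. f (tr z b \<circ> c))"
proof -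
  let ?P = "\<lambda>A. {p. p permutes A}"
  have fc: "full_cycles B = {c \<in> ?P B. cyc c B = 1}" for B :: "'a set" by (auto simp: full_cycles_def)
  let ?g = "\<lambda>c. if cyc c (insert z A) = 1 then f c else 0"
  have "(\<Sum>c\<in>full_cycles (insert z A). f c) = (\<Sum>c\<in>?P (insert z A). ?g c)"
    unfolding fc by (rule sum.inter_filter) (simp add: finite_permutations A)
  also have "\<dots> = (\<Sum>b\<in>insert z A. \<Sum>c\<in>?P A. ?g (tr z b \<circ> c))"
    by (rule sum_over_permutations_insert[OF A(1,3)])
  also have "\<dots> = (\<Sum>c\<in>?P A. ?g (tr z z \<circ> c)) + (\<Sum>b\<in>A. \<Sum>c\<in>?P A. ?g (tr z b \<circ> c))"
    using A by simp
  also have "(\<Sum>c\<in>?P A. ?g (tr z z \<circ> c)) = 0"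
  proof (intro sum.neutral ballI)
    fix p assume "p \<in> ?P A"
    then have "cyc p (insert z A) \<noteq> 1"
      using cyc_pos[OF A(1,2), of p] cyc_insert_fixed[OF _ A(1,3), of p] by simp
    then show "?g (tr z z \<circ> p) = 0" by simp
  qed
  also have "(\<Sum>b\<in>A. \<Sum>c\<in>?P A. ?g (tr z b \<circ> c)) = (\<Sum>b\<in>A. \<Sum>c\<in>full_cycles A. f (tr z b \<circ> c))"
  proof (rule sum.cong[OF refl])
    fix b assume b: "b \<in> A"
    have "(\<Sum>c\<in>?P A. ?g (tr z b \<circ> c)) = (\<Sum>c\<in>?P A. if cyc c A = 1 then f (tr z b \<circ> c) else 0)"
      by (rule sum.cong[OF refl]) (simp add: cyc_insert_tr[OF _ A(1,3) b])
    also have "\<dots> = (\<Sum>c\<in>full_cycles A. f (tr z b \<circ> c))"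
      unfolding fc by (rule sum.inter_filter[symmetric]) (simp add: finite_permutations A)
    finally show "(\<Sum>c\<in>?P A. ?g (tr z b \<circ> c)) = (\<Sum>c\<in>full_cycles A. f (tr z b \<circ> c))" .
  qed
  finally show ?thesis by simp
qed

text \<open>Cut and join: a partner \<open>j = (p ^^ i) a\<close> in the cycle of \<open>a\<close>
  cuts it into lengths \<open>i\<close> and \<open>m - i\<close>, whereas each of the
  \<open>card C\<close> points of another cycle \<open>C\<close> joins \<open>C\<close> to it, with
  the same effect.\<close>

lemma sum_orbit_prod_tr:
  assumes p: "p permutes A" "finite A" and a: "a \<in> A"
  defines "m \<equiv> card (orbit p a)"
  shows "(\<Sum>j\<in>A - {a}. orbit_prod w (tr a j \<circ> p) A) =
    (\<Sum>i\<in>{1..<m}. w i * w (m - i)) * (\<Prod>C\<in>orbits p A - {orbit p a}. w (card C)) +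
    (\<Sum>C\<in>orbits p A - {orbit p a}. of_nat (card C) * (w (m + card C) *
       (\<Prod>D\<in>orbits p A - {orbit p a} - {C}. w (card D))))"
proof -
  let ?f = "\<lambda>j. orbit_prod w (tr a j \<circ> p) A"
  let ?O = "orbit p a"
  let ?R = "orbits p A - {?O}"
  note fo = finite_orbits[OF p(2), of p]
  note oc = orbit_cycle[OF p, of a, folded m_def]
  have aO: "a \<in> ?O" by (rule self_in_orbit[OF p])
  have OA: "?O \<subseteq> A" by (rule orbit_subset_carrier[OF p(1) a])
  have finO: "finite ?O" using OA p(2) finite_subset by blast
  have dec: "A - {a} = (?O - {a}) \<union> \<Union>?R"
  proof -
    have "A = ?O \<union> \<Union>?R" using Union_orbits[OF p] orbit_in_orbits[OF a, of p] by blast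
    moreover have "?O \<inter> \<Union>?R = {}"
      using orbits_disjoint[OF p orbit_in_orbits[OF a]] by blast
    ultimately show ?thesis using aO by blast
  qed
  have dj: "(?O - {a}) \<inter> \<Union>?R = {}"
    using orbits_disjoint[OF p orbit_in_orbits[OF a]] by blast
  have "sum ?f (A - {a}) = sum ?f (?O - {a}) + sum ?f (\<Union>?R)"
    unfolding dec by (rule sum.union_disjoint) (use dj finO p(2) Union_orbits[OF p] in \<open>auto intro: finite_subset[of _ A]\<close>)
  moreover have "sum ?f (?O - {a}) = (\<Sum>i\<in>{1..<m}. w i * w (m - i)) * (\<Prod>C\<in>?R. w (card C))"
  proof -
    have im: "?O - {a} = (\<lambda>t. (p ^^ t) a) ` {1..<m}"
    proof -
      have "{1..<m} = {..<m} - {0}" by auto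
      then have "(\<lambda>t. (p ^^ t) a) ` {1..<m} = (\<lambda>t. (p ^^ t) a) ` {..<m} - (\<lambda>t. (p ^^ t) a) ` {0}"
        using inj_on_image_set_diff[OF oc(3), of "{..<m}" "{0}"] oc(4) by auto
      then show ?thesis using oc(2) by simp
    qed
    have inj: "inj_on (\<lambda>t. (p ^^ t) a) {1..<m}"
      by (rule inj_on_subset[OF oc(3)]) auto
    have "sum ?f (?O - {a}) = (\<Sum>i\<in>{1..<m}. ?f ((p ^^ i) a))"
      unfolding im by (rule sum.reindex_cong[OF inj refl refl])
    also have "\<dots> = (\<Sum>i\<in>{1..<m}. w i * w (m - i) * (\<Prod>C\<in>?R. w (card C)))"
    proof (rule sum.cong[OF refl])
      fix i assume "i \<in> {1..<m}"
      then have i: "0 < i" "i < card ?O" by (auto simp: m_def)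
      define B1 where "B1 = (\<lambda>t. (p ^^ t) a) ` {..<i}"
      define B2 where "B2 = (\<lambda>t. (p ^^ t) a) ` {i..<card ?O}"
      note sp = orbits_tr_split[OF p a i, folded B1_def B2_def]
      have ne: "B1 \<noteq> {}" "B2 \<noteq> {}" using sp(4,5) i by auto
      have nin: "B1 \<notin> ?R" "B2 \<notin> ?R"
        using sp(3) ne orbits_disjoint[OF p orbit_in_orbits[OF a]] by blast+
      have b12: "B1 \<noteq> B2" using sp(2) ne by blast
      have "?f ((p ^^ i) a) = (\<Prod>C\<in>insert B1 (insert B2 ?R). w (card C))"
        unfolding orbit_prod_def sp(1) by simp
      also have "\<dots> = w i * (w (m - i) * (\<Prod>C\<in>?R. w (card C)))"
        using fo nin b12 sp(4,5) by (simp add: m_def)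
      finally show "?f ((p ^^ i) a) = w i * w (m - i) * (\<Prod>C\<in>?R. w (card C))"
        by (simp add: mult.assoc)
    qed
    finally show ?thesis by (simp add: sum_distrib_right)
  qed
  moreover have "sum ?f (\<Union>?R) = (\<Sum>C\<in>?R. of_nat (card C) * (w (m + card C) * (\<Prod>D\<in>?R - {C}. w (card D))))"
  proof -
    have "sum ?f (\<Union>?R) = (sum \<circ> sum) ?f ?R"
    proof (rule sum.Union_disjoint)
      show "\<forall>A'\<in>?R. finite A'" using finite_orbit_mem[OF p] by blast
      show "\<forall>A'\<in>?R. \<forall>B\<in>?R. A' \<noteq> B \<longrightarrow> A' \<inter> B = {}" using orbits_disjoint[OF p] by blast
    qed
    also have "(sum \<circ> sum) ?f ?R = (\<Sum>C\<in>?R. sum ?f C)" by simp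
    also have "\<dots> = (\<Sum>C\<in>?R. of_nat (card C) * (w (m + card C) * (\<Prod>D\<in>?R - {C}. w (card D))))"
    proof (rule sum.cong[OF refl])
      fix C assume C: "C \<in> ?R"
      have finC: "finite C" using C finite_orbit_mem[OF p] by blast
      have "?f j = w (m + card C) * (\<Prod>D\<in>?R - {C}. w (card D))" if j: "j \<in> C" for j
      proof -
        have jA: "j \<in> A" using j C Union_orbits[OF p] by blast
        have oj: "orbit p j = C" by (rule orbits_mem_eq[OF p _ j]) (use C in simp)
        have dj: "?O \<inter> C = {}" using orbits_disjoint[OF p orbit_in_orbits[OF a]] C by blast
        have aj: "a \<notin> orbit p j" using oj dj aO by blast
        have nin: "?O \<union> C \<notin> ?R - {C}"
          using orbits_disjoint[OF p orbit_in_orbits[OF a]] aO by blast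
        have "?f j = (\<Prod>D\<in>insert (?O \<union> C) (?R - {C}). w (card D))"
          unfolding orbit_prod_def orbits_tr_join[OF p a jA aj] oj
          by (simp only: Diff_insert2[of _ "?O" "{C}"])
        also have "\<dots> = w (card (?O \<union> C)) * (\<Prod>D\<in>?R - {C}. w (card D))"
          using fo nin by (subst prod.insert) auto
        also have "card (?O \<union> C) = m + card C"
          unfolding m_def using finO finC dj by (rule card_Un_disjoint)
        finally show ?thesis .
      qed
      then show "sum ?f C = of_nat (card C) * (w (m + card C) * (\<Prod>D\<in>?R - {C}. w (card D)))"
        by simp
    qed
    finally show ?thesis .
  qed
  ultimately show ?thesis by simp
qed

section \<open>Products with a full cycle\<close>

text \<open>The series is indexed by the base \<open>q\<close>, not by the number of cycles. An
  additional cycle multiplies the coefficient at \<open>q\<close> by \<open>q\<close>, so it acts as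
  the Euler operator \<open>fps_X * fps_deriv\<close>, and cut and join becomes a first-order
  differential recurrence.\<close>

definition cycle_gf :: "('a \<Rightarrow> 'a) \<Rightarrow> 'a set \<Rightarrow> real fps" where
  "cycle_gf p A = (\<Sum>c\<in>full_cycles A. Abs_fps (\<lambda>q. of_nat q ^ cyc (c \<circ> p) A))"

lemma fps_sum_mult_deriv:
  "fps_X * fps_deriv (\<Sum>x\<in>S. F x :: real fps) = (\<Sum>x\<in>S. fps_X * fps_deriv (F x))"
  by (simp add: fps_deriv_sum sum_distrib_left)

lemma tr_comp_full_cycle:
  assumes "c permutes A" "z \<notin> A"
  shows "tr z (c j) \<circ> c = c \<circ> tr z j"
proof
  fix x
  have "c z = z" using assms by (simp add: permutes_not_in)
  then show "(tr z (c j) \<circ> c) x = (c \<circ> tr z j) x"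
    using inj_eq[OF permutes_inj[OF assms(1)], of x z] inj_eq[OF permutes_inj[OF assms(1)], of x j]
    by (simp add: Transposition.transpose_def)
qed

lemma cycle_gf_insert_fixed:
  assumes p: "p permutes A" and A: "finite A" "A \<noteq> {}" "z \<notin> A"
  shows "cycle_gf p (insert z A) = of_nat (card A) * cycle_gf p A"
proof -
  have "cyc (tr z b \<circ> c \<circ> p) (insert z A) = cyc (c \<circ> p) A" if "b \<in> A" "c \<in> full_cycles A" for b c
  proof -
    have "(c \<circ> p) permutes A" using that p by (auto simp: full_cycles_def intro: permutes_compose)
    from cyc_insert_tr[OF this A(1,3) that(1)] show ?thesis by (simp add: comp_assoc)
  qed
  then show ?thesis
    unfolding cycle_gf_def sum_full_cycles_insert[OF A] by simp
qed

lemma cycle_gf_insert_tr: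
  assumes p: "p permutes A" and A: "finite A" "A \<noteq> {}" "z \<notin> A" and a: "a \<in> A"
  shows "cycle_gf (tr z a \<circ> p) (insert z A) =
    fps_X * fps_deriv (cycle_gf p A) + (\<Sum>j\<in>A - {a}. cycle_gf (tr a j \<circ> p) A)"
proof -
  define F :: "nat \<Rightarrow> real fps" where "F = (\<lambda>k. Abs_fps (\<lambda>q. of_nat q ^ k))"
  have FS: "F (Suc k) = fps_X * fps_deriv (F k)" for k
    unfolding F_def fps_mult_fps_X_deriv_shift by simp
  have gf: "cycle_gf p B = (\<Sum>c\<in>full_cycles B. F (cyc (c \<circ> p) B))" for p and B :: "'a set"
    by (simp add: cycle_gf_def F_def)
  let ?B = "insert z A"
  have "cycle_gf (tr z a \<circ> p) ?B =
      (\<Sum>b\<in>A. \<Sum>c\<in>full_cycles A. F (cyc (tr z b \<circ> c \<circ> (tr z a \<circ> p)) ?B))"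
    unfolding gf sum_full_cycles_insert[OF A] ..
  also have "\<dots> = (\<Sum>c\<in>full_cycles A. \<Sum>b\<in>A. F (cyc (tr z b \<circ> c \<circ> (tr z a \<circ> p)) ?B))"
    by (rule sum.swap)
  also have "\<dots> = (\<Sum>c\<in>full_cycles A. F (Suc (cyc (c \<circ> p) A)) + (\<Sum>j\<in>A - {a}. F (cyc (c \<circ> (tr a j \<circ> p)) A)))"
  proof (rule sum.cong[OF refl])
    fix c assume "c \<in> full_cycles A"
    then have c: "c permutes A" by (simp add: full_cycles_def)
    have cp: "(c \<circ> p) permutes A" by (rule permutes_compose[OF p c])
    have "(\<Sum>b\<in>A. F (cyc (tr z b \<circ> c \<circ> (tr z a \<circ> p)) ?B)) =
        (\<Sum>j\<in>A. F (cyc (tr z (c j) \<circ> c \<circ> (tr z a \<circ> p)) ?B))"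
      by (rule sum.reindex_bij_betw[OF permutes_imp_bij[OF c], symmetric])
    also have "\<dots> = (\<Sum>j\<in>A. F (cyc (c \<circ> (tr z j \<circ> tr z a) \<circ> p) ?B))"
      by (simp only: tr_comp_full_cycle[OF c A(3)] comp_assoc)
    also have "\<dots> = F (cyc (c \<circ> (tr z a \<circ> tr z a) \<circ> p) ?B) +
        (\<Sum>j\<in>A - {a}. F (cyc (c \<circ> (tr z j \<circ> tr z a) \<circ> p) ?B))"
      by (rule sum.remove[OF A(1) a])
    also have "cyc (c \<circ> (tr z a \<circ> tr z a) \<circ> p) ?B = Suc (cyc (c \<circ> p) A)"
      using cyc_insert_fixed[OF cp A(1,3)] by simp
    also have "(\<Sum>j\<in>A - {a}. F (cyc (c \<circ> (tr z j \<circ> tr z a) \<circ> p) ?B)) =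
        (\<Sum>j\<in>A - {a}. F (cyc (c \<circ> (tr a j \<circ> p)) A))"
    proof (rule sum.cong[OF refl])
      fix j assume j: "j \<in> A - {a}"
      have tt: "tr z j \<circ> tr z a = tr z a \<circ> tr a j"
        using j a A(3) by (auto simp: fun_eq_iff Transposition.transpose_def)
      have "c \<circ> (tr z j \<circ> tr z a) \<circ> p = (c \<circ> tr z a) \<circ> (tr a j \<circ> p)"
        unfolding tt by (simp only: comp_assoc)
      also have "\<dots> = tr z (c a) \<circ> (c \<circ> (tr a j \<circ> p))"
        unfolding tr_comp_full_cycle[OF c A(3), symmetric] by (simp only: comp_assoc)
      finally have e: "c \<circ> (tr z j \<circ> tr z a) \<circ> p = tr z (c a) \<circ> (c \<circ> (tr a j \<circ> p))" .
      have "(c \<circ> (tr a j \<circ> p)) permutes A"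
        using j a by (intro permutes_compose[OF _ c] tr_comp_permutes[OF p]) auto
      moreover have "c a \<in> A" using a permutes_in_image[OF c] by simp
      ultimately show "F (cyc (c \<circ> (tr z j \<circ> tr z a) \<circ> p) ?B) = F (cyc (c \<circ> (tr a j \<circ> p)) A)"
        unfolding e using cyc_insert_tr[OF _ A(1,3)] by simp
    qed
    finally show "(\<Sum>b\<in>A. F (cyc (tr z b \<circ> c \<circ> (tr z a \<circ> p)) ?B)) =
      F (Suc (cyc (c \<circ> p) A)) + (\<Sum>j\<in>A - {a}. F (cyc (c \<circ> (tr a j \<circ> p)) A))" .
  qed
  also have "\<dots> = fps_X * fps_deriv (cycle_gf p A) + (\<Sum>j\<in>A - {a}. cycle_gf (tr a j \<circ> p) A)"
    unfolding sum.distrib FS gf fps_sum_mult_deriv by (subst (2) sum.swap) (rule refl)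
  finally show ?thesis .
qed

section \<open>The differential recurrence for the products of 1 - s^m\<close>

abbreviation cyc_weight :: "nat \<Rightarrow> real fps" where "cyc_weight \<equiv> \<lambda>k. 1 - fps_X ^ k"

lemma fps_X_deriv_X_power: "fps_X * fps_deriv (fps_X ^ k :: real fps) = of_nat k * fps_X ^ k"
proof (induction k)
  case (Suc k)
  have "fps_X * fps_deriv (fps_X ^ Suc k :: real fps) = fps_X * (fps_X * fps_deriv (fps_X ^ k)) + fps_X * fps_X ^ k"
    by (simp only: power_Suc fps_deriv_mult fps_deriv_fps_X mult_1_left mult_1_right distrib_left)
  also have "\<dots> = of_nat (Suc k) * fps_X ^ Suc k"
    unfolding Suc.IH by (simp only: of_nat_Suc power_Suc algebra_simps mult_1_left mult_1_right)
  finally show ?case .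
qed simp

lemma fps_X_deriv_prod:
  fixes k :: "'b \<Rightarrow> nat"
  assumes "finite R"
  shows "fps_X * fps_deriv (\<Prod>C\<in>R. 1 - fps_X ^ k C :: real fps) =
    - (\<Sum>C\<in>R. of_nat (k C) * (fps_X ^ k C * (\<Prod>D\<in>R - {C}. 1 - fps_X ^ k D)))"
  using assms
proof (induction R rule: finite_induct)
  case (insert x R)
  let ?w = "\<lambda>C. 1 - fps_X ^ k C :: real fps"
  have dw: "fps_X * fps_deriv (?w x) = - (of_nat (k x) * fps_X ^ k x)"
    by (simp only: fps_deriv_sub fps_deriv_1 right_diff_distrib mult_zero_right fps_X_deriv_X_power) simp
  have "(\<Sum>C\<in>R. of_nat (k C) * (fps_X ^ k C * (\<Prod>D\<in>insert x R - {C}. ?w D))) =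
      (\<Sum>C\<in>R. ?w x * (of_nat (k C) * (fps_X ^ k C * (\<Prod>D\<in>R - {C}. ?w D))))"
  proof (rule sum.cong[OF refl])
    fix C assume "C \<in> R"
    then have "insert x R - {C} = insert x (R - {C})" using insert.hyps by auto
    then show "of_nat (k C) * (fps_X ^ k C * (\<Prod>D\<in>insert x R - {C}. ?w D)) =
      ?w x * (of_nat (k C) * (fps_X ^ k C * (\<Prod>D\<in>R - {C}. ?w D)))"
      using insert.hyps by (simp add: mult.left_commute)
  qed
  then have s: "(\<Sum>C\<in>insert x R. of_nat (k C) * (fps_X ^ k C * (\<Prod>D\<in>insert x R - {C}. ?w D))) =
      of_nat (k x) * (fps_X ^ k x * (\<Prod>D\<in>R. ?w D)) +
      ?w x * (\<Sum>C\<in>R. of_nat (k C) * (fps_X ^ k C * (\<Prod>D\<in>R - {C}. ?w D)))"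
    using insert.hyps by (simp add: sum_distrib_left)
  have "fps_X * fps_deriv (\<Prod>C\<in>insert x R. ?w C) =
      ?w x * (fps_X * fps_deriv (\<Prod>C\<in>R. ?w C)) + (fps_X * fps_deriv (?w x)) * (\<Prod>C\<in>R. ?w C)"
    using insert.hyps by (simp add: algebra_simps)
  then have "fps_X * fps_deriv (\<Prod>C\<in>insert x R. ?w C) =
      ?w x * - (\<Sum>C\<in>R. of_nat (k C) * (fps_X ^ k C * (\<Prod>D\<in>R - {C}. ?w D))) +
      - (of_nat (k x) * fps_X ^ k x) * (\<Prod>C\<in>R. ?w C)"
    unfolding insert.IH dw .
  then show ?case unfolding s
    by (simp only: minus_add_distrib mult_minus_right mult_minus_left add.commute mult.assoc)
qed simp

text \<open>The factor \<open>1 - fps_X\<close> sums the geometric series in the cut terms; only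
  this multiple of the cut sum enters the recurrence.\<close>

lemma sum_pair_weights:
  assumes "0 < m"
  shows "(1 - fps_X) * (\<Sum>i\<in>{1..<m}. cyc_weight i * cyc_weight (m - i)) =
    (1 - fps_X) * (of_nat m - 1) * (1 + fps_X ^ m) - 2 * (fps_X - fps_X ^ m)"
proof -
  have "(\<Sum>i\<in>{1..<m}. cyc_weight i * cyc_weight (m - i)) =
      (\<Sum>i\<in>{1..<m}. (1 + fps_X ^ m) - fps_X ^ i - fps_X ^ (m - i))"
  proof (rule sum.cong[OF refl])
    fix i assume "i \<in> {1..<m}"
    then have "fps_X ^ i * fps_X ^ (m - i) = (fps_X ^ m :: real fps)" by (simp flip: power_add)
    then show "cyc_weight i * cyc_weight (m - i) = (1 + fps_X ^ m) - fps_X ^ i - fps_X ^ (m - i)"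
      by (simp add: algebra_simps)
  qed
  also have "\<dots> = (of_nat m - 1) * (1 + fps_X ^ m) - (\<Sum>i\<in>{1..<m}. fps_X ^ i) - (\<Sum>i\<in>{1..<m}. fps_X ^ (m - i))"
    using assms by (simp add: sum_subtractf of_nat_diff Suc_le_eq)
  also have "(\<Sum>i\<in>{1..<m}. fps_X ^ (m - i)) = (\<Sum>i\<in>{1..<m}. fps_X ^ i :: real fps)"
    by (rule sum.reindex_bij_witness[of _ "\<lambda>i. m - i" "\<lambda>i. m - i"]) auto
  finally have e: "(\<Sum>i\<in>{1..<m}. cyc_weight i * cyc_weight (m - i)) =
      (of_nat m - 1) * (1 + fps_X ^ m) - 2 * (\<Sum>i\<in>{1..<m}. fps_X ^ i)" by simp
  have g: "(1 - fps_X) * (\<Sum>i\<in>{1..<m}. fps_X ^ i) = (fps_X - fps_X ^ m :: real fps)"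
    using assms
  proof (induction m rule: nat_induct_non_zero)
    case (Suc m)
    then have "{1..<Suc m} = insert m {1..<m}" by auto
    then have "(1 - fps_X) * (\<Sum>i\<in>{1..<Suc m}. fps_X ^ i) =
        (1 - fps_X) * fps_X ^ m + ((1 - fps_X) * (\<Sum>i\<in>{1..<m}. fps_X ^ i) :: real fps)"
      by (simp add: distrib_left)
    then show ?case unfolding Suc.IH by (simp add: algebra_simps)
  qed simp
  have "(1 - fps_X) * (\<Sum>i\<in>{1..<m}. cyc_weight i * cyc_weight (m - i)) =
    (1 - fps_X) * (of_nat m - 1) * (1 + fps_X ^ m) - 2 * ((1 - fps_X) * (\<Sum>i\<in>{1..<m}. fps_X ^ i))"
    unfolding e by (simp only: algebra_simps)
  then show ?thesis unfolding g .
qed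

text \<open>\<open>x\<close> stands for \<open>fps_X\<close>, \<open>Y\<close> for its power at the
  length of the marked cycle, \<open>M\<close> for the product over the other cycles,
  \<open>S\<close> for the negated Euler derivative of \<open>M\<close>, and \<open>T\<close> for
  the cut sum, known only after multiplication by \<open>1 - x\<close>. The part of the join terms
  with \<open>S\<close> cancels the derivative of \<open>M\<close>.\<close>

lemma orbit_prod_recurrence_aux:
  fixes x Y M S T n m :: "'b::idom"
  assumes "(1 - x) * T = (1 - x) * (m - 1) * (1 + Y) - 2 * (x - Y)"
  shows "(1 - x) * ((1 - Y) * M + (- (m * Y * M) - (1 - Y) * S)) + (n + 2) * x * ((1 - Y) * M) +
      (1 - x) * (T * M + ((n - m) * M + (1 - Y) * S)) = n * ((1 - x * Y) * M)"
proof -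
  have "(1 - x) * ((1 - Y) * M + (- (m * Y * M) - (1 - Y) * S)) + (n + 2) * x * ((1 - Y) * M) +
      (1 - x) * (T * M + ((n - m) * M + (1 - Y) * S)) =
    (1 - x) * ((1 - Y) * M - m * Y * M) + (n + 2) * x * ((1 - Y) * M) +
      ((1 - x) * T) * M + (1 - x) * ((n - m) * M)"
    by (simp add: algebra_simps)
  also have "\<dots> = n * ((1 - x * Y) * M)"
    unfolding assms by (simp add: algebra_simps)
  finally show ?thesis .
qed

text \<open>This is \<open>cycle_gf_insert_tr\<close> after substitution of the closed form, with
  common factors removed; the term with \<open>card A + 2\<close> comes from differentiating the
  power of \<open>1 - fps_X\<close>. The right side is the product for the permutation in which the
  cycle of \<open>a\<close> has grown by one point.\<close>

lemma orbit_prod_recurrence: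
  assumes p: "p permutes A" "finite A" and a: "a \<in> A"
  defines "G \<equiv> \<lambda>p. orbit_prod cyc_weight p A"
  shows "(1 - fps_X) * (G p + fps_X * fps_deriv (G p)) + of_nat (card A + 2) * fps_X * G p +
      (1 - fps_X) * (\<Sum>j\<in>A - {a}. G (tr a j \<circ> p)) =
    of_nat (card A) * ((1 - fps_X ^ Suc (card (orbit p a))) * (\<Prod>C\<in>orbits p A - {orbit p a}. cyc_weight (card C)))"
proof -
  define m where "m = card (orbit p a)"
  define R where "R = orbits p A - {orbit p a}"
  define M where "M = (\<Prod>C\<in>R. cyc_weight (card C))"
  define S where "S = (\<Sum>C\<in>R. of_nat (card C) * (fps_X ^ card C * (\<Prod>D\<in>R - {C}. cyc_weight (card D))))"
  define T where "T = (\<Sum>i\<in>{1..<m}. cyc_weight i * cyc_weight (m - i))"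
  define Y :: "real fps" where "Y = fps_X ^ m"
  have finR: "finite R" using finite_orbits[OF p(2)] by (simp add: R_def)
  have m0: "0 < m" unfolding m_def by (rule orbit_cycle(4)[OF p])
  have G: "G p = (1 - Y) * M"
    unfolding G_def orbit_prod_def M_def R_def Y_def m_def
    by (rule prod.remove[OF finite_orbits[OF p(2)] orbit_in_orbits[OF a]])
  have dM: "fps_X * fps_deriv M = - S" unfolding M_def S_def by (rule fps_X_deriv_prod[OF finR])
  have dY: "fps_X * fps_deriv Y = of_nat m * Y"
    unfolding Y_def by (rule fps_X_deriv_X_power)
  have cardA: "of_nat (card A) = (of_nat m + (\<Sum>C\<in>R. of_nat (card C)) :: real fps)"
  proof -
    have "card A = card (\<Union>(orbits p A))" by (simp add: Union_orbits[OF p])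
    also have "\<dots> = (\<Sum>C\<in>orbits p A. card C)"
      using finite_orbit_mem[OF p] orbits_disjoint[OF p]
      by (intro card_Union_disjoint) (auto simp: pairwise_def disjnt_def)
    also have "\<dots> = m + (\<Sum>C\<in>R. card C)"
      unfolding m_def R_def by (rule sum.remove[OF finite_orbits[OF p(2)] orbit_in_orbits[OF a]])
    finally show ?thesis by (simp only: of_nat_add of_nat_sum)
  qed
  have "(\<Sum>C\<in>R. of_nat (card C) * (cyc_weight (m + card C) * (\<Prod>D\<in>R - {C}. cyc_weight (card D)))) =
      (\<Sum>C\<in>R. of_nat (card C) * M + (1 - Y) *
        (of_nat (card C) * (fps_X ^ card C * (\<Prod>D\<in>R - {C}. cyc_weight (card D)))))"
  proof (rule sum.cong[OF refl])
    fix C assume "C \<in> R"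
    then have M: "M = cyc_weight (card C) * (\<Prod>D\<in>R - {C}. cyc_weight (card D))"
      unfolding M_def by (rule prod.remove[OF finR])
    show "of_nat (card C) * (cyc_weight (m + card C) * (\<Prod>D\<in>R - {C}. cyc_weight (card D))) =
      of_nat (card C) * M + (1 - Y) *
        (of_nat (card C) * (fps_X ^ card C * (\<Prod>D\<in>R - {C}. cyc_weight (card D))))"
      unfolding power_add Y_def[symmetric] unfolding M by (simp add: algebra_simps)
  qed
  also have "\<dots> = (of_nat (card A) - of_nat m) * M + (1 - Y) * S"
    unfolding sum.distrib S_def cardA by (simp add: sum_distrib_left sum_distrib_right)
  finally have sG: "(\<Sum>j\<in>A - {a}. G (tr a j \<circ> p)) = T * M + ((of_nat (card A) - of_nat m) * M + (1 - Y) * S)"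
    unfolding G_def sum_orbit_prod_tr[OF p a] m_def[symmetric] R_def[symmetric] M_def[symmetric] T_def[symmetric]
    by simp
  have uT: "(1 - fps_X) * T = (1 - fps_X) * (of_nat m - 1) * (1 + Y) - 2 * (fps_X - Y)"
    unfolding T_def Y_def by (rule sum_pair_weights[OF m0])
  have dG: "fps_X * fps_deriv (G p) = - (of_nat m * Y * M) - (1 - Y) * S"
  proof -
    have "fps_X * fps_deriv (G p) = (1 - Y) * (fps_X * fps_deriv M) - (fps_X * fps_deriv Y) * M"
      unfolding G by (simp add: algebra_simps)
    then show ?thesis unfolding dM dY by (simp add: algebra_simps)
  qed
  have "of_nat (card A + 2) = (of_nat (card A) + 2 :: real fps)" by simp
  then have "(1 - fps_X) * (G p + fps_X * fps_deriv (G p)) + of_nat (card A + 2) * fps_X * G p +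
      (1 - fps_X) * (\<Sum>j\<in>A - {a}. G (tr a j \<circ> p)) = of_nat (card A) * ((1 - fps_X * Y) * M)"
    unfolding sG dG unfolding G using orbit_prod_recurrence_aux[OF uT] by (simp only:)
  then show ?thesis by (simp only: Y_def m_def M_def R_def power_Suc)
qed

text \<open>Induction by deleting a point \<open>z\<close>. If \<open>p\<close> fixes
  \<open>z\<close>, its own factor \<open>1 - fps_X\<close> accounts for the additional power on the
  left, and the insertions of \<open>z\<close> into the full cycle extend the factorial. Otherwise
  the differential recurrence applies.\<close>

theorem cycle_gf_formula:
  assumes "finite A" "A \<noteq> {}" "p permutes A"
  shows "(1 - fps_X) ^ (card A + 2) * cycle_gf p A =
    fact (card A - 1) * fps_X * orbit_prod cyc_weight p A"
  using assms
proof (induction A arbitrary: p rule: finite_ne_induct)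
  case (singleton x)
  then have p: "p = id" by (metis permutes_sing)
  have o: "orbits id {x} = {{x}}" by (simp add: orbits_def orbit_eq_singleton_iff)
  have fc: "full_cycles {x} = {id}"
    by (auto simp: full_cycles_def cyc_def o permutes_sing permutes_id)
  \<comment> \<open>The series with coefficients q is X / (1 - X)^2, the Euler operator applied to
    the geometric series. The third factor 1 - X on the left matches the product over the single
    cycle.\<close>
  have "cycle_gf p {x} = Abs_fps of_nat" by (simp add: cycle_gf_def p fc cyc_def o)
  also have "\<dots> = fps_X * fps_deriv (Abs_fps (\<lambda>_. 1))"
    by (simp only: fps_mult_fps_X_deriv_shift) simp
  finally have g: "cycle_gf p {x} = fps_X * fps_deriv (Abs_fps (\<lambda>_. 1))" .
  have i: "(1 - fps_X) * Abs_fps (\<lambda>_. 1) = (1 :: real fps)"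
    by (rule fps_ext) (simp add: algebra_simps fps_X_mult_nth)
  have "fps_deriv ((1 - fps_X) * Abs_fps (\<lambda>_. 1 :: real)) = 0" unfolding i by simp
  then have "(1 - fps_X) * fps_deriv (Abs_fps (\<lambda>_. 1 :: real)) = Abs_fps (\<lambda>_. 1)" by simp
  then have "(1 - fps_X) ^ 2 * fps_deriv (Abs_fps (\<lambda>_. 1 :: real)) = 1"
    using i by (simp add: power2_eq_square mult.assoc)
  then have "(1 - fps_X) ^ 2 * cycle_gf p {x} = fps_X" unfolding g by (simp add: mult.left_commute)
  then have "(1 - fps_X) * ((1 - fps_X) ^ 2 * cycle_gf p {x}) = (1 - fps_X) * fps_X" by simp
  moreover have "orbit_prod cyc_weight p {x} = 1 - fps_X" by (simp add: orbit_prod_def p o)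
  moreover have "(1 - fps_X) ^ (card {x} + 2) * cycle_gf p {x} = (1 - fps_X) * ((1 - fps_X) ^ 2 * cycle_gf p {x})"
    by (simp add: numeral_3_eq_3 numeral_2_eq_2 mult.assoc)
  ultimately show ?case by simp
next
  case (insert z A)
  define N where "N = card A"
  have N0: "0 < N" using insert.hyps by (simp add: N_def card_gt_0_iff)
  have cz: "card (insert z A) = Suc N" using insert.hyps by (simp add: N_def)
  have fN: "(fact N :: real fps) = of_nat N * fact (N - 1)" using N0 by (cases N) auto
  have "p \<in> {p. p permutes insert z A}" using insert.prems by simp
  then obtain b q where bq: "b \<in> insert z A" "q permutes A" "p = tr z b \<circ> q"
    unfolding permutes_insert by auto
  show ?case
  proof (cases "b = z")
    case True
    then have p: "p = q" using bq by simp
    have "(1 - fps_X) ^ (card (insert z A) + 2) * cycle_gf p (insert z A) =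
        of_nat N * (1 - fps_X) * ((1 - fps_X) ^ (card A + 2) * cycle_gf q A)"
      unfolding p cz cycle_gf_insert_fixed[OF bq(2) insert.hyps(1-3)] by (simp add: N_def)
    also have "\<dots> = of_nat N * (1 - fps_X) * (fact (N - 1) * fps_X * orbit_prod cyc_weight q A)"
      unfolding insert.IH[OF bq(2)] N_def ..
    also have "\<dots> = fact N * fps_X * orbit_prod cyc_weight p (insert z A)"
      unfolding p orbit_prod_insert_fixed[OF bq(2) insert.hyps(1,3)] fN by simp
    finally show ?thesis by (simp add: cz)
  next
    case False
    then have b: "b \<in> A" using bq by simp
    define u :: "real fps" where "u = 1 - fps_X"
    define G where "G = (\<lambda>p. orbit_prod cyc_weight p A)"
    have IH: "u ^ (N + 2) * cycle_gf p A = fact (N - 1) * fps_X * G p" if "p permutes A" for p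
      unfolding u_def N_def G_def by (rule insert.IH[OF that])
    define U where "U = cycle_gf q A"
    have du: "fps_deriv u = - 1" by (simp add: u_def)
    have dp: "fps_deriv (u ^ (N + 2)) = - (of_nat (N + 2) * u ^ (N + 1))"
      unfolding fps_deriv_power' du by (simp only: mult_minus_right mult_minus_left mult_1_right) simp
    have p3: "u ^ (N + 3) = u * u ^ (N + 2)" "u ^ (N + 2) = u * u ^ (N + 1)"
      by (simp_all only: power_Suc[symmetric]) (simp_all add: numeral_3_eq_3)
    \<comment> \<open>The induction hypothesis describes \<open>u ^ (N + 2) * U\<close> and not
      \<open>U\<close>; the product rule, multiplied by \<open>u\<close>, isolates the derivative of
      \<open>U\<close>.\<close>
    have "u * fps_deriv (u ^ (N + 2) * U) = u ^ (N + 3) * fps_deriv U - of_nat (N + 2) * (u ^ (N + 2) * U)"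
      unfolding fps_deriv_mult dp unfolding p3
      by (simp only: algebra_simps mult_minus_left mult_minus_right) simp
    then have dU: "u ^ (N + 3) * fps_deriv U =
        u * fps_deriv (u ^ (N + 2) * U) + of_nat (N + 2) * (u ^ (N + 2) * U)" by simp
    have V: "u ^ (N + 2) * U = fact (N - 1) * fps_X * G q" unfolding U_def by (rule IH[OF bq(2)])
    have ff: "(fact (N - 1) :: real fps) = fps_const (fact (N - 1))"
      using fps_of_nat[of "fact (N - 1)", where ?'a = real] by (simp only: of_nat_fact)
    have dV: "fps_deriv (u ^ (N + 2) * U) = fact (N - 1) * (G q + fps_X * fps_deriv (G q))"
      unfolding V unfolding ff
      by (simp only: mult.assoc fps_deriv_const fps_deriv_mult fps_deriv_fps_X mult_1_left mult_zero_left
          add_0_left add.commute)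
    have "u ^ (N + 3) * (\<Sum>j\<in>A - {b}. cycle_gf (tr b j \<circ> q) A) =
        (\<Sum>j\<in>A - {b}. u * (u ^ (N + 2) * cycle_gf (tr b j \<circ> q) A))"
      unfolding p3(1) by (simp only: sum_distrib_left mult.assoc)
    also have "\<dots> = (\<Sum>j\<in>A - {b}. u * (fact (N - 1) * fps_X * G (tr b j \<circ> q)))"
    proof (rule sum.cong[OF refl])
      fix j assume "j \<in> A - {b}"
      then have "(tr b j \<circ> q) permutes A" using b by (intro tr_comp_permutes[OF bq(2)]) auto
      then show "u * (u ^ (N + 2) * cycle_gf (tr b j \<circ> q) A) = u * (fact (N - 1) * fps_X * G (tr b j \<circ> q))"
        by (simp only: IH)
    qed
    also have "\<dots> = fact (N - 1) * fps_X * (u * (\<Sum>j\<in>A - {b}. G (tr b j \<circ> q)))"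
      by (simp only: sum_distrib_left mult_ac)
    finally have sU: "u ^ (N + 3) * (\<Sum>j\<in>A - {b}. cycle_gf (tr b j \<circ> q) A) =
        fact (N - 1) * fps_X * (u * (\<Sum>j\<in>A - {b}. G (tr b j \<circ> q)))" .
    have "u ^ (N + 3) * cycle_gf p (insert z A) =
        fps_X * (u ^ (N + 3) * fps_deriv U) + u ^ (N + 3) * (\<Sum>j\<in>A - {b}. cycle_gf (tr b j \<circ> q) A)"
      unfolding bq(3) cycle_gf_insert_tr[OF bq(2) insert.hyps(1-3) b] U_def by (simp only: algebra_simps)
    also have "\<dots> = fact (N - 1) * fps_X * (u * (G q + fps_X * fps_deriv (G q)) + of_nat (N + 2) * fps_X * G q +
        u * (\<Sum>j\<in>A - {b}. G (tr b j \<circ> q)))"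
      unfolding dU dV sU unfolding V by (simp only: algebra_simps)
    also have "\<dots> = fact (N - 1) * fps_X * (of_nat N * orbit_prod cyc_weight p (insert z A))"
      unfolding bq(3) orbit_prod_insert_tr[OF bq(2) insert.hyps(1,3) b] u_def G_def N_def
        orbit_prod_recurrence[OF bq(2) insert.hyps(1) b] ..
    also have "\<dots> = fact N * fps_X * orbit_prod cyc_weight p (insert z A)"
      unfolding fN by (simp only: algebra_simps)
    finally show ?thesis by (simp add: cz u_def numeral_3_eq_3)
  qed
qed

section \<open>Hook polynomials\<close>

definition cycle_poly :: "('a \<Rightarrow> 'a) \<Rightarrow> 'a set \<Rightarrow> real poly" where
  "cycle_poly p A = orbit_prod (\<lambda>k. 1 - monom 1 k) p A"

text \<open>\<open>cycle_poly\<close> is det(1 - x P) for the permutation matrix P, so the quotient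
  by 1 - x is the same determinant on the reflection representation of dimension
  \<open>card A - 1\<close>. Its coefficient at x^b is (-1)^b times the character of the b-th
  exterior power, that is, of the hook with leg length b.\<close>

definition hook_poly :: "('a \<Rightarrow> 'a) \<Rightarrow> 'a set \<Rightarrow> real poly" where
  "hook_poly p A = cycle_poly p A div [:1, -1:]"

lemma card_eq_sum_orbits:
  assumes "p permutes A" "finite A"
  shows "card A = (\<Sum>C\<in>orbits p A. card C)"
proof -
  have "card A = card (\<Union>(orbits p A))" by (simp add: Union_orbits[OF assms])
  also have "\<dots> = (\<Sum>C\<in>orbits p A. card C)"
    using finite_orbit_mem[OF assms] orbits_disjoint[OF assms]
    by (intro card_Union_disjoint) (auto simp: pairwise_def disjnt_def)
  finally show ?thesis .
qed

lemma card_orbits_pos: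
  assumes "p permutes A" "finite A" "C \<in> orbits p A"
  shows "0 < card C"
  using finite_orbit_mem[OF assms] orbits_nonempty_mem[OF assms(3)] by (simp add: card_gt_0_iff)

lemma poly_cycle_poly: "poly (cycle_poly p A) x = orbit_prod (\<lambda>k. 1 - x ^ k) p A"
  by (simp add: cycle_poly_def orbit_prod_def poly_prod poly_monom)

text \<open>Every factor 1 - x^m vanishes at 1 and there is at least one cycle, so the division is
  exact.\<close>

lemma hook_poly_eq:
  assumes "finite A" "A \<noteq> {}"
  shows "[:1, -1:] * hook_poly p A = cycle_poly p A"
proof -
  obtain C where "C \<in> orbits p A" using assms(2) orbit_in_orbits[of _ A p] by blast
  then have "poly (cycle_poly p A) 1 = 0"
    unfolding poly_cycle_poly orbit_prod_def
    by (intro prod_zero[OF finite_orbits[OF assms(1)]] bexI[of _ C]) simp_all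
  then have "[:-1, 1:] dvd cycle_poly p A" by (simp add: poly_eq_0_iff_dvd)
  then have "- [:-1, 1:] dvd cycle_poly p A" by (subst minus_dvd_iff)
  then have "[:1, -1:] dvd cycle_poly p A" by simp
  then show ?thesis unfolding hook_poly_def by (rule dvd_mult_div_cancel)
qed

lemma degree_one_minus_monom: "0 < k \<Longrightarrow> degree (1 - monom (1 :: real) k) = k"
  and lead_coeff_one_minus_monom: "0 < k \<Longrightarrow> lead_coeff (1 - monom (1 :: real) k) = - 1"
proof -
  assume k: "0 < k"
  have "degree (1 :: real poly) < degree (monom (1 :: real) k)" using k by (simp add: degree_monom_eq)
  then show d: "degree (1 - monom (1 :: real) k) = k"
    using degree_add_eq_right[of 1 "- monom (1 :: real) k"] by (simp add: degree_monom_eq)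
  show "lead_coeff (1 - monom (1 :: real) k) = - 1" unfolding d using k by (simp add: coeff_1)
qed

lemma degree_cycle_poly:
  assumes "p permutes A" "finite A"
  shows "degree (cycle_poly p A) = card A"
    and "lead_coeff (cycle_poly p A) = (- 1) ^ cyc p A"
proof -
  have nz: "1 - monom (1 :: real) (card C) \<noteq> 0" if "C \<in> orbits p A" for C
    using lead_coeff_one_minus_monom[OF card_orbits_pos[OF assms that]] by (metis leading_coeff_0_iff neg_equal_0_iff_equal zero_neq_one)
  have "degree (cycle_poly p A) = (\<Sum>C\<in>orbits p A. degree (1 - monom (1 :: real) (card C)))"
    unfolding cycle_poly_def orbit_prod_def by (rule degree_prod_eq_sum_degree) (use nz in blast)
  also have "\<dots> = (\<Sum>C\<in>orbits p A. card C)"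
    by (intro sum.cong refl degree_one_minus_monom card_orbits_pos[OF assms])
  finally show "degree (cycle_poly p A) = card A" by (simp add: card_eq_sum_orbits[OF assms])
  have "lead_coeff (cycle_poly p A) = (\<Prod>C\<in>orbits p A. lead_coeff (1 - monom (1 :: real) (card C)))"
    unfolding cycle_poly_def orbit_prod_def by (rule lead_coeff_prod)
  also have "\<dots> = (\<Prod>C\<in>orbits p A. - 1)"
    by (intro prod.cong refl lead_coeff_one_minus_monom card_orbits_pos[OF assms])
  finally show "lead_coeff (cycle_poly p A) = (- 1) ^ cyc p A" by (simp add: cyc_def)
qed

text \<open>With n = \<open>card A\<close>, the extreme coefficients are the trivial character and
  (-1)^(n-1) times the sign character. They are what a telescoping sum over all coefficients leaves
  over.\<close>

lemma degree_hook_poly: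
  assumes "p permutes A" "finite A" "A \<noteq> {}"
  shows "Suc (degree (hook_poly p A)) = card A"
    and "lead_coeff (hook_poly p A) = - ((- 1) ^ cyc p A)"
    and "coeff (hook_poly p A) 0 = 1"
proof -
  note e = hook_poly_eq[OF assms(2,3), of p]
  have "cycle_poly p A \<noteq> 0" using degree_cycle_poly(2)[OF assms(1,2)] by (metis leading_coeff_0_iff power_eq_0_iff neg_equal_0_iff_equal zero_neq_one)
  then have nz: "hook_poly p A \<noteq> 0" using e by (metis mult_zero_right)
  have "degree (cycle_poly p A) = degree [:1, -1 :: real:] + degree (hook_poly p A)"
    unfolding e[symmetric] by (rule degree_mult_eq) (use nz in auto)
  then show "Suc (degree (hook_poly p A)) = card A" by (simp add: degree_cycle_poly[OF assms(1,2)])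
  have "lead_coeff (cycle_poly p A) = lead_coeff [:1, -1 :: real:] * lead_coeff (hook_poly p A)"
    unfolding e[symmetric] by (rule lead_coeff_mult)
  then show "lead_coeff (hook_poly p A) = - ((- 1) ^ cyc p A)"
    unfolding degree_cycle_poly(2)[OF assms(1,2)] by simp
  have "poly (cycle_poly p A) 0 = 1"
    using card_orbits_pos[OF assms(1,2)]
    by (auto simp: poly_cycle_poly orbit_prod_def power_0_left intro!: prod.neutral)
  moreover have "poly (cycle_poly p A) 0 = poly (hook_poly p A) 0" unfolding e[symmetric] by simp
  ultimately show "coeff (hook_poly p A) 0 = 1" by (simp add: poly_0_coeff_0)
qed

lemma fps_of_cycle_poly: "fps_of_poly (cycle_poly p A) = orbit_prod cyc_weight p A"
  by (simp add: cycle_poly_def orbit_prod_def fps_of_poly_prod fps_of_poly_diff fps_of_poly_monom')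

text \<open>One of the n + 2 factors 1 - X cancels against the one split off from
  \<open>cycle_poly\<close>; the remaining n + 1 are inverted by the negative binomial
  series.\<close>

lemma cycle_gf_eq_hook:
  assumes "finite A" "A \<noteq> {}" "p permutes A"
  shows "cycle_gf p A = fact (card A - 1) * (fps_X * (fps_of_poly (hook_poly p A) *
    Abs_fps (\<lambda>k. of_nat ((card A + k) choose k))))"
proof -
  define u :: "real fps" where "u = 1 - fps_X"
  define n where "n = card A"
  define B :: "real fps" where "B = Abs_fps (\<lambda>k. of_nat ((n + k) choose k))"
  have u0: "u \<noteq> 0" unfolding u_def by (metis fps_nonzero_nth fps_sub_nth fps_one_nth fps_X_nth diff_zero zero_neq_one)
  have iB: "inverse (u ^ Suc n) = B"
    unfolding u_def B_def using one_minus_const_fps_X_neg_power'[of "Suc n" "1 :: real"] by simp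
  have uB: "u ^ Suc n * B = 1" unfolding iB[symmetric]
    by (rule inverse_mult_eq_1') (simp add: u_def)
  have pow_comb: "fps_of_poly [:1, -1 :: real:] = u"
    by (simp add: u_def fps_of_poly_linear')
  have "u * (u ^ Suc n * cycle_gf p A) = u * (fact (n - 1) * fps_X * fps_of_poly (hook_poly p A))"
    using cycle_gf_formula[OF assms]
    unfolding fps_of_cycle_poly[symmetric] hook_poly_eq[OF assms(1,2), symmetric] fps_of_poly_mult pow_comb
    by (simp add: u_def[symmetric] n_def mult_ac)
  then have "u ^ Suc n * cycle_gf p A = fact (n - 1) * fps_X * fps_of_poly (hook_poly p A)"
    using u0 by simp
  then have "(u ^ Suc n * B) * cycle_gf p A = fact (n - 1) * fps_X * fps_of_poly (hook_poly p A) * B"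
    by (simp only: mult_ac)
  then show ?thesis unfolding uB by (simp add: n_def B_def mult_ac)
qed

text \<open>Coefficient extraction at \<open>q\<close>. The convolution runs over b < q; terms with
  b \<ge> n vanish because the hook polynomial has degree n - 1, and among the b < n those with b
  \<ge> q vanish because the upper index of the binomial is below n.\<close>

lemma sum_full_cycles_power:
  assumes "finite A" "A \<noteq> {}" "p permutes A"
  defines "n \<equiv> card A"
  shows "(\<Sum>c\<in>full_cycles A. real q ^ cyc (c \<circ> p) A) =
    fact (n - 1) * (\<Sum>b<n. coeff (hook_poly p A) b * real ((q + (n - 1 - b)) choose n))"
proof -
  define h where "h = hook_poly p A"
  have n0: "0 < n" using assms by (simp add: card_gt_0_iff)
  have dh: "Suc (degree h) = n" unfolding h_def n_def by (rule degree_hook_poly(1)[OF assms(3,1,2)])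
  have ff: "(fact (n - 1) :: real fps) = fps_const (fact (n - 1))"
    using fps_of_nat[of "fact (n - 1)", where ?'a = real] by (simp only: of_nat_fact)
  let ?t = "\<lambda>b. coeff h b * real ((q + (n - 1 - b)) choose n)"
  have "(\<Sum>c\<in>full_cycles A. real q ^ cyc (c \<circ> p) A) = fps_nth (cycle_gf p A) q"
    by (simp add: cycle_gf_def fps_sum_nth)
  also have "\<dots> = fact (n - 1) * fps_nth (fps_X * (fps_of_poly h * Abs_fps (\<lambda>k. of_nat ((n + k) choose k)))) q"
    unfolding cycle_gf_eq_hook[OF assms(1-3)] h_def[symmetric] n_def[symmetric] ff by (rule fps_mult_left_const_nth)
  also have "fps_nth (fps_X * (fps_of_poly h * Abs_fps (\<lambda>k. of_nat ((n + k) choose k)))) q = (\<Sum>b<q. ?t b)"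
  proof (cases q)
    case (Suc q')
    have "fps_nth (fps_X * (fps_of_poly h * Abs_fps (\<lambda>k. of_nat ((n + k) choose k)))) q =
        (\<Sum>b=0..q'. coeff h b * real ((n + (q' - b)) choose (q' - b)))"
      unfolding Suc fps_X_mult_nth by (simp add: fps_mult_nth)
    also have "\<dots> = (\<Sum>b<q. ?t b)"
    proof (rule sum.cong)
      show "{0..q'} = {..<q}" using Suc by auto
      fix b assume b: "b \<in> {..<q}"
      show "coeff h b * real ((n + (q' - b)) choose (q' - b)) = ?t b"
      proof (cases "b < n")
        case True
        then have "q + (n - 1 - b) = n + (q' - b)" using Suc b by simp
        moreover have "(n + (q' - b)) choose (q' - b) = (n + (q' - b)) choose n"
          by (subst binomial_symmetric) simp_all
        ultimately show ?thesis by simp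
      next
        case False
        then have "coeff h b = 0" using dh by (intro coeff_eq_0) simp
        then show ?thesis by simp
      qed
    qed
    finally show ?thesis .
  qed simp
  also have "(\<Sum>b<q. ?t b) = (\<Sum>b<min q n. ?t b)"
  proof (rule sum.mono_neutral_right)
    show "\<forall>b\<in>{..<q} - {..<min q n}. ?t b = 0"
    proof
      fix b assume "b \<in> {..<q} - {..<min q n}"
      then have "degree h < b" using dh by auto
      then show "?t b = 0" by (simp add: coeff_eq_0)
    qed
  qed auto
  also have "\<dots> = (\<Sum>b<n. ?t b)"
  proof (rule sum.mono_neutral_left)
    show "\<forall>b\<in>{..<n} - {..<min q n}. ?t b = 0"
    proof
      fix b assume "b \<in> {..<n} - {..<min q n}"
      then have "q + (n - 1 - b) < n" by auto
      then show "?t b = 0" by (simp add: binomial_eq_0)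
    qed
  qed auto
  finally show ?thesis by (simp only: h_def)
qed

section \<open>Counting the full cycles whose product with a permutation is a full cycle\<close>

lemma prod_centered:
  assumes "c < n"
  shows "(\<Prod>i\<in>{..<n} - {c}. real c - real i) = (- 1) ^ (n - 1 - c) * fact c * fact (n - 1 - c)"
proof -
  have s: "{..<n} - {c} = {..<c} \<union> {c<..<n}" using assms by auto
  have "(\<Prod>i\<in>{..<n} - {c}. real c - real i) = (\<Prod>i<c. real c - real i) * (\<Prod>i\<in>{c<..<n}. real c - real i)"
    unfolding s by (rule prod.union_disjoint) auto
  also have "(\<Prod>i<c. real c - real i) = (\<Prod>i=1..c. real i)"
    by (rule prod.reindex_bij_witness[of _ "\<lambda>i. c - i" "\<lambda>i. c - i"]) (auto simp: of_nat_diff)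
  also have "\<dots> = fact c" by (simp add: fact_prod)
  also have "(\<Prod>i\<in>{c<..<n}. real c - real i) = (\<Prod>i=1..n - 1 - c. - 1 * real i)"
    by (rule prod.reindex_bij_witness[of _ "\<lambda>i. c + i" "\<lambda>i. i - c"]) (auto simp: of_nat_diff)
  also have "\<dots> = (- 1) ^ (n - 1 - c) * fact (n - 1 - c)"
    unfolding prod.distrib by (simp add: fact_prod)
  finally show ?thesis by (simp only: mult_ac)
qed

lemma poly_eqI_nat:
  fixes P Q :: "real poly"
  assumes "\<And>q :: nat. poly P (real q) = poly Q (real q)"
  shows "P = Q"
proof (rule poly_eqI_degree)
  let ?A = "real ` {..max (degree P) (degree Q)}"
  have "card ?A = Suc (max (degree P) (degree Q))" by (subst card_image) (auto intro: inj_onI)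
  then show "degree P < card ?A" "degree Q < card ?A" by auto
  show "poly P x = poly Q x" if "x \<in> ?A" for x using that assms by auto
qed

text \<open>The count is the linear coefficient of the polynomial in q whose values are given by
  \<open>sum_full_cycles_power\<close>. As a polynomial in q, the binomial (q + n - 1 - b choose n)
  vanishes at 0, and its linear coefficient is (-1)^b b! (n - 1 - b)! / n!.\<close>

lemma card_full_cycle_products:
  assumes "finite A" "A \<noteq> {}" "p permutes A"
  defines "n \<equiv> card A"
  shows "real (card {c \<in> full_cycles A. cyc (c \<circ> p) A = 1}) =
    (\<Sum>b<n. coeff (hook_poly p A) b * ((- 1) ^ b * fact b * fact (n - 1 - b) / real n))"
proof -
  have n0: "0 < n" using assms by (simp add: card_gt_0_iff)
  define h where "h = hook_poly p A"
  define P :: "real poly" where "P = (\<Sum>c\<in>full_cycles A. monom 1 (cyc (c \<circ> p) A))"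
  define B :: "nat \<Rightarrow> real poly" where "B = (\<lambda>c. \<Prod>i<n. [:real c - real i, 1:])"
  define Q :: "real poly" where "Q = (\<Sum>b<n. Polynomial.smult (coeff h b * fact (n - 1) / fact n) (B (n - 1 - b)))"
  have pB: "poly (B c) (real q) = fact n * real ((q + c) choose n)" for c q
  proof -
    have "poly (B c) (real q) = (\<Prod>i=0..<n. real (q + c) - of_nat i)"
      unfolding B_def poly_prod by (rule prod.cong) auto
    then show ?thesis by (simp add: binomial_gbinomial gbinomial_prod_rev)
  qed
  have "P = Q"
  proof (rule poly_eqI_nat)
    fix q :: nat
    have "poly P (real q) = (\<Sum>c\<in>full_cycles A. real q ^ cyc (c \<circ> p) A)"
      by (simp add: P_def poly_sum poly_monom)
    also have "\<dots> = fact (n - 1) * (\<Sum>b<n. coeff h b * real ((q + (n - 1 - b)) choose n))"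
      unfolding h_def n_def by (rule sum_full_cycles_power[OF assms(1-3)])
    also have "\<dots> = poly Q (real q)"
      unfolding Q_def poly_sum poly_smult pB sum_distrib_left
      by (rule sum.cong[OF refl]) simp
    finally show "poly P (real q) = poly Q (real q)" .
  qed
  have cB: "coeff (B c) 1 = (- 1) ^ (n - 1 - c) * fact c * fact (n - 1 - c)" if "c < n" for c
  proof -
    \<comment> \<open>The factor with i = c is q itself, so the linear coefficient is the product of
      the other constant terms.\<close>
    have "B c = [:0, 1:] * (\<Prod>i\<in>{..<n} - {c}. [:real c - real i, 1:])"
      unfolding B_def using that by (subst prod.remove[of _ c]) auto
    then have "coeff (B c) 1 = coeff (\<Prod>i\<in>{..<n} - {c}. [:real c - real i, 1:]) 0"
      by simp
    also have "\<dots> = (\<Prod>i\<in>{..<n} - {c}. real c - real i)"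
      unfolding poly_0_coeff_0[symmetric] poly_prod by simp
    also note prod_centered[OF that]
    finally show ?thesis .
  qed
  have "coeff P 1 = (\<Sum>c\<in>full_cycles A. if cyc (c \<circ> p) A = 1 then 1 else 0)"
    unfolding P_def coeff_sum by (intro sum.cong refl) auto
  also have "\<dots> = real (card {c \<in> full_cycles A. cyc (c \<circ> p) A = 1})"
    using finite_full_cycles[OF assms(1)] by (simp add: sum.If_cases Int_def)
  finally have "real (card {c \<in> full_cycles A. cyc (c \<circ> p) A = 1}) = coeff P 1" ..
  also have "\<dots> = (\<Sum>b<n. coeff h b * ((- 1) ^ b * fact b * fact (n - 1 - b) / real n))"
    unfolding \<open>P = Q\<close> Q_def coeff_sum
  proof (rule sum.cong[OF refl])
    fix b assume "b \<in> {..<n}"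
    then have b: "n - 1 - b < n" "n - 1 - (n - 1 - b) = b" by auto
    have fn: "(fact n :: real) = real n * fact (n - 1)" using n0 by (cases n) auto
    show "coeff (Polynomial.smult (coeff h b * fact (n - 1) / fact n) (B (n - 1 - b))) 1 =
      coeff h b * ((- 1) ^ b * fact b * fact (n - 1 - b) / real n)"
      unfolding coeff_smult cB[OF b(1)] b(2) fn using n0 by simp
  qed
  finally show ?thesis by (simp only: h_def)
qed

section \<open>Signs, and sums over all permutations\<close>

lemma sign_eq_cyc:
  assumes "finite A" "p permutes A"
  shows "sign p = (- 1) ^ (card A + cyc p A)"
  using assms
proof (induction A arbitrary: p rule: finite_induct)
  case empty
  then have "p = id" by simp
  then show ?case by (simp add: cyc_def orbits_def)
next
  case (insert z A)
  have "p \<in> {p. p permutes insert z A}" using insert.prems by simp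
  then obtain b q where bq: "b \<in> insert z A" "q permutes A" "p = tr z b \<circ> q"
    unfolding permutes_insert by auto
  note IH = insert.IH[OF bq(2)]
  show ?case
  proof (cases "b = z")
    case True
    then have "p = q" using bq by simp
    then show ?thesis
      using IH cyc_insert_fixed[OF bq(2) insert.hyps(1,2)] insert.hyps by simp
  next
    case False
    then have b: "b \<in> A" using bq by simp
    have "permutation q" using bq(2) insert.hyps(1) permutation_permutes by blast
    then have "sign p = sign (tr z b) * sign q"
      unfolding bq(3) by (intro sign_compose permutation_swap_id)
    also have "\<dots> = - sign q" using False by (simp add: sign_swap_id)
    finally have s: "sign p = - sign q" .
    have c: "cyc p (insert z A) = cyc q A"
      unfolding bq(3) by (rule cyc_insert_tr[OF bq(2) insert.hyps(1,2) b])
    show ?thesis unfolding s c IH using insert.hyps by simp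
  qed
qed

text \<open>A new point is either fixed, with factor x, or placed next to one of the points already
  present; this multiplies by the next factor of the rising factorial.\<close>

lemma sum_power_cyc:
  fixes x :: real
  assumes "finite A"
  shows "(\<Sum>p | p permutes A. x ^ cyc p A) = pochhammer x (card A)"
  using assms
proof (induction A rule: finite_induct)
  case empty
  have "{p :: 'a \<Rightarrow> 'a. p permutes {}} = {id}" by auto
  then show ?case by (simp add: cyc_def orbits_def)
next
  case (insert z A)
  have "(\<Sum>p | p permutes insert z A. x ^ cyc p (insert z A)) =
      (\<Sum>b\<in>insert z A. \<Sum>q | q permutes A. x ^ cyc (tr z b \<circ> q) (insert z A))"
    by (rule sum_over_permutations_insert[OF insert.hyps])
  also have "\<dots> = (\<Sum>q | q permutes A. x ^ cyc q (insert z A)) +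
      (\<Sum>b\<in>A. \<Sum>q | q permutes A. x ^ cyc (tr z b \<circ> q) (insert z A))"
    using insert.hyps by simp
  also have "(\<Sum>q | q permutes A. x ^ cyc q (insert z A)) = (\<Sum>q | q permutes A. x * x ^ cyc q A)"
    by (rule sum.cong) (auto simp: cyc_insert_fixed[OF _ insert.hyps])
  also have "(\<Sum>b\<in>A. \<Sum>q | q permutes A. x ^ cyc (tr z b \<circ> q) (insert z A)) =
      (\<Sum>b\<in>A. \<Sum>q | q permutes A. x ^ cyc q A)"
    by (intro sum.cong refl) (auto simp: cyc_insert_tr[OF _ insert.hyps])
  finally show ?case
    using insert by (simp add: pochhammer_Suc algebra_simps flip: sum_distrib_left)
qed

text \<open>The sign is (-1)^(n + cyc), so the signed sum is the unsigned one at -a, up to (-1)^n,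
  and the rising factorial turns into a falling one.\<close>

lemma sum_binomial_cyc:
  assumes "finite A" "card A = n"
  shows "(\<Sum>p | p permutes A. real a ^ cyc p A) = fact n * real ((a + n - 1) choose n)"
    and "(\<Sum>p | p permutes A. real_of_int (sign p) * real a ^ cyc p A) = fact n * real (a choose n)"
proof -
  show "(\<Sum>p | p permutes A. real a ^ cyc p A) = fact n * real ((a + n - 1) choose n)"
  proof (cases n)
    case (Suc m)
    have "real ((a + n - 1) choose n) = pochhammer (real a) n / fact n"
      unfolding binomial_gbinomial gbinomial_pochhammer' using Suc by (simp add: algebra_simps)
    then show ?thesis unfolding sum_power_cyc[OF assms(1)] assms(2) by simp
  qed (simp add: sum_power_cyc[OF assms(1)] assms(2))
  have "(\<Sum>p | p permutes A. real_of_int (sign p) * real a ^ cyc p A) =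
      (\<Sum>p | p permutes A. (- 1) ^ n * (- real a) ^ cyc p A)"
  proof (rule sum.cong[OF refl])
    fix p assume "p \<in> {p. p permutes A}"
    then have "real_of_int (sign p) = (- 1) ^ (n + cyc p A)"
      using sign_eq_cyc[OF assms(1), of p] assms(2) by simp
    then show "real_of_int (sign p) * real a ^ cyc p A = (- 1) ^ n * (- real a) ^ cyc p A"
      unfolding power_minus[of "real a"] by (simp add: power_add)
  qed
  also have "\<dots> = (- 1) ^ n * pochhammer (- real a) n"
    unfolding sum_distrib_left[symmetric] sum_power_cyc[OF assms(1)] assms(2) ..
  also have "\<dots> = fact n * real (a choose n)"
    unfolding binomial_gbinomial gbinomial_pochhammer by simp
  finally show "(\<Sum>p | p permutes A. real_of_int (sign p) * real a ^ cyc p A) = fact n * real (a choose n)" .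
qed

text \<open>For a point \<open>i\<close> moved by \<open>p\<close>, the right side of the hypothesis
  is the cycle polynomial of \<open>p\<close> with \<open>i\<close> cut out of its cycle; for a
  fixed point it is 0. Since k (1 - x^(k-1)) = k (1 - x^k) + (1 - x) (1 - x^k)', summing over all
  points gives n G + (1 - x) G' for G = \<open>cycle_poly p A\<close>, and G = (1 - x) g turns this
  into 1 - x times the claim.\<close>

lemma sum_deleted_hook_poly:
  assumes p: "p permutes A" "finite A" "A \<noteq> {}"
    and h: "\<And>i. i \<in> A \<Longrightarrow> [:1, -1:] * h i =
      (1 - monom 1 (card (orbit p i) - 1)) * (\<Prod>C\<in>orbits p A - {orbit p i}. 1 - monom 1 (card C))"
  shows "(\<Sum>i\<in>A. h i) = Polynomial.smult (real (card A) - 1) (hook_poly p A) + [:1, -1:] * pderiv (hook_poly p A)"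
proof -
  define L :: "real poly" where "L = [:1, -1:]"
  define X :: "real poly" where "X = [:0, 1:]"
  define w :: "nat \<Rightarrow> real poly" where "w = (\<lambda>k. 1 - monom 1 k)"
  define M where "M = (\<lambda>C. \<Prod>D\<in>orbits p A - {C}. w (card D))"
  define G where "G = cycle_poly p A"
  define g where "g = hook_poly p A"
  have fo: "finite (orbits p A)" by (rule finite_orbits[OF p(2)])
  have G: "G = L * g" unfolding G_def g_def L_def by (rule hook_poly_eq[OF p(2,3), symmetric])
  have Gw: "G = (\<Prod>C\<in>orbits p A. w (card C))" by (simp add: G_def cycle_poly_def orbit_prod_def w_def)
  have pw: "pderiv (w k) = - (of_nat k * monom 1 (k - 1))" for k
    by (simp add: w_def pderiv_diff pderiv_1 pderiv_monom of_nat_poly smult_monom)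
  have LX: "L = 1 - X" by (simp add: L_def X_def one_pCons)
  have step: "of_nat (card C) * G + L * (M C * pderiv (w (card C))) = of_nat (card C) * (w (card C - 1) * M C)"
    if C: "C \<in> orbits p A" for C
  proof -
    have "0 < card C" by (rule card_orbits_pos[OF p(1,2) C])
    then have m: "(monom 1 (card C) :: real poly) = X * monom 1 (card C - 1)"
      by (cases "card C") (simp_all add: X_def monom_Suc)
    have GM: "G = w (card C) * M C" unfolding Gw M_def by (rule prod.remove[OF fo C])
    have "of_nat k * ((1 - X * mm) * N) + (1 - X) * (N * - (of_nat k * mm)) = of_nat k * ((1 - mm) * N)"
      for k and mm N :: "real poly" by (simp add: algebra_simps)
    then show ?thesis unfolding pw LX GM unfolding w_def m .
  qed
  have "L * (\<Sum>i\<in>A. h i) = (\<Sum>i\<in>A. w (card (orbit p i) - 1) * M (orbit p i))"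
    unfolding sum_distrib_left
  proof (rule sum.cong[OF refl])
    fix i assume "i \<in> A"
    then show "L * h i = w (card (orbit p i) - 1) * M (orbit p i)"
      unfolding L_def w_def M_def by (rule h)
  qed
  also have "\<dots> = (\<Sum>C\<in>orbits p A. of_nat (card C) * (w (card C - 1) * M C))"
  proof -
    let ?f = "\<lambda>i. w (card (orbit p i) - 1) * M (orbit p i)"
    have "sum ?f A = sum ?f (\<Union>(orbits p A))" by (simp add: Union_orbits[OF p(1,2)])
    also have "\<dots> = (sum \<circ> sum) ?f (orbits p A)"
    proof (rule sum.Union_disjoint)
      show "\<forall>C\<in>orbits p A. finite C" using finite_orbit_mem[OF p(1,2)] by blast
      show "\<forall>C\<in>orbits p A. \<forall>D\<in>orbits p A. C \<noteq> D \<longrightarrow> C \<inter> D = {}" using orbits_disjoint[OF p(1,2)] by blast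
    qed
    also have "(sum \<circ> sum) ?f (orbits p A) = (\<Sum>C\<in>orbits p A. sum ?f C)" by simp
    also have "\<dots> = (\<Sum>C\<in>orbits p A. of_nat (card C) * (w (card C - 1) * M C))"
    proof (rule sum.cong[OF refl])
      fix C assume C: "C \<in> orbits p A"
      have "sum ?f C = (\<Sum>i\<in>C. w (card C - 1) * M C)"
        by (rule sum.cong[OF refl]) (simp add: orbits_mem_eq[OF p(1,2) C])
      then show "sum ?f C = of_nat (card C) * (w (card C - 1) * M C)" by simp
    qed
    finally show ?thesis .
  qed
  also have "\<dots> = (\<Sum>C\<in>orbits p A. of_nat (card C) * G + L * (M C * pderiv (w (card C))))"
    by (rule sum.cong[OF refl]) (simp only: step)
  also have "\<dots> = of_nat (card A) * G + L * (\<Sum>C\<in>orbits p A. M C * pderiv (w (card C)))"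
    unfolding sum.distrib sum_distrib_left[symmetric] sum_distrib_right[symmetric]
    by (simp add: card_eq_sum_orbits[OF p(1,2)])
  also have "(\<Sum>C\<in>orbits p A. M C * pderiv (w (card C))) = pderiv G"
    unfolding Gw pderiv_prod M_def ..
  also have "pderiv G = - g + L * pderiv g"
  proof -
    have "pderiv L = - 1" by (simp add: L_def pderiv_pCons one_pCons)
    then show ?thesis unfolding G pderiv_mult by simp
  qed
  also have "of_nat (card A) * G + L * (- g + L * pderiv g) = L * ((of_nat (card A) - 1) * g + L * pderiv g)"
  proof -
    have "k * (l * u) + l * (- u + v) = l * ((k - 1) * u + v)" for k l u v :: "real poly"
      by (simp add: algebra_simps)
    then show ?thesis unfolding G .
  qed
  finally have "(\<Sum>i\<in>A. h i) = (of_nat (card A) - 1) * g + L * pderiv g"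
    using mult_cancel_left[of L] by (simp add: L_def del: mult_pCons_left)
  also have "(of_nat (card A) - 1) * g = Polynomial.smult (real (card A) - 1) g"
    by (simp add: of_nat_poly one_pCons)
  finally show ?thesis by (simp only: g_def L_def)
qed

text \<open>Cutting \<open>i\<close> out of its cycle in \<open>p\<close> moves the count to
  \<open>A - {i}\<close>, where \<open>card_full_cycle_products\<close> applies. The polynomial is
  only asserted to exist because a fixed point of \<open>p\<close> calls for the zero polynomial:
  then \<open>p \<circ> d\<close> fixes \<open>i\<close> as well and is never a full cycle.\<close>

lemma card_deleted_products:
  assumes A: "finite A" "2 \<le> card A" and p: "p permutes A" and i: "i \<in> A"
  defines "n \<equiv> card A"
  obtains h where
    "[:1, -1:] * h = (1 - monom 1 (card (orbit p i) - 1)) * (\<Prod>C\<in>orbits p A - {orbit p i}. 1 - monom 1 (card C))"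
    "real (card {d \<in> full_cycles (A - {i}). p \<circ> pinv d \<in> full_cycles A}) =
      (\<Sum>b<n - 1. coeff h b * ((- 1) ^ b * fact b * fact (n - 2 - b) / real (n - 1)))"
proof -
  define B where "B = A - {i}"
  have AB: "A = insert i B" "i \<notin> B" "finite B" using i A by (auto simp: B_def)
  have cB: "card B = n - 1" using i A by (simp add: B_def n_def)
  then have Bne: "B \<noteq> {}" using A by (auto simp: n_def)
  have "p \<in> {p. p permutes insert i B}" using p AB by simp
  then obtain b q where bq: "b \<in> insert i B" "q permutes B" "p = tr i b \<circ> q"
    unfolding permutes_insert by auto
  have "bij_betw pinv {d \<in> full_cycles B. p \<circ> pinv d \<in> full_cycles A} {d \<in> full_cycles B. p \<circ> d \<in> full_cycles A}"
  proof (rule bij_betw_byWitness[where f' = pinv])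
    have pp: "pinv (pinv d) = d" if "d \<in> full_cycles B" for d
      using that by (auto simp: full_cycles_def permutes_inv_inv)
    show "\<forall>d\<in>{d \<in> full_cycles B. p \<circ> pinv d \<in> full_cycles A}. pinv (pinv d) = d"
      "\<forall>d\<in>{d \<in> full_cycles B. p \<circ> d \<in> full_cycles A}. pinv (pinv d) = d"
      using pp by blast+
    show "pinv ` {d \<in> full_cycles B. p \<circ> pinv d \<in> full_cycles A} \<subseteq> {d \<in> full_cycles B. p \<circ> d \<in> full_cycles A}"
      using inv_in_full_cycles[OF AB(3)] by auto
    show "pinv ` {d \<in> full_cycles B. p \<circ> d \<in> full_cycles A} \<subseteq> {d \<in> full_cycles B. p \<circ> pinv d \<in> full_cycles A}"
      using inv_in_full_cycles[OF AB(3)] pp by auto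
  qed
  then have c1: "card {d \<in> full_cycles B. p \<circ> pinv d \<in> full_cycles A} = card {d \<in> full_cycles B. p \<circ> d \<in> full_cycles A}"
    by (rule bij_betw_same_card)
  show thesis
  proof (cases "b = i")
    case True
    then have pq: "p = q" using bq by simp
    have oi: "orbit p i = {i}" unfolding pq using bq(2) AB(2) by (simp add: orbit_eq_singleton_iff permutes_not_in)
    have "p \<circ> d \<notin> full_cycles A" if "d \<in> full_cycles B" for d
    proof -
      have "(q \<circ> d) permutes B" using that bq(2) by (auto simp: full_cycles_def intro: permutes_compose)
      then have "cyc (p \<circ> d) A = Suc (cyc (q \<circ> d) B)" unfolding AB(1) pq by (rule cyc_insert_fixed[OF _ AB(3,2)])
      moreover have "0 < cyc (q \<circ> d) B" by (rule cyc_pos[OF AB(3) Bne])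
      ultimately show ?thesis by (simp add: full_cycles_def)
    qed
    then have e: "{d \<in> full_cycles B. p \<circ> d \<in> full_cycles A} = {}" by blast
    have "real (card {d \<in> full_cycles B. p \<circ> pinv d \<in> full_cycles A}) = 0" unfolding c1 e by simp
    then show thesis
      by (intro that[of 0]) (simp_all add: B_def oi)
  next
    case False
    then have b: "b \<in> B" using bq by simp
    note o = orbits_insert_tr[OF bq(2) AB(3,2) b]
    have iO: "i \<in> orbit p i" by (rule self_in_orbit[OF p A(1)])
    have finO: "finite (orbit q b)" by (rule finite_orbit_mem[OF bq(2) AB(3) orbit_in_orbits[OF b]])
    have oi: "orbit p i = insert i (orbit q b)"
      by (rule orbits_mem_eq[OF p A(1)]) (use o(1) in \<open>auto simp: bq(3) AB(1)\<close>)
    have ci: "card (orbit p i) - 1 = card (orbit q b)" unfolding oi using o(3) finO by simp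
    have rest: "orbits p A - {orbit p i} = orbits q B - {orbit q b}"
      unfolding oi using o(1,2) by (auto simp: bq(3) AB(1))
    have "{d \<in> full_cycles B. p \<circ> d \<in> full_cycles A} = {d \<in> full_cycles B. cyc (d \<circ> q) B = 1}"
    proof (rule Collect_cong, rule conj_cong[OF refl])
      fix d assume "d \<in> full_cycles B"
      then have d: "d permutes B" by (simp add: full_cycles_def)
      have qd: "(q \<circ> d) permutes B" by (rule permutes_compose[OF d bq(2)])
      have "(p \<circ> d) permutes A"
        using p d permutes_imp_permutes_insert[OF d, of i] AB(1) by (simp add: permutes_compose)
      moreover have "cyc (p \<circ> d) A = cyc (q \<circ> d) B"
        unfolding bq(3) AB(1) comp_assoc by (rule cyc_insert_tr[OF qd AB(3,2) b])
      moreover have "cyc (q \<circ> d) B = cyc (d \<circ> q) B" by (rule cyc_comp_commute[OF d])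
      ultimately show "(p \<circ> d \<in> full_cycles A) = (cyc (d \<circ> q) B = 1)" by (simp add: full_cycles_def)
    qed
    then have "real (card {d \<in> full_cycles B. p \<circ> pinv d \<in> full_cycles A}) =
        (\<Sum>b<n - 1. coeff (hook_poly q B) b * ((- 1) ^ b * fact b * fact (n - 1 - 1 - b) / real (n - 1)))"
      using c1 card_full_cycle_products[OF AB(3) Bne bq(2)] unfolding cB by simp
    moreover have "[:1, -1:] * hook_poly q B = (1 - monom 1 (card (orbit p i) - 1)) *
        (\<Prod>C\<in>orbits p A - {orbit p i}. 1 - monom 1 (card C))"
      unfolding hook_poly_eq[OF AB(3) Bne] cycle_poly_def orbit_prod_def ci rest
      by (rule prod.remove[OF finite_orbits[OF AB(3)] orbit_in_orbits[OF b]])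
    moreover have "n - 1 - 1 = n - 2" by simp
    ultimately show thesis using that[of "hook_poly q B"] unfolding B_def by (simp only:)
  qed
qed

text \<open>
  Only the constant and the top coefficient of the hook polynomial survive a telescoping sum. Hence
  a product of an \<open>n\<close>-cycle and an \<open>(n - 1)\<close>-cycle is uniform on the odd permutations.
\<close>

lemma count_near_full_factorizations:
  assumes A: "finite A" "2 \<le> card A" and p: "p permutes A"
  defines "n \<equiv> card A"
  shows "(\<Sum>i\<in>A. real (card {d \<in> full_cycles (A - {i}). p \<circ> pinv d \<in> full_cycles A})) =
    fact (n - 2) * (1 - real_of_int (sign p))"
proof -
  have Ane: "A \<noteq> {}" using A by auto
  let ?w = "\<lambda>b. (- 1) ^ b * fact b * fact (n - 2 - b) / real (n - 1)"
  have "\<forall>i\<in>A. \<exists>h. [:1, -1:] * h = (1 - monom 1 (card (orbit p i) - 1)) *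
        (\<Prod>C\<in>orbits p A - {orbit p i}. 1 - monom 1 (card C)) \<and>
      real (card {d \<in> full_cycles (A - {i}). p \<circ> pinv d \<in> full_cycles A}) = (\<Sum>b<n - 1. coeff h b * ?w b)"
  proof
    fix i assume i: "i \<in> A"
    show "\<exists>h. [:1, -1:] * h = (1 - monom 1 (card (orbit p i) - 1)) *
        (\<Prod>C\<in>orbits p A - {orbit p i}. 1 - monom 1 (card C)) \<and>
      real (card {d \<in> full_cycles (A - {i}). p \<circ> pinv d \<in> full_cycles A}) = (\<Sum>b<n - 1. coeff h b * ?w b)"
      unfolding n_def by (rule card_deleted_products[OF A p i], rule exI, rule conjI)
  qed
  from bchoice[OF this] obtain h where h: "\<And>i. i \<in> A \<Longrightarrow> [:1, -1:] * h i = (1 - monom 1 (card (orbit p i) - 1)) *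
        (\<Prod>C\<in>orbits p A - {orbit p i}. 1 - monom 1 (card C))"
      "\<And>i. i \<in> A \<Longrightarrow> real (card {d \<in> full_cycles (A - {i}). p \<circ> pinv d \<in> full_cycles A}) =
        (\<Sum>b<n - 1. coeff (h i) b * ?w b)"
    by blast
  define g where "g = hook_poly p A"
  have H: "(\<Sum>i\<in>A. h i) = Polynomial.smult (real n - 1) g + [:1, -1:] * pderiv g"
    unfolding g_def n_def by (rule sum_deleted_hook_poly[OF p A(1) Ane h(1)])
  have cH: "coeff (\<Sum>i\<in>A. h i) b = (real n - 1 - real b) * coeff g b + real (Suc b) * coeff g (Suc b)" for b
  proof -
    have "coeff ([:1, -1:] * pderiv g) b = coeff (pderiv g) b - real b * coeff g b"
      by (cases b) (simp_all add: coeff_pderiv)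
    then show ?thesis unfolding H by (simp add: coeff_pderiv algebra_simps)
  qed
  \<comment> \<open>These numbers telescope: in \<open>cH\<close> the factor n - 1 - b completes the
    factorial of n - 2 - b, the factor b + 1 completes that of b, and the sign alternates.\<close>
  define a where "a = (\<lambda>b. (- 1) ^ b * fact b * fact (n - 1 - b) * coeff g b)"
  have n1: "real (n - 1) \<noteq> 0" using A by (simp add: n_def)
  have "(\<Sum>i\<in>A. real (card {d \<in> full_cycles (A - {i}). p \<circ> pinv d \<in> full_cycles A})) =
      (\<Sum>i\<in>A. \<Sum>b<n - 1. coeff (h i) b * ?w b)"
    by (rule sum.cong[OF refl]) (rule h(2))
  also have "\<dots> = (\<Sum>b<n - 1. coeff (\<Sum>i\<in>A. h i) b * ?w b)"
    unfolding coeff_sum sum_distrib_right by (rule sum.swap)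
  also have "\<dots> = (\<Sum>b<n - 1. (a b - a (Suc b)) / real (n - 1))"
  proof (rule sum.cong[OF refl])
    fix b assume "b \<in> {..<n - 1}"
    then have b: "Suc b < n" by simp
    define k where "k = n - Suc (Suc b)"
    then have k: "n = k + Suc (Suc b)" using b by simp
    have f: "(fact (n - 1 - b) :: real) = (real n - 1 - real b) * fact (n - 2 - b)"
      unfolding k by simp
    have f2: "n - 1 - Suc b = n - 2 - b" by simp
    show "coeff (\<Sum>i\<in>A. h i) b * ?w b = (a b - a (Suc b)) / real (n - 1)"
      unfolding cH a_def f f2 by (simp add: algebra_simps diff_divide_distrib add_divide_distrib)
  qed
  also have "\<dots> = (a 0 - a (n - 1)) / real (n - 1)"
    unfolding sum_divide_distrib[symmetric] sum_lessThan_telescope' ..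
  also have "a 0 = fact (n - 1)"
    using degree_hook_poly(3)[OF p A(1) Ane] by (simp add: a_def g_def)
  \<comment> \<open>The top coefficient carries -(-1)^cyc; together with the alternating sign
    (-1)^(n-1) this is the sign of \<open>p\<close>.\<close>
  also have "a (n - 1) = fact (n - 1) * real_of_int (sign p)"
  proof -
    have "degree g = n - 1" using degree_hook_poly(1)[OF p A(1) Ane] by (simp add: g_def n_def)
    then have "coeff g (n - 1) = - ((- 1) ^ cyc p A)"
      using degree_hook_poly(2)[OF p A(1) Ane] by (simp add: g_def)
    moreover have "real_of_int (sign p) = (- 1) ^ (n + cyc p A)"
      by (simp add: sign_eq_cyc[OF A(1) p] n_def)
    moreover have "(- 1) ^ n = - ((- 1) ^ (n - 1) :: real)" using A by (cases n) (auto simp: n_def)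
    ultimately show ?thesis by (simp add: a_def power_add)
  qed
  also have "(fact (n - 1) - fact (n - 1) * real_of_int (sign p)) / real (n - 1) = fact (n - 2) * (1 - real_of_int (sign p))"
  proof -
    have "(fact (n - 1) :: real) = real (n - 1) * fact (n - 2)"
      using A by (cases n; cases "n - 1") (auto simp: n_def)
    then have "fact (n - 1) - fact (n - 1) * real_of_int (sign p) =
        real (n - 1) * (fact (n - 2) * (1 - real_of_int (sign p)))"
      by (simp only: right_diff_distrib mult.assoc mult_1_right)
    then show ?thesis by (simp only: nonzero_mult_div_cancel_left[OF n1])
  qed
  finally show ?thesis .
qed

text \<open>A triple is determined by \<open>i\<close>, \<open>d\<close> and the product
  \<open>p = c \<circ> d\<close>, so the sum can be grouped by \<open>p\<close>, each weighted by
  its number of factorizations.\<close>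

lemma sum_near_full_products:
  fixes f :: "('a \<Rightarrow> 'a) \<Rightarrow> real"
  assumes A: "finite A" "2 \<le> card A"
  shows "(\<Sum>c\<in>full_cycles A. \<Sum>i\<in>A. \<Sum>d\<in>full_cycles (A - {i}). f (c \<circ> d)) =
    fact (card A - 2) * (\<Sum>p | p permutes A. (1 - real_of_int (sign p)) * f p)"
proof -
  let ?P = "{p. p permutes A}"
  have fP: "finite ?P" using A by (simp add: finite_permutations)
  have "(\<Sum>c\<in>full_cycles A. \<Sum>i\<in>A. \<Sum>d\<in>full_cycles (A - {i}). f (c \<circ> d)) =
      (\<Sum>i\<in>A. \<Sum>d\<in>full_cycles (A - {i}). \<Sum>c\<in>full_cycles A. f (c \<circ> d))"
    by (subst sum.swap) (intro sum.cong refl sum.swap)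
  also have "\<dots> = (\<Sum>i\<in>A. \<Sum>d\<in>full_cycles (A - {i}). \<Sum>p\<in>?P. if p \<circ> pinv d \<in> full_cycles A then f p else 0)"
  proof (rule sum.cong[OF refl], rule sum.cong[OF refl])
    fix i d assume i: "i \<in> A" and "d \<in> full_cycles (A - {i})"
    then have "d permutes A - {i}" by (simp add: full_cycles_def)
    then have d: "d permutes A" by (rule permutes_subset) auto
    have "(\<Sum>p\<in>?P. if p \<circ> pinv d \<in> full_cycles A then f p else 0) =
        (\<Sum>p\<in>{p \<in> ?P. p \<circ> pinv d \<in> full_cycles A}. f p)"
      by (rule sum.inter_filter[symmetric, OF fP])
    also have "\<dots> = (\<Sum>c\<in>full_cycles A. f (c \<circ> d))"
    proof (rule sum.reindex_bij_witness[of _ "\<lambda>c. c \<circ> d" "\<lambda>p. p \<circ> pinv d"])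
      fix c assume c: "c \<in> full_cycles A"
      show "c \<circ> d \<circ> pinv d = c" by (simp add: comp_assoc permutes_inv_o[OF d])
      then show "c \<circ> d \<in> {p \<in> ?P. p \<circ> pinv d \<in> full_cycles A}"
        using c d by (auto simp: full_cycles_def intro: permutes_compose)
    qed (auto simp: comp_assoc permutes_inv_o[OF d])
    finally show "(\<Sum>c\<in>full_cycles A. f (c \<circ> d)) =
      (\<Sum>p\<in>?P. if p \<circ> pinv d \<in> full_cycles A then f p else 0)" ..
  qed
  also have "\<dots> = (\<Sum>i\<in>A. \<Sum>p\<in>?P. \<Sum>d\<in>full_cycles (A - {i}). if p \<circ> pinv d \<in> full_cycles A then f p else 0)"
    by (intro sum.cong refl sum.swap)
  also have "\<dots> = (\<Sum>p\<in>?P. \<Sum>i\<in>A. \<Sum>d\<in>full_cycles (A - {i}). if p \<circ> pinv d \<in> full_cycles A then f p else 0)"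
    by (rule sum.swap)
  also have "\<dots> = (\<Sum>p\<in>?P. (\<Sum>i\<in>A. real (card {d \<in> full_cycles (A - {i}). p \<circ> pinv d \<in> full_cycles A})) * f p)"
    unfolding sum_distrib_right
  proof (rule sum.cong[OF refl], rule sum.cong[OF refl])
    fix p i
    have "finite (full_cycles (A - {i}))" using A by (simp add: finite_full_cycles)
    then show "(\<Sum>d\<in>full_cycles (A - {i}). if p \<circ> pinv d \<in> full_cycles A then f p else 0) =
      real (card {d \<in> full_cycles (A - {i}). p \<circ> pinv d \<in> full_cycles A}) * f p"
      by (simp add: sum.If_cases Int_def)
  qed
  also have "\<dots> = (\<Sum>p\<in>?P. fact (card A - 2) * ((1 - real_of_int (sign p)) * f p))"
    by (rule sum.cong[OF refl]) (simp add: count_near_full_factorizations[OF A])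
  finally show ?thesis by (simp only: sum_distrib_left)
qed

section \<open>Orthogonality of the hook polynomials\<close>

definition marked_prod :: "(nat \<Rightarrow> 'b::comm_ring_1) \<Rightarrow> ('a \<Rightarrow> 'a) \<Rightarrow> 'a set \<Rightarrow> 'a \<Rightarrow> 'b" where
  "marked_prod w p A b = (\<Prod>C\<in>orbits p A - {orbit p b}. w (card C))"

lemma orbit_prod_marked:
  assumes "finite A" "b \<in> A"
  shows "orbit_prod w p A = w (card (orbit p b)) * marked_prod w p A b"
  unfolding orbit_prod_def marked_prod_def
  by (rule prod.remove[OF finite_orbits[OF assms(1)] orbit_in_orbits[OF assms(2)]])

lemma marked_insert_fixed:
  assumes "q permutes A" "z \<notin> A"
  shows "orbit q z = {z}" "marked_prod w q (insert z A) z = orbit_prod w q A"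
proof -
  show o: "orbit q z = {z}" using assms by (simp add: orbit_eq_singleton_iff permutes_not_in)
  show "marked_prod w q (insert z A) z = orbit_prod w q A"
    using orbits_insert_fixed[OF assms] by (simp add: marked_prod_def orbit_prod_def o)
qed

lemma marked_insert_tr:
  assumes q: "q permutes A" "finite A" and z: "z \<notin> A" and b: "b \<in> A"
  shows "card (orbit (tr z b \<circ> q) z) = Suc (card (orbit q b))"
    and "marked_prod w (tr z b \<circ> q) (insert z A) z = marked_prod w q A b"
proof -
  note o = orbits_insert_tr[OF q z b]
  have p: "(tr z b \<circ> q) permutes insert z A"
    using b by (intro tr_comp_permutes permutes_imp_permutes_insert[OF q(1)]) auto
  have finA: "finite (insert z A)" using q(2) by simp
  have "orbit (tr z b \<circ> q) z = insert z (orbit q b)"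
    by (rule orbits_mem_eq[OF p finA]) (use o(1) in auto)
  note oz = this
  have "finite (orbit q b)" by (rule finite_orbit_mem[OF q orbit_in_orbits[OF b]])
  then show "card (orbit (tr z b \<circ> q) z) = Suc (card (orbit q b))" unfolding oz using o(3) by simp
  have "orbits (tr z b \<circ> q) (insert z A) - {insert z (orbit q b)} = orbits q A - {orbit q b}"
    using o(1,2) by auto
  then show "marked_prod w (tr z b \<circ> q) (insert z A) z = marked_prod w q A b"
    unfolding marked_prod_def oz by simp
qed

text \<open>The exponential formula: \<open>v N\<close> is the coefficient of z^N in the exponential
  of the sum of w_m z^m / m, and the hypothesis on \<open>v\<close> is its logarithmic derivative.
  The second statement, which prescribes the length of the cycle through a marked point, is needed
  to carry the induction.\<close>

lemma cycle_index:
  fixes w v :: "nat \<Rightarrow> real"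
  assumes v0: "v 0 = 1" and v: "\<And>N. 0 < N \<Longrightarrow> (\<Sum>m=1..N. w m * v (N - m)) = real N * v N"
    and "finite A" "card A = n"
  shows "(\<Sum>p | p permutes A. orbit_prod w p A) = fact n * v n"
    and "\<And>b m. b \<in> A \<Longrightarrow> 0 < m \<Longrightarrow> m \<le> n \<Longrightarrow>
      (\<Sum>p | p permutes A. if card (orbit p b) = m then marked_prod w p A b else 0) = fact (n - 1) * v (n - m)"
proof -
  have "(\<Sum>p | p permutes A. orbit_prod w p A) = fact n * v n \<and>
    (\<forall>b\<in>A. \<forall>m. 0 < m \<longrightarrow> m \<le> n \<longrightarrow>
      (\<Sum>p | p permutes A. if card (orbit p b) = m then marked_prod w p A b else 0) = fact (n - 1) * v (n - m))"
    using assms(3,4)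
  proof (induction n arbitrary: A)
    case 0
    then have "A = {}" by simp
    moreover have "{p :: 'a \<Rightarrow> 'a. p permutes {}} = {id}" by auto
    ultimately show ?case by (simp add: orbit_prod_def orbits_def v0)
  next
    case (Suc n)
    \<comment> \<open>The marked point is deleted. For \<open>m = 1\<close> the first statement on
      the smaller set remains; otherwise the neighbour of \<open>z\<close> becomes the marked point
      of a cycle of length \<open>m - 1\<close>.\<close>
    have M: "(\<Sum>p | p permutes A. if card (orbit p z) = m then marked_prod w p A z else 0) = fact n * v (Suc n - m)"
      if z: "z \<in> A" and m: "0 < m" "m \<le> Suc n" for z m
    proof -
      define B where "B = A - {z}"
      have A: "A = insert z B" "z \<notin> B" "finite B" "card B = n" using z Suc.prems by (auto simp: B_def)
      note IH = Suc.IH[OF A(3,4)]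
      let ?g = "\<lambda>p. if card (orbit p z) = m then marked_prod w p (insert z B) z else 0"
      have "(\<Sum>p | p permutes insert z B. ?g p) = (\<Sum>b\<in>insert z B. \<Sum>q | q permutes B. ?g (tr z b \<circ> q))"
        by (rule sum_over_permutations_insert[OF A(3,2)])
      also have "\<dots> = (\<Sum>q | q permutes B. ?g q) + (\<Sum>b\<in>B. \<Sum>q | q permutes B. ?g (tr z b \<circ> q))"
        unfolding sum.insert[OF A(3,2)] by (simp cong: if_cong)
      also have "(\<Sum>q | q permutes B. ?g q) = (\<Sum>q | q permutes B. if m = 1 then orbit_prod w q B else 0)"
      proof (rule sum.cong[OF refl])
        fix q assume "q \<in> {q. q permutes B}"
        then have "q permutes B" by simp
        note mf = marked_insert_fixed[OF this A(2)]
        show "?g q = (if m = 1 then orbit_prod w q B else 0)" unfolding mf by simp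
      qed
      also have "(\<Sum>b\<in>B. \<Sum>q | q permutes B. ?g (tr z b \<circ> q)) =
          (\<Sum>b\<in>B. \<Sum>q | q permutes B. if Suc (card (orbit q b)) = m then marked_prod w q B b else 0)"
      proof (rule sum.cong[OF refl], rule sum.cong[OF refl])
        fix b q assume b: "b \<in> B" and "q \<in> {q. q permutes B}"
        then have "q permutes B" by simp
        note mt = marked_insert_tr[OF this A(3,2) b]
        show "?g (tr z b \<circ> q) = (if Suc (card (orbit q b)) = m then marked_prod w q B b else 0)"
          unfolding mt ..
      qed
      also have "(\<Sum>q | q permutes B. if m = 1 then orbit_prod w q B else 0) +
          (\<Sum>b\<in>B. \<Sum>q | q permutes B. if Suc (card (orbit q b)) = m then marked_prod w q B b else 0) =
        fact n * v (Suc n - m)"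
      proof (cases "m = 1")
        case True
        have "(\<Sum>b\<in>B. \<Sum>q | q permutes B. if Suc (card (orbit q b)) = m then marked_prod w q B b else 0) = 0"
        proof (intro sum.neutral ballI)
          fix b q assume "q \<in> {q. q permutes B}"
          then have "0 < card (orbit q b)" using orbit_cycle(4)[OF _ A(3)] by blast
          then show "(if Suc (card (orbit q b)) = m then marked_prod w q B b else 0) = 0" using True by simp
        qed
        then show ?thesis using True IH by simp
      next
        case False
        then obtain k where k: "m = Suc k" "0 < k" "k \<le> n" using m by (cases m) auto
        then have "(\<Sum>b\<in>B. \<Sum>q | q permutes B. if Suc (card (orbit q b)) = m then marked_prod w q B b else 0) =
            (\<Sum>b\<in>B. fact (n - 1) * v (n - k))"
          using IH by (intro sum.cong refl) simp
        also have "\<dots> = fact n * v (n - k)" using k A(4) by (cases n) simp_all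
        finally show ?thesis using False k by simp
      qed
      finally show ?thesis by (simp only: A(1)[symmetric])
    qed
    have "A \<noteq> {}" using Suc.prems by auto
    then obtain z where z: "z \<in> A" by blast
    have fP: "finite {p. p permutes A}" using Suc.prems by (simp add: finite_permutations)
    have "(\<Sum>p | p permutes A. orbit_prod w p A) =
        (\<Sum>p | p permutes A. \<Sum>m=1..Suc n. if card (orbit p z) = m then w m * marked_prod w p A z else 0)"
    proof (rule sum.cong[OF refl])
      fix p assume "p \<in> {p. p permutes A}"
      then have p: "p permutes A" by simp
      have "0 < card (orbit p z)" by (rule orbit_cycle(4)[OF p Suc.prems(1)])
      moreover have "card (orbit p z) \<le> Suc n"
        using card_mono[OF Suc.prems(1) orbit_subset_carrier[OF p z]] Suc.prems(2) by simp
      ultimately show "orbit_prod w p A = (\<Sum>m=1..Suc n. if card (orbit p z) = m then w m * marked_prod w p A z else 0)"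
        unfolding orbit_prod_marked[OF Suc.prems(1) z] by (subst sum.delta') auto
    qed
    also have "\<dots> = (\<Sum>m=1..Suc n. \<Sum>p | p permutes A. if card (orbit p z) = m then w m * marked_prod w p A z else 0)"
      by (rule sum.swap)
    also have "\<dots> = (\<Sum>m=1..Suc n. w m * (\<Sum>p | p permutes A. if card (orbit p z) = m then marked_prod w p A z else 0))"
      unfolding sum_distrib_left by (intro sum.cong refl) simp
    also have "\<dots> = (\<Sum>m=1..Suc n. w m * (fact n * v (Suc n - m)))"
      using M[OF z] by (intro sum.cong refl) simp
    also have "\<dots> = fact n * (\<Sum>m=1..Suc n. w m * v (Suc n - m))"
      unfolding sum_distrib_left by (intro sum.cong refl) simp
    also have "\<dots> = fact (Suc n) * v (Suc n)"
      unfolding v[OF zero_less_Suc] by (simp add: algebra_simps)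
    finally show ?case using M by simp
  qed
  then show "(\<Sum>p | p permutes A. orbit_prod w p A) = fact n * v n"
    and "\<And>b m. b \<in> A \<Longrightarrow> 0 < m \<Longrightarrow> m \<le> n \<Longrightarrow>
      (\<Sum>p | p permutes A. if card (orbit p b) = m then marked_prod w p A b else 0) = fact (n - 1) * v (n - m)"
    by blast+
qed

text \<open>For these weights the exponential formula yields (1 - s z) (1 - u z) / ((1 - z) (1 - s u
  z)), which equals 1 + p_1 z / ((1 - z) (1 - s u z)); hence the coefficients p_1 \<open>e N\<close>
  for N > 0. The separate term \<open>p N\<close> accounts for the constant coefficient 1, where the
  formula would give 0.\<close>

lemma hook_weight_convolution:
  fixes s u :: real
  defines "p \<equiv> \<lambda>m. (1 - s ^ m) * (1 - u ^ m)" and "e \<equiv> \<lambda>N. \<Sum>b<N. (s * u) ^ b"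
  shows "p 1 * (\<Sum>m=1..N. p m * e (N - m)) + p N = real N * (p 1 * e N)"
proof -
  have e1: "e (Suc N) = 1 + s * u * e N" for N
    unfolding e_def by (subst sum.lessThan_Suc_shift) (simp add: sum_distrib_left)
  have e2: "e (Suc N) = e N + (s * u) ^ N" for N by (simp add: e_def)
  \<comment> \<open>This is what remains of the claim for N + 1 after subtracting s u times the
    claim for N; it satisfies a one-step recurrence of its own.\<close>
  have aux: "p 1 * (\<Sum>m=1..N. p m) + p (Suc N) - s * u * p N = real (Suc N) * p 1 + p 1 * (s * u) * e N" for N
  proof (induction N)
    case 0
    show ?case by (simp add: p_def e_def)
  next
    case (Suc N)
    have st: "p 1 * p (Suc N) + p (Suc (Suc N)) - p (Suc N) - s * u * p (Suc N) + s * u * p N =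
        p 1 + p 1 * (s * u) * (s * u) ^ N"
      unfolding p_def by (simp add: algebra_simps power_mult_distrib)
    have "p 1 * (\<Sum>m=1..Suc N. p m) + p (Suc (Suc N)) - s * u * p (Suc N) =
        (p 1 * (\<Sum>m=1..N. p m) + p (Suc N) - s * u * p N) +
        (p 1 * p (Suc N) + p (Suc (Suc N)) - p (Suc N) - s * u * p (Suc N) + s * u * p N)"
      by (simp add: algebra_simps)
    also have "\<dots> = real (Suc (Suc N)) * p 1 + p 1 * (s * u) * e (Suc N)"
      unfolding Suc.IH st e2 by (simp add: algebra_simps)
    finally show ?case .
  qed
  show ?thesis
  proof (induction N)
    case 0
    show ?case by (simp add: p_def e_def)
  next
    case (Suc N)
    have "(\<Sum>m=1..Suc N. p m * e (Suc N - m)) = (\<Sum>m=1..N. p m * e (Suc (N - m)))"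
      by (simp add: e_def Suc_diff_le)
    also have "\<dots> = (\<Sum>m=1..N. p m) + s * u * (\<Sum>m=1..N. p m * e (N - m))"
      unfolding e1 by (simp add: algebra_simps sum.distrib sum_distrib_left)
    finally have T: "(\<Sum>m=1..Suc N. p m * e (Suc N - m)) = (\<Sum>m=1..N. p m) + s * u * (\<Sum>m=1..N. p m * e (N - m))" .
    have "p 1 * (\<Sum>m=1..Suc N. p m * e (Suc N - m)) + p (Suc N) =
        (p 1 * (\<Sum>m=1..N. p m) + p (Suc N) - s * u * p N) +
        s * u * (p 1 * (\<Sum>m=1..N. p m * e (N - m)) + p N)"
      unfolding T by (simp only: algebra_simps)
    also have "\<dots> = real (Suc N) * (p 1 * e (Suc N))"
      unfolding Suc.IH aux e1 by (simp add: algebra_simps)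
    finally show ?case .
  qed
qed

lemma sum_cycle_poly_products:
  fixes s u :: real
  assumes "finite A" "A \<noteq> {}"
  shows "(\<Sum>p | p permutes A. poly (cycle_poly p A) s * poly (cycle_poly p A) u) =
    fact (card A) * ((1 - s) * (1 - u) * (\<Sum>b<card A. (s * u) ^ b))"
proof -
  define p where "p = (\<lambda>m. (1 - s ^ m) * (1 - u ^ m))"
  define e where "e = (\<lambda>N. \<Sum>b<N. (s * u) ^ b)"
  \<comment> \<open>The empty permutation has weight 1, whereas \<open>p 1 * e 0\<close> is
    0.\<close>
  define v where "v = (\<lambda>N. if N = 0 then 1 else p 1 * e N)"
  have "(\<Sum>m=1..N. p m * v (N - m)) = real N * v N" if N: "0 < N" for N
  proof -
    have "(\<Sum>m=1..N. p m * v (N - m)) = (\<Sum>m=1..N. p 1 * (p m * e (N - m)) + (if m = N then p m else 0))"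
      by (intro sum.cong refl) (auto simp: v_def e_def)
    also have "\<dots> = p 1 * (\<Sum>m=1..N. p m * e (N - m)) + p N"
      unfolding sum.distrib sum_distrib_left[symmetric] using N by (subst sum.delta) auto
    also have "\<dots> = real N * v N"
      unfolding v_def p_def e_def hook_weight_convolution using N by simp
    finally show ?thesis .
  qed
  from cycle_index(1)[of v p, OF _ this assms(1) refl]
  have "(\<Sum>q | q permutes A. orbit_prod p q A) = fact (card A) * v (card A)" by (simp add: v_def)
  moreover have "0 < card A" using assms by (simp add: card_gt_0_iff)
  ultimately have "(\<Sum>q | q permutes A. orbit_prod p q A) = fact (card A) * (p 1 * e (card A))"
    by (simp add: v_def)
  moreover have "orbit_prod p q A = poly (cycle_poly q A) s * poly (cycle_poly q A) u" for q
    unfolding poly_cycle_poly by (simp add: p_def orbit_prod_def prod.distrib)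
  ultimately show ?thesis by (simp add: p_def e_def)
qed

text \<open>Dividing the sum of det(1 - s P) det(1 - u P) by (1 - s) (1 - u) leaves n! times the sum
  of (s u)^b over b < n, and comparison of coefficients gives orthogonality. The variables are
  treated in turn: \<open>u\<close> is a number while coefficients in s are read off, and then
  becomes the variable itself.\<close>

lemma hook_poly_orthogonal:
  assumes A: "finite A" "A \<noteq> {}" and ij: "i < card A" "j < card A"
  shows "(\<Sum>p | p permutes A. coeff (hook_poly p A) i * coeff (hook_poly p A) j) = (if i = j then fact (card A) else 0)"
proof -
  define n where "n = card A"
  define L :: "real poly" where "L = [:1, -1:]"
  have L0: "L \<noteq> 0" by (simp add: L_def)
  have pL: "poly L x = 1 - x" for x by (simp add: L_def)
  have G: "cycle_poly p A = L * hook_poly p A" for p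
    unfolding L_def by (rule hook_poly_eq[OF A, symmetric])
  have 1: "(\<Sum>p | p permutes A. poly (cycle_poly p A) u * coeff (hook_poly p A) i) = fact n * (1 - u) * u ^ i" for u
  proof -
    have "L * (\<Sum>p | p permutes A. Polynomial.smult (poly (cycle_poly p A) u) (hook_poly p A)) =
        L * Polynomial.smult (fact n * (1 - u)) (\<Sum>b<n. monom (u ^ b) b)"
    proof (rule poly_eqI_nat)
      fix q
      let ?s = "real q"
      have "poly (L * (\<Sum>p | p permutes A. Polynomial.smult (poly (cycle_poly p A) u) (hook_poly p A))) ?s =
          (\<Sum>p | p permutes A. poly (cycle_poly p A) ?s * poly (cycle_poly p A) u)"
        unfolding poly_mult poly_sum sum_distrib_left poly_smult
        by (rule sum.cong[OF refl]) (simp only: G poly_mult mult_ac)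
      also have "\<dots> = fact n * ((1 - ?s) * (1 - u) * (\<Sum>b<n. (?s * u) ^ b))"
        unfolding n_def by (rule sum_cycle_poly_products[OF A])
      also have "\<dots> = poly (L * Polynomial.smult (fact n * (1 - u)) (\<Sum>b<n. monom (u ^ b) b)) ?s"
        by (simp add: pL poly_sum poly_monom power_mult_distrib mult_ac)
      finally show "poly (L * (\<Sum>p | p permutes A. Polynomial.smult (poly (cycle_poly p A) u) (hook_poly p A))) ?s =
        poly (L * Polynomial.smult (fact n * (1 - u)) (\<Sum>b<n. monom (u ^ b) b)) ?s" .
    qed
    then have "(\<Sum>p | p permutes A. Polynomial.smult (poly (cycle_poly p A) u) (hook_poly p A)) =
        Polynomial.smult (fact n * (1 - u)) (\<Sum>b<n. monom (u ^ b) b)"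
      using L0 by (simp only: mult_cancel_left) simp
    then have "coeff (\<Sum>p | p permutes A. Polynomial.smult (poly (cycle_poly p A) u) (hook_poly p A)) i =
        coeff (Polynomial.smult (fact n * (1 - u)) (\<Sum>b<n. monom (u ^ b) b)) i" by (rule arg_cong)
    moreover have "(\<Sum>b<n. coeff (monom (u ^ b) b) i) = u ^ i"
      using ij by (simp add: n_def)
    ultimately show ?thesis by (simp add: coeff_sum)
  qed
  have "L * (\<Sum>p | p permutes A. Polynomial.smult (coeff (hook_poly p A) i) (hook_poly p A)) =
      L * monom (fact n) i"
  proof (rule poly_eqI_nat)
    fix q
    let ?s = "real q"
    have "poly (L * (\<Sum>p | p permutes A. Polynomial.smult (coeff (hook_poly p A) i) (hook_poly p A))) ?s =
        (\<Sum>p | p permutes A. poly (cycle_poly p A) ?s * coeff (hook_poly p A) i)"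
      unfolding poly_mult poly_sum sum_distrib_left poly_smult
      by (rule sum.cong[OF refl]) (simp only: G poly_mult mult_ac)
    also have "\<dots> = poly (L * monom (fact n) i) ?s"
      unfolding 1 by (simp add: pL poly_monom)
    finally show "poly (L * (\<Sum>p | p permutes A. Polynomial.smult (coeff (hook_poly p A) i) (hook_poly p A))) ?s =
      poly (L * monom (fact n) i) ?s" .
  qed
  then have "(\<Sum>p | p permutes A. Polynomial.smult (coeff (hook_poly p A) i) (hook_poly p A)) = monom (fact n) i"
    using L0 by (simp only: mult_cancel_left) simp
  then have "coeff (\<Sum>p | p permutes A. Polynomial.smult (coeff (hook_poly p A) i) (hook_poly p A)) j =
      coeff (monom (fact n) i) j" by (rule arg_cong)
  then show ?thesis by (simp add: coeff_sum n_def)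
qed

section \<open>Averages over the symmetric group\<close>

lemma card_full_cycles:
  assumes "finite A" "A \<noteq> {}"
  shows "real (card (full_cycles A)) = fact (card A - 1)"
proof -
  have n0: "0 < card A" using assms by (simp add: card_gt_0_iff)
  \<comment> \<open>At base 1 every power is 1, and only the constant coefficient of the hook
    polynomial meets a nonzero binomial.\<close>
  have "real (card (full_cycles A)) = (\<Sum>c\<in>full_cycles A. real 1 ^ cyc (c \<circ> id) A)" by simp
  also have "\<dots> = fact (card A - 1) *
      (\<Sum>b<card A. coeff (hook_poly id A) b * real ((1 + (card A - 1 - b)) choose card A))"
    by (rule sum_full_cycles_power[OF assms permutes_id])
  also have "(\<Sum>b<card A. coeff (hook_poly id A) b * real ((1 + (card A - 1 - b)) choose card A)) =
      (\<Sum>b<card A. if b = 0 then 1 else 0)"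
  proof (rule sum.cong[OF refl])
    fix b assume "b \<in> {..<card A}"
    then show "coeff (hook_poly id A) b * real ((1 + (card A - 1 - b)) choose card A) = (if b = 0 then 1 else 0)"
      using degree_hook_poly(3)[OF permutes_id assms] n0 by (simp add: binomial_eq_0)
  qed
  also have "\<dots> = 1" using n0 by simp
  finally show ?thesis by simp
qed

lemma sum_permutes_comp_right:
  assumes "c permutes A"
  shows "(\<Sum>p | p permutes A. f (p \<circ> c)) = (\<Sum>p | p permutes A. f p)"
  by (rule sum.reindex_bij_witness[of _ "\<lambda>p. p \<circ> pinv c" "\<lambda>p. p \<circ> c"])
    (auto simp: comp_assoc permutes_inv_o[OF assms] intro: permutes_compose[OF permutes_inv[OF assms]]
      permutes_compose[OF assms])

lemma sum_full_cycles_inv: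
  assumes "finite A"
  shows "(\<Sum>c\<in>full_cycles A. f (pinv c)) = (\<Sum>c\<in>full_cycles A. f c)"
  by (rule sum.reindex_bij_witness[of _ pinv pinv])
    (use inv_in_full_cycles[OF assms] in \<open>auto simp: full_cycles_def permutes_inv_inv\<close>)

text \<open>Invariance under rotation and the translation of \<open>p\<close> by \<open>c1\<close>
  move one full cycle to each of the two powers. The inner sums then decouple into two expansions in
  the hook coefficients of the same \<open>p\<close>, and orthogonality leaves only equal
  indices.\<close>

lemma sum_two_full_cycles:
  assumes A: "finite A" "A \<noteq> {}"
  defines "n \<equiv> card A"
  shows "(\<Sum>p | p permutes A. \<Sum>c1\<in>full_cycles A. \<Sum>c2\<in>full_cycles A.
      real a ^ cyc p A * real b ^ cyc (c1 \<circ> (c2 \<circ> p)) A) =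
    fact n * (fact (n - 1) * fact (n - 1)) *
      (\<Sum>i<n. real ((a + (n - 1 - i)) choose n) * real ((b + (n - 1 - i)) choose n))"
proof -
  let ?P = "{p. p permutes A}" and ?F = "full_cycles A"
  let ?U = "\<lambda>q p. \<Sum>c\<in>?F. real q ^ cyc (c \<circ> p) A"
  let ?B = "\<lambda>q i. real ((q + (n - 1 - i)) choose n)"
  have "(\<Sum>p\<in>?P. \<Sum>c1\<in>?F. \<Sum>c2\<in>?F. real a ^ cyc p A * real b ^ cyc (c1 \<circ> (c2 \<circ> p)) A) =
      (\<Sum>c1\<in>?F. \<Sum>p\<in>?P. real a ^ cyc p A * (\<Sum>c2\<in>?F. real b ^ cyc (c1 \<circ> (c2 \<circ> p)) A))"
    unfolding sum_distrib_left by (rule sum.swap)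
  also have "\<dots> = (\<Sum>c1\<in>?F. \<Sum>p\<in>?P. real a ^ cyc (pinv c1 \<circ> p) A * ?U b p)"
  proof (rule sum.cong[OF refl])
    fix c1 assume "c1 \<in> ?F"
    then have c1: "c1 permutes A" by (simp add: full_cycles_def)
    have "(\<Sum>p\<in>?P. real a ^ cyc p A * (\<Sum>c2\<in>?F. real b ^ cyc (c1 \<circ> (c2 \<circ> p)) A)) =
        (\<Sum>p\<in>?P. real a ^ cyc (p \<circ> c1 \<circ> pinv c1) A * ?U b (p \<circ> c1))"
    proof (rule sum.cong[OF refl])
      fix p assume "p \<in> ?P"
      have "cyc (c1 \<circ> (c2 \<circ> p)) A = cyc (c2 \<circ> (p \<circ> c1)) A" for c2
        using cyc_comp_commute[OF c1, of "c2 \<circ> p"] by (simp add: comp_assoc)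
      moreover have "p \<circ> c1 \<circ> pinv c1 = p" by (simp add: comp_assoc permutes_inv_o[OF c1])
      ultimately show "real a ^ cyc p A * (\<Sum>c2\<in>?F. real b ^ cyc (c1 \<circ> (c2 \<circ> p)) A) =
        real a ^ cyc (p \<circ> c1 \<circ> pinv c1) A * ?U b (p \<circ> c1)" by (simp only:)
    qed
    also have "\<dots> = (\<Sum>p\<in>?P. real a ^ cyc (p \<circ> pinv c1) A * ?U b p)"
      by (rule sum_permutes_comp_right[OF c1])
    also have "\<dots> = (\<Sum>p\<in>?P. real a ^ cyc (pinv c1 \<circ> p) A * ?U b p)"
      by (simp only: cyc_comp_commute[OF permutes_inv[OF c1]])
    finally show "(\<Sum>p\<in>?P. real a ^ cyc p A * (\<Sum>c2\<in>?F. real b ^ cyc (c1 \<circ> (c2 \<circ> p)) A)) =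
      (\<Sum>p\<in>?P. real a ^ cyc (pinv c1 \<circ> p) A * ?U b p)" .
  qed
  also have "\<dots> = (\<Sum>p\<in>?P. \<Sum>c1\<in>?F. real a ^ cyc (pinv c1 \<circ> p) A * ?U b p)"
    by (rule sum.swap)
  also have "\<dots> = (\<Sum>p\<in>?P. ?U a p * ?U b p)"
    unfolding sum_distrib_right[symmetric]
    by (intro sum.cong refl arg_cong2[of _ _ _ _ "(*)"] sum_full_cycles_inv[OF A(1), of "\<lambda>c. real a ^ cyc (c \<circ> p) A" for p])
  also have "\<dots> = (\<Sum>p\<in>?P. (fact (n - 1) * (\<Sum>i<n. coeff (hook_poly p A) i * ?B a i)) *
      (fact (n - 1) * (\<Sum>j<n. coeff (hook_poly p A) j * ?B b j)))"
    unfolding n_def by (intro sum.cong refl) (simp only: sum_full_cycles_power[OF A] mem_Collect_eq)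
  also have "\<dots> = (\<Sum>p\<in>?P. \<Sum>i<n. \<Sum>j<n. fact (n - 1) * fact (n - 1) * ?B a i * ?B b j *
      (coeff (hook_poly p A) i * coeff (hook_poly p A) j))"
  proof (rule sum.cong[OF refl])
    fix p
    let ?f = "\<lambda>q i. coeff (hook_poly p A) i * ?B q i"
    have m: "(x * S) * (x * T) = x * x * (S * T)" for x S T :: real by (simp only: mult_ac)
    have "(fact (n - 1) * sum (?f a) {..<n}) * (fact (n - 1) * sum (?f b) {..<n}) =
        fact (n - 1) * fact (n - 1) * (\<Sum>i<n. \<Sum>j<n. ?f a i * ?f b j)"
      unfolding m sum_product ..
    also have "\<dots> = (\<Sum>i<n. \<Sum>j<n. fact (n - 1) * fact (n - 1) * ?B a i * ?B b j *
        (coeff (hook_poly p A) i * coeff (hook_poly p A) j))"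
      unfolding sum_distrib_left by (intro sum.cong refl) (simp only: mult_ac)
    finally show "(fact (n - 1) * sum (?f a) {..<n}) * (fact (n - 1) * sum (?f b) {..<n}) =
      (\<Sum>i<n. \<Sum>j<n. fact (n - 1) * fact (n - 1) * ?B a i * ?B b j *
        (coeff (hook_poly p A) i * coeff (hook_poly p A) j))" .
  qed
  also have "\<dots> = (\<Sum>i<n. \<Sum>j<n. \<Sum>p\<in>?P. fact (n - 1) * fact (n - 1) * ?B a i * ?B b j *
      (coeff (hook_poly p A) i * coeff (hook_poly p A) j))"
    by (subst sum.swap) (intro sum.cong refl sum.swap)
  also have "\<dots> = (\<Sum>i<n. \<Sum>j<n. fact (n - 1) * fact (n - 1) * ?B a i * ?B b j * (if i = j then fact n else 0))"
    unfolding sum_distrib_left[symmetric]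
    by (intro sum.cong refl) (simp add: hook_poly_orthogonal[OF A] n_def)
  also have "\<dots> = (\<Sum>i<n. fact (n - 1) * fact (n - 1) * ?B a i * ?B b i * fact n)"
    by (intro sum.cong refl) (simp add: if_distrib[of "(*) _"] cong: if_cong)
  also have "\<dots> = fact n * (fact (n - 1) * fact (n - 1)) * (\<Sum>i<n. ?B a i * ?B b i)"
    unfolding sum_distrib_left by (rule sum.cong[OF refl]) (simp only: mult_ac)
  finally show ?thesis .
qed

text \<open>The fixed point is part of the data. With three or more points the cycle determines it,
  but on two points the cycle is the identity and occurs with both markings.\<close>

definition near_full_cycles :: "'a set \<Rightarrow> ('a \<times> ('a \<Rightarrow> 'a)) set" where
  "near_full_cycles A = (SIGMA i:A. full_cycles (A - {i}))"

lemma sum_near_full_cycles: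
  assumes "finite A"
  shows "(\<Sum>x\<in>near_full_cycles A. f (snd x)) = (\<Sum>i\<in>A. \<Sum>d\<in>full_cycles (A - {i}). f d)"
  unfolding near_full_cycles_def
  by (subst sum.Sigma) (use assms in \<open>auto simp: finite_full_cycles intro!: sum.cong\<close>)

lemma near_full_cycle_permutes:
  assumes "x \<in> near_full_cycles A"
  shows "snd x permutes A"
proof -
  obtain i d where x: "x = (i, d)" "d permutes A - {i}"
    using assms by (auto simp: near_full_cycles_def full_cycles_def)
  then show ?thesis using permutes_subset[OF x(2), of A] by auto
qed

lemma sign_full_cycle:
  assumes "finite A" "c \<in> full_cycles A"
  shows "sign c = (- 1) ^ Suc (card A)"
  using sign_eq_cyc[OF assms(1), of c] assms(2) by (simp add: full_cycles_def)

lemma sign_near_full_cycle: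
  assumes "finite A" "x \<in> near_full_cycles A"
  shows "sign (snd x) = (- 1) ^ card A"
proof -
  obtain i d where x: "x = (i, d)" "i \<in> A" "d \<in> full_cycles (A - {i})"
    using assms by (auto simp: near_full_cycles_def)
  have "sign d = (- 1) ^ Suc (card (A - {i}))" using x assms(1) by (intro sign_full_cycle) auto
  also have "Suc (card (A - {i})) = card A" by (rule card_Suc_Diff1[OF assms(1) x(2)])
  finally show ?thesis by (simp add: x)
qed

lemma sum_factorizations:
  fixes f :: "('a \<Rightarrow> 'a) \<Rightarrow> real"
  assumes A: "finite A" "2 \<le> card A"
  shows "(\<Sum>c\<in>full_cycles A. \<Sum>x\<in>near_full_cycles A. f (c \<circ> snd x)) =
    fact (card A - 2) * (\<Sum>p | p permutes A. (1 - real_of_int (sign p)) * f p)"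
  using sum_near_full_cycles[OF A(1)] sum_near_full_products[OF A, of f]
  by (simp add: sum_near_full_cycles[OF A(1), of "\<lambda>d. f (c \<circ> d)" for c])

lemma card_factorizations:
  assumes A: "finite A" "2 \<le> card A"
  shows "real (card (full_cycles A)) * real (card (near_full_cycles A)) = fact (card A - 2) * fact (card A)"
proof -
  have "real (card (full_cycles A)) * real (card (near_full_cycles A)) =
      (\<Sum>c\<in>full_cycles A. \<Sum>x\<in>near_full_cycles A. 1)" by simp
  also have "\<dots> = fact (card A - 2) * (\<Sum>p | p permutes A. (1 - real_of_int (sign p)) * 1)"
    by (rule sum_factorizations[OF A])
  \<comment> \<open>The signs sum to 0 because there are at least two points: their sum is the
    signed sum at a = 1, which contains 1 choose n.\<close>
  also have "(\<Sum>p | p permutes A. (1 - real_of_int (sign p)) * 1) = fact (card A)"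
    using sum_binomial_cyc[OF A(1) refl, of 1] A by (simp add: left_diff_distrib sum_subtractf binomial_eq_0)
  finally show ?thesis .
qed

lemma permutes_sign_comp:
  assumes "finite A" "p permutes A" "q permutes A"
  shows "real_of_int (sign (p \<circ> q)) = real_of_int (sign p) * real_of_int (sign q)"
proof -
  have "permutation p" "permutation q" using assms permutation_permutes by blast+
  then show ?thesis by (simp add: sign_compose)
qed

text \<open>For \<open>e = 1\<close> or \<open>e = - 1\<close> the first factor is twice the
  indicator of equal or of opposite signs, so \<open>q\<close> runs over one coset of the
  alternating group that depends on \<open>p\<close>. Expanding the factor leaves only the trivial
  and the sign character.\<close>

lemma sum_sign_correlation:
  assumes A: "finite A" "card A = n"
  shows "(\<Sum>p | p permutes A. \<Sum>q | q permutes A.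
      (1 + e * (real_of_int (sign p) * real_of_int (sign q))) * (real a ^ cyc p A * real b ^ cyc q A)) =
    fact n * fact n * (real ((a + n - 1) choose n) * real ((b + n - 1) choose n) + e * (real (a choose n) * real (b choose n)))"
proof -
  have "(\<Sum>p | p permutes A. \<Sum>q | q permutes A.
      (1 + e * (real_of_int (sign p) * real_of_int (sign q))) * (real a ^ cyc p A * real b ^ cyc q A)) =
    (\<Sum>p | p permutes A. real a ^ cyc p A) * (\<Sum>q | q permutes A. real b ^ cyc q A) +
    e * ((\<Sum>p | p permutes A. real_of_int (sign p) * real a ^ cyc p A) *
      (\<Sum>q | q permutes A. real_of_int (sign q) * real b ^ cyc q A))"
  proof -
    let ?a = "\<lambda>p. real a ^ cyc p A" and ?b = "\<lambda>p. real b ^ cyc p A"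
    let ?P = "{p. p permutes A}"
    have "(\<Sum>p\<in>?P. ?a p) * (\<Sum>q\<in>?P. ?b q) = (\<Sum>p\<in>?P. \<Sum>q\<in>?P. ?a p * ?b q)"
      by (rule sum_product)
    moreover have "e * ((\<Sum>p\<in>?P. real_of_int (sign p) * ?a p) * (\<Sum>q\<in>?P. real_of_int (sign q) * ?b q)) =
        (\<Sum>p\<in>?P. \<Sum>q\<in>?P. e * ((real_of_int (sign p) * ?a p) * (real_of_int (sign q) * ?b q)))"
      by (subst sum_product) (simp only: sum_distrib_left)
    ultimately show ?thesis
      unfolding sum.distrib[symmetric] by (simp only: sum.distrib[symmetric])
        (intro sum.cong refl, simp add: algebra_simps)
  qed
  then show ?thesis unfolding sum_binomial_cyc[OF A] by (simp add: algebra_simps)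
qed

text \<open>\<open>c \<circ> snd x\<close> is uniform on the odd permutations, so its product with
  \<open>p\<close> is uniform on the permutations whose sign is opposite to that of
  \<open>p\<close>.\<close>

lemma sum_full_near:
  assumes A: "finite A" "2 \<le> card A"
  defines "n \<equiv> card A"
  shows "(\<Sum>p | p permutes A. \<Sum>c\<in>full_cycles A. \<Sum>x\<in>near_full_cycles A.
      real a ^ cyc p A * real b ^ cyc (c \<circ> (snd x \<circ> p)) A) =
    fact n * (real (card (full_cycles A)) * real (card (near_full_cycles A))) *
      (real ((a + n - 1) choose n) * real ((b + n - 1) choose n) - real (a choose n) * real (b choose n))"
proof -
  let ?P = "{p. p permutes A}"
  have "(\<Sum>p\<in>?P. \<Sum>c\<in>full_cycles A. \<Sum>x\<in>near_full_cycles A.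
      real a ^ cyc p A * real b ^ cyc (c \<circ> (snd x \<circ> p)) A) =
    (\<Sum>p\<in>?P. fact (n - 2) * (\<Sum>q\<in>?P. (1 + (- 1) * (real_of_int (sign p) * real_of_int (sign q))) * (real a ^ cyc p A * real b ^ cyc q A)))"
  proof (rule sum.cong[OF refl])
    fix p assume "p \<in> ?P"
    then have p: "p permutes A" by simp
    have "(\<Sum>c\<in>full_cycles A. \<Sum>x\<in>near_full_cycles A. real a ^ cyc p A * real b ^ cyc (c \<circ> (snd x \<circ> p)) A) =
        fact (n - 2) * (\<Sum>q\<in>?P. (1 - real_of_int (sign q)) * (real a ^ cyc p A * real b ^ cyc (q \<circ> p) A))"
      unfolding n_def sum_factorizations[OF A, symmetric] by (simp only: comp_assoc)
    also have "(\<Sum>q\<in>?P. (1 - real_of_int (sign q)) * (real a ^ cyc p A * real b ^ cyc (q \<circ> p) A)) =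
        (\<Sum>q\<in>?P. (1 + (- 1) * (real_of_int (sign p) * real_of_int (sign (q \<circ> p)))) * (real a ^ cyc p A * real b ^ cyc (q \<circ> p) A))"
    proof (rule sum.cong[OF refl])
      fix q assume "q \<in> ?P"
      then have "real_of_int (sign (q \<circ> p)) = real_of_int (sign q) * real_of_int (sign p)"
        using p by (intro permutes_sign_comp[OF A(1)]) auto
      moreover have "real_of_int (sign p) * real_of_int (sign p) = 1"
        by (simp flip: of_int_mult)
      ultimately show "(1 - real_of_int (sign q)) * (real a ^ cyc p A * real b ^ cyc (q \<circ> p) A) =
        (1 + (- 1) * (real_of_int (sign p) * real_of_int (sign (q \<circ> p)))) * (real a ^ cyc p A * real b ^ cyc (q \<circ> p) A)"
        by (simp add: mult.left_commute)
    qed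
    also have "\<dots> = (\<Sum>q\<in>?P. (1 + (- 1) * (real_of_int (sign p) * real_of_int (sign q))) * (real a ^ cyc p A * real b ^ cyc q A))"
      by (rule sum_permutes_comp_right[OF p])
    finally show "(\<Sum>c\<in>full_cycles A. \<Sum>x\<in>near_full_cycles A. real a ^ cyc p A * real b ^ cyc (c \<circ> (snd x \<circ> p)) A) =
      fact (n - 2) * (\<Sum>q\<in>?P. (1 + (- 1) * (real_of_int (sign p) * real_of_int (sign q))) * (real a ^ cyc p A * real b ^ cyc q A))" .
  qed
  also have "\<dots> = fact (n - 2) * (fact n * fact n * (real ((a + n - 1) choose n) * real ((b + n - 1) choose n) +
      (- 1) * (real (a choose n) * real (b choose n))))"
    unfolding sum_distrib_left[symmetric] n_def sum_sign_correlation[OF A(1) refl] ..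
  finally show ?thesis unfolding card_factorizations[OF A] n_def[symmetric] by (simp only: mult_ac) simp
qed

text \<open>The pair of \<open>c2\<close> and \<open>snd x\<close> already makes the product uniform
  on a coset, while \<open>c1\<close> and \<open>snd y\<close> are held fixed. The product of these
  two is odd as well, so the total keeps the sign of \<open>p\<close>; hence plus where
  \<open>sum_full_near\<close> has minus.\<close>

lemma sum_two_full_two_near:
  assumes A: "finite A" "2 \<le> card A"
  defines "n \<equiv> card A"
  shows "(\<Sum>p | p permutes A. \<Sum>c1\<in>full_cycles A. \<Sum>c2\<in>full_cycles A. \<Sum>x\<in>near_full_cycles A. \<Sum>y\<in>near_full_cycles A.
      real a ^ cyc p A * real b ^ cyc (c1 \<circ> (c2 \<circ> (snd x \<circ> (snd y \<circ> p)))) A) =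
    fact n * ((real (card (full_cycles A)) * real (card (full_cycles A))) *
      (real (card (near_full_cycles A)) * real (card (near_full_cycles A)))) *
      (real ((a + n - 1) choose n) * real ((b + n - 1) choose n) + real (a choose n) * real (b choose n))"
proof -
  let ?P = "{p. p permutes A}" and ?F = "full_cycles A" and ?N = "near_full_cycles A"
  let ?H = "\<lambda>p q. real a ^ cyc p A * real b ^ cyc q A"
  let ?s = "\<lambda>p. real_of_int (sign p)"
  define W where "W = (\<lambda>p. fact (n - 2) * (\<Sum>q\<in>?P. (1 + 1 * (?s p * ?s q)) * ?H p q))"
  have inner: "(\<Sum>c2\<in>?F. \<Sum>x\<in>?N. ?H p (c1 \<circ> (c2 \<circ> (snd x \<circ> (snd y \<circ> p))))) = W p"
    if p: "p permutes A" and c1: "c1 \<in> ?F" and y: "y \<in> ?N" for p c1 y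
  proof -
    have c1p: "c1 permutes A" using c1 by (simp add: full_cycles_def)
    have yp: "(snd y \<circ> p) permutes A" by (rule permutes_compose[OF p near_full_cycle_permutes[OF y]])
    have "(\<Sum>c2\<in>?F. \<Sum>x\<in>?N. ?H p (c1 \<circ> (c2 \<circ> (snd x \<circ> (snd y \<circ> p))))) =
        fact (n - 2) * (\<Sum>q\<in>?P. (1 - ?s q) * ?H p (c1 \<circ> (q \<circ> (snd y \<circ> p))))"
      unfolding n_def sum_factorizations[OF A, symmetric] by (simp only: comp_assoc)
    also have "(\<Sum>q\<in>?P. (1 - ?s q) * ?H p (c1 \<circ> (q \<circ> (snd y \<circ> p)))) =
        (\<Sum>q\<in>?P. (1 + 1 * (?s p * ?s (q \<circ> (snd y \<circ> p \<circ> c1)))) * ?H p (q \<circ> (snd y \<circ> p \<circ> c1)))"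
    proof (rule sum.cong[OF refl])
      fix q assume "q \<in> ?P"
      then have q: "q permutes A" by simp
      \<comment> \<open>Rotation brings \<open>c1\<close> behind the free factor \<open>q\<close>,
        so that a single right translation of \<open>q\<close> suffices.\<close>
      have "cyc (c1 \<circ> (q \<circ> (snd y \<circ> p))) A = cyc (q \<circ> (snd y \<circ> p) \<circ> c1) A"
        by (rule cyc_comp_commute[OF c1p, symmetric])
      then have c: "cyc (c1 \<circ> (q \<circ> (snd y \<circ> p))) A = cyc (q \<circ> (snd y \<circ> p \<circ> c1)) A"
        by (simp only: comp_assoc)
      have "?s (q \<circ> (snd y \<circ> p \<circ> c1)) = ?s q * (?s (snd y) * ?s p * ?s c1)"
        using permutes_sign_comp[OF A(1) q permutes_compose[OF c1p yp]]
          permutes_sign_comp[OF A(1) yp c1p] permutes_sign_comp[OF A(1) near_full_cycle_permutes[OF y] p]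
        by simp
      moreover have "?s (snd y) * ?s c1 = - 1"
        unfolding sign_near_full_cycle[OF A(1) y] sign_full_cycle[OF A(1) c1]
        by (simp flip: power_mult_distrib)
      moreover have "?s p * ?s p = 1" by (simp flip: of_int_mult)
      ultimately have "?s p * ?s (q \<circ> (snd y \<circ> p \<circ> c1)) = - ?s q"
        by (metis (no_types, opaque_lifting) mult.assoc mult.commute mult.right_neutral mult_minus_right)
      then show "(1 - ?s q) * ?H p (c1 \<circ> (q \<circ> (snd y \<circ> p))) =
        (1 + 1 * (?s p * ?s (q \<circ> (snd y \<circ> p \<circ> c1)))) * ?H p (q \<circ> (snd y \<circ> p \<circ> c1))"
        unfolding c by simp
    qed
    also have "\<dots> = (\<Sum>q\<in>?P. (1 + 1 * (?s p * ?s q)) * ?H p q)"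
      by (rule sum_permutes_comp_right) (rule permutes_compose[OF c1p yp])
    finally show ?thesis by (simp only: W_def)
  qed
  have "(\<Sum>p\<in>?P. \<Sum>c1\<in>?F. \<Sum>c2\<in>?F. \<Sum>x\<in>?N. \<Sum>y\<in>?N. ?H p (c1 \<circ> (c2 \<circ> (snd x \<circ> (snd y \<circ> p))))) =
      (\<Sum>p\<in>?P. \<Sum>c1\<in>?F. \<Sum>y\<in>?N. W p)"
  proof (rule sum.cong[OF refl], rule sum.cong[OF refl])
    fix p c1 assume "p \<in> ?P" and c1: "c1 \<in> ?F"
    then have p: "p permutes A" by simp
    have "(\<Sum>c2\<in>?F. \<Sum>x\<in>?N. \<Sum>y\<in>?N. ?H p (c1 \<circ> (c2 \<circ> (snd x \<circ> (snd y \<circ> p))))) =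
        (\<Sum>c2\<in>?F. \<Sum>y\<in>?N. \<Sum>x\<in>?N. ?H p (c1 \<circ> (c2 \<circ> (snd x \<circ> (snd y \<circ> p)))))"
      by (intro sum.cong refl sum.swap)
    also have "\<dots> = (\<Sum>y\<in>?N. \<Sum>c2\<in>?F. \<Sum>x\<in>?N. ?H p (c1 \<circ> (c2 \<circ> (snd x \<circ> (snd y \<circ> p)))))"
      by (rule sum.swap)
    also have "\<dots> = (\<Sum>y\<in>?N. W p)" by (rule sum.cong[OF refl]) (rule inner[OF p c1])
    finally show "(\<Sum>c2\<in>?F. \<Sum>x\<in>?N. \<Sum>y\<in>?N. ?H p (c1 \<circ> (c2 \<circ> (snd x \<circ> (snd y \<circ> p))))) = (\<Sum>y\<in>?N. W p)" .
  qed
  also have "\<dots> = (real (card ?F) * real (card ?N)) * (\<Sum>p\<in>?P. W p)"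
    by (simp add: sum_distrib_left mult.assoc)
  also have "(\<Sum>p\<in>?P. W p) = fact (n - 2) * (fact n * fact n * (real ((a + n - 1) choose n) * real ((b + n - 1) choose n) +
      1 * (real (a choose n) * real (b choose n))))"
    unfolding W_def sum_distrib_left[symmetric] n_def sum_sign_correlation[OF A(1) refl] ..
  also have "\<dots> = fact n * (real (card ?F) * real (card ?N)) * (real ((a + n - 1) choose n) * real ((b + n - 1) choose n) +
      real (a choose n) * real (b choose n))"
    unfolding card_factorizations[OF A] n_def[symmetric] by (simp only: mult_ac mult_1_left)
  finally show ?thesis by (simp only: mult_ac)
qed

section \<open>Monomial matrices\<close>

text \<open>The entries are indexed by columns, following the convention of
  \<open>permutation_matrix\<close>; products of matrices then compose the permutations in the same
  order.\<close>

definition mono_mat :: "nat \<Rightarrow> (nat \<Rightarrow> nat) \<Rightarrow> (nat \<Rightarrow> complex) \<Rightarrow> complex mat" where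
  "mono_mat n p e = mat n n (\<lambda>(i, j). if i = p j then e j else 0)"

lemma mono_mat_index: "i < n \<Longrightarrow> j < n \<Longrightarrow> mono_mat n p e $$ (i, j) = (if i = p j then e j else 0)"
  by (simp add: mono_mat_def)

lemma mono_mat_carrier: "mono_mat n p e \<in> carrier_mat n n"
  by (simp add: mono_mat_def)

lemma mono_mat_cong: "(\<And>j. j < n \<Longrightarrow> e j = f j) \<Longrightarrow> mono_mat n p e = mono_mat n p f"
  unfolding mono_mat_def by (intro cong_mat) auto

lemma permutes_less: "p permutes {..<n} \<Longrightarrow> p j < n \<longleftrightarrow> j < (n :: nat)"
  using permutes_in_image[of p "{..<n}" j] by simp

lemma mono_mat_mult:
  assumes "q permutes {..<n}"
  shows "mono_mat n p e * mono_mat n q f = mono_mat n (p \<circ> q) (\<lambda>j. e (q j) * f j)"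
proof (rule eq_matI)
  fix i j assume "i < dim_row (mono_mat n (p \<circ> q) (\<lambda>j. e (q j) * f j))" "j < dim_col (mono_mat n (p \<circ> q) (\<lambda>j. e (q j) * f j))"
  then have ij: "i < n" "j < n" by (simp_all add: mono_mat_def)
  have qj: "q j < n" using ij permutes_less[OF assms] by simp
  have "(mono_mat n p e * mono_mat n q f) $$ (i, j) = (\<Sum>k=0..<n. mono_mat n p e $$ (i, k) * mono_mat n q f $$ (k, j))"
    using ij by (simp add: scalar_prod_def mono_mat_def)
  also have "\<dots> = (\<Sum>k=0..<n. if k = q j then (if i = p (q j) then e (q j) * f j else 0) else 0)"
    by (rule sum.cong[OF refl]) (use ij in \<open>auto simp: mono_mat_index\<close>)
  also have "\<dots> = (if i = p (q j) then e (q j) * f j else 0)"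
    using qj by (subst sum.delta) auto
  finally show "(mono_mat n p e * mono_mat n q f) $$ (i, j) = mono_mat n (p \<circ> q) (\<lambda>j. e (q j) * f j) $$ (i, j)"
    using ij by (simp add: mono_mat_index)
qed (simp_all add: mono_mat_def)

lemma perm_of_mono_mat:
  assumes p: "p permutes {..<n}" and e: "\<And>j. j < n \<Longrightarrow> e j \<noteq> 0"
  shows "perm_of n (mono_mat n p e) = p"
  unfolding perm_of_def
proof (rule the_equality)
  have pm: "D * permutation_matrix n q = mat n n (\<lambda>(i, j). if i = q j then D $$ (i, i) else 0)"
    if D: "D \<in> carrier_mat n n" "diagonal_mat D" and q: "q permutes {..<n}" for D q
  proof (rule eq_matI)
    fix i j assume "i < dim_row (mat n n (\<lambda>(i, j). if i = q j then D $$ (i, i) else 0))"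
      "j < dim_col (mat n n (\<lambda>(i, j). if i = q j then D $$ (i, i) else 0))"
    then have ij: "i < n" "j < n" by simp_all
    have qj: "q j < n" using ij permutes_less[OF q] by simp
    have "(D * permutation_matrix n q) $$ (i, j) = (\<Sum>k=0..<n. D $$ (i, k) * permutation_matrix n q $$ (k, j))"
      using ij D by (simp add: scalar_prod_def permutation_matrix_def)
    also have "\<dots> = (\<Sum>k=0..<n. if k = q j then D $$ (i, q j) else 0)"
      by (rule sum.cong[OF refl]) (use ij in \<open>auto simp: permutation_matrix_def\<close>)
    also have "\<dots> = D $$ (i, q j)" using qj by (subst sum.delta) auto
    also have "\<dots> = (if i = q j then D $$ (i, i) else 0)"
      using D ij qj by (auto simp: diagonal_mat_def)
    finally show "(D * permutation_matrix n q) $$ (i, j) = mat n n (\<lambda>(i, j). if i = q j then D $$ (i, i) else 0) $$ (i, j)"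
      using ij by simp
  qed (use D in \<open>simp_all add: permutation_matrix_def\<close>)
  show "p permutes {..<n} \<and> (\<exists>D\<in>carrier_mat n n. diagonal_mat D \<and> mono_mat n p e = D * permutation_matrix n p)"
  proof (intro conjI p bexI)
    \<comment> \<open>The diagonal factor acts on rows, so its entry in row i is the value of
      \<open>e\<close> at the column \<open>pinv p i\<close>.\<close>
    let ?D = "mat n n (\<lambda>(i, j). if i = j then e (pinv p i) else 0)"
    show D: "?D \<in> carrier_mat n n" by simp
    show dg: "diagonal_mat ?D" by (simp add: diagonal_mat_def)
    show "mono_mat n p e = ?D * permutation_matrix n p"
      unfolding pm[OF D dg p] mono_mat_def
      by (rule cong_mat) (use permutes_less[OF p] in \<open>auto simp: permutes_inverses[OF p]\<close>)
  qed
  fix q assume "q permutes {..<n} \<and> (\<exists>D\<in>carrier_mat n n. diagonal_mat D \<and> mono_mat n p e = D * permutation_matrix n q)"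
  then obtain D where q: "q permutes {..<n}" and D: "D \<in> carrier_mat n n" "diagonal_mat D"
    "mono_mat n p e = D * permutation_matrix n q" by blast
  show "q = p"
  proof
    fix j
    show "q j = p j"
    proof (cases "j < n")
      case True
      then have pj: "p j < n" using permutes_less[OF p] by simp
      have "mono_mat n p e $$ (p j, j) \<noteq> 0" using True pj e by (simp add: mono_mat_index)
      then show ?thesis unfolding D(3) pm[OF D(1,2) q] using True pj by (auto split: if_splits)
    next
      case False
      then show ?thesis using p q by (simp add: permutes_not_in)
    qed
  qed
qed

lemma cycles_of_mono_mat:
  assumes "p permutes {..<n}" "\<And>j. j < n \<Longrightarrow> e j \<noteq> 0"
  shows "cycles_of n (mono_mat n p e) = orbits p {..<n}"
proof -
  have "perm_of n (mono_mat n p e) = p" using assms by (intro perm_of_mono_mat) auto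
  then show ?thesis by (simp add: cycles_of_def orbits_def)
qed

lemma cycle_product_mono_mat:
  assumes "p permutes {..<n}" "\<And>j. j < n \<Longrightarrow> e j \<noteq> 0" "C \<subseteq> {..<n}"
  shows "cycle_product n (mono_mat n p e) C = prod e C"
proof -
  have pm: "perm_of n (mono_mat n p e) = p" using assms(1,2) by (intro perm_of_mono_mat) auto
  show ?thesis unfolding cycle_product_def pm
  proof (rule prod.cong[OF refl])
    fix i assume "i \<in> C"
    then have "i < n" using assms(3) by auto
    then show "mono_mat n p e $$ (p i, i) = e i"
      using permutes_less[OF assms(1)] by (simp add: mono_mat_index)
  qed
qed

lemma type_of_mono_mat:
  assumes "p permutes {..<n}" "\<And>j. j < n \<Longrightarrow> e j \<noteq> 0"
  shows "type_of r n \<zeta> (mono_mat n p e) =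
    map (\<lambda>j. image_mset card (mset_set {C \<in> orbits p {..<n}. prod e C = \<zeta> ^ j})) [0..<r]"
proof -
  have "cycle_product n (mono_mat n p e) C = prod e C" if "C \<in> orbits p {..<n}" for C
    using Union_orbits[OF assms(1)] that assms by (intro cycle_product_mono_mat) auto
  then have "{C \<in> orbits p {..<n}. cycle_product n (mono_mat n p e) C = \<zeta> ^ j} =
      {C \<in> orbits p {..<n}. prod e C = \<zeta> ^ j}" for j by auto
  moreover have "cycles_of n (mono_mat n p e) = orbits p {..<n}"
    using assms by (intro cycles_of_mono_mat) auto
  ultimately show ?thesis by (simp add: type_of_def)
qed

section \<open>The group as a set of pairs of a permutation and a tuple of roots of unity\<close>

locale monomial_group =
  fixes r n :: nat and \<zeta> :: complex
  assumes r2: "2 \<le> r" and n1: "1 \<le> n" and prim: "primitive_root_of_unity r \<zeta>"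
begin

abbreviation A :: "nat set" where "A \<equiv> {..<n}"

definition Z :: "complex set" where "Z = (\<lambda>k. \<zeta> ^ k) ` {..<r}"

text \<open>Extensional tuples have fixed values outside \<open>A\<close>, so a matrix determines
  its pair and sums over the group become sums over this product set.\<close>

definition pairs :: "((nat \<Rightarrow> nat) \<times> (nat \<Rightarrow> complex)) set" where
  "pairs = {p. p permutes A} \<times> (A \<rightarrow>\<^sub>E Z)"

abbreviation M :: "(nat \<Rightarrow> nat) \<Rightarrow> (nat \<Rightarrow> complex) \<Rightarrow> complex mat" where "M \<equiv> mono_mat n"

lemma A_facts: "finite A" "A \<noteq> {}" "card A = n"
  using n1 by (auto simp: lessThan_empty_iff)

lemma zeta_r: "\<zeta> ^ r = 1" and zeta_nz: "\<zeta> \<noteq> 0"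
proof -
  show "\<zeta> ^ r = 1" using prim by (simp add: primitive_root_of_unity_def)
  then show "\<zeta> \<noteq> 0" using r2 by (auto simp: power_0_left)
qed

lemma zeta_inj: "inj_on (\<lambda>k. \<zeta> ^ k) {..<r}"
proof -
  have "\<zeta> ^ i \<noteq> \<zeta> ^ j" if "i < j" "j < r" for i j
  proof
    assume e: "\<zeta> ^ i = \<zeta> ^ j"
    have "\<zeta> ^ j = \<zeta> ^ i * \<zeta> ^ (j - i)" using that by (simp flip: power_add)
    then have "\<zeta> ^ (j - i) = 1" using e zeta_nz by simp
    then show False using prim that by (simp add: primitive_root_of_unity_def)
  qed
  then show ?thesis by (intro linorder_inj_onI) auto
qed

lemma zeta_power_in_Z: "\<zeta> ^ k \<in> Z"
proof -
  have "\<zeta> ^ k = \<zeta> ^ (k mod r + r * (k div r))" by simp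
  also have "\<dots> = \<zeta> ^ (k mod r)" by (simp only: power_add power_mult zeta_r power_one mult_1_right)
  finally show ?thesis unfolding Z_def using r2 by (intro image_eqI[of _ _ "k mod r"]) auto
qed

lemma range_zeta: "range (\<lambda>k :: nat. \<zeta> ^ k) = Z"
  using zeta_power_in_Z by (auto simp: Z_def)

lemma Z_facts: "finite Z" "card Z = r" "1 \<in> Z" "\<zeta> \<in> Z" "\<zeta> \<noteq> 1" "0 \<notin> Z"
proof -
  show "finite Z" "card Z = r" unfolding Z_def by (simp_all add: card_image zeta_inj)
  show "1 \<in> Z" "\<zeta> \<in> Z" using zeta_power_in_Z[of 0] zeta_power_in_Z[of 1] by simp_all
  show "\<zeta> \<noteq> 1" using prim r2 unfolding primitive_root_of_unity_def by (metis One_nat_def Suc_1 Suc_le_lessD less_numeral_extra(1) power_one_right)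
  show "0 \<notin> Z" using zeta_nz by (auto simp: Z_def)
qed

lemma Z_mult: "x \<in> Z \<Longrightarrow> y \<in> Z \<Longrightarrow> x * y \<in> Z"
  unfolding range_zeta[symmetric] by (auto simp flip: power_add)

lemma Z_power: "x \<in> Z \<Longrightarrow> x ^ r = 1"
  unfolding Z_def by (auto simp: zeta_r simp flip: power_mult) (simp add: mult.commute[of _ r] power_mult zeta_r)

lemma Z_nz: "x \<in> Z \<Longrightarrow> x \<noteq> 0"
  using Z_facts(6) by auto

lemma Z_inverse: "x \<in> Z \<Longrightarrow> inverse x \<in> Z"
proof -
  assume x: "x \<in> Z"
  have "x ^ (r - 1) \<in> Z"
    using x unfolding range_zeta[symmetric] by (auto simp flip: power_mult)
  moreover have "x ^ (r - 1) = inverse x"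
    using Z_power[OF x] Z_nz[OF x] r2 by (cases r) (auto simp: field_simps)
  ultimately show ?thesis by simp
qed

lemma Z_prod: "(\<And>i. i \<in> S \<Longrightarrow> e i \<in> Z) \<Longrightarrow> prod e S \<in> Z"
  by (induction S rule: infinite_finite_induct) (auto simp: Z_facts Z_mult)

lemma sum_Z_power:
  assumes "s < r"
  shows "(\<Sum>z\<in>Z. z ^ s) = (if s = 0 then of_nat r else 0)"
proof (cases "s = 0")
  case True
  then show ?thesis by (simp add: Z_facts)
next
  case False
  have "(\<Sum>z\<in>Z. z ^ s) = (\<Sum>k<r. (\<zeta> ^ s) ^ k)"
    unfolding Z_def sum.reindex[OF zeta_inj] by (simp add: mult.commute flip: power_mult)
  moreover have "\<zeta> ^ s \<noteq> 1" using False assms prim by (simp add: primitive_root_of_unity_def)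
  moreover have "(\<zeta> ^ s) ^ r = 1"
    by (metis mult.commute power_mult power_one zeta_r)
  ultimately show ?thesis using False by (simp add: sum_gp_strict)
qed

lemma sum_Z_inverse: "(\<Sum>z\<in>Z. f (inverse z)) = (\<Sum>z\<in>Z. f z)"
  by (rule sum.reindex_bij_witness[of _ inverse inverse]) (auto simp: Z_inverse)

text \<open>Column orthogonality: the powers with exponents below r run through all characters of
  \<open>Z\<close>.\<close>

lemma delta_one_Fourier:
  assumes "z \<in> Z"
  shows "(\<Sum>s<r. z ^ s) = (if z = 1 then of_nat r else 0)"
  using Z_power[OF assms] by (simp add: sum_gp_strict)

lemma pairs_entry:
  assumes "e \<in> A \<rightarrow>\<^sub>E Z" "j < n"
  shows "e j \<in> Z" "e j \<noteq> 0"
  using assms Z_nz by auto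

lemma M_in_Gn:
  assumes p: "p permutes A" and e: "\<And>j. j < n \<Longrightarrow> e j \<in> Z"
  shows "M p e \<in> Gn n \<zeta>"
  unfolding Gn_def range_zeta
proof (intro CollectI conjI allI impI)
  have nz: "e j \<noteq> 0" if "j < n" for j using e[OF that] Z_nz by blast
  show "M p e \<in> carrier_mat n n" by (rule mono_mat_carrier)
  fix i assume i: "i < n"
  have pi: "pinv p i < n" using i permutes_less[OF permutes_inv[OF p]] by simp
  show "\<exists>!j. j < n \<and> M p e $$ (i, j) \<noteq> 0"
  proof (rule ex1I[of _ "pinv p i"])
    show "pinv p i < n \<and> M p e $$ (i, pinv p i) \<noteq> 0"
      using pi i nz by (simp add: mono_mat_index permutes_inverses[OF p])
    fix j assume "j < n \<and> M p e $$ (i, j) \<noteq> 0"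
    then have "i = p j" using i by (auto simp: mono_mat_index split: if_splits)
    then show "j = pinv p i" by (simp add: permutes_inverses[OF p])
  qed
  have pj: "p i < n" using i permutes_less[OF p] by simp
  show "\<exists>!j. j < n \<and> M p e $$ (j, i) \<noteq> 0"
    by (rule ex1I[of _ "p i"]) (use pj i nz in \<open>auto simp: mono_mat_index split: if_splits\<close>)
  fix j assume "j < n" "M p e $$ (i, j) \<noteq> 0"
  then show "M p e $$ (i, j) \<in> Z" using i e by (auto simp: mono_mat_index split: if_splits)
qed

lemma Gn_bij: "bij_betw (\<lambda>(p, e). M p e) pairs (Gn n \<zeta>)"
  unfolding bij_betw_def
proof
  show "inj_on (\<lambda>(p, e). M p e) pairs"
  proof (rule inj_onI, clarify)
    fix p e q f assume pe: "(p, e) \<in> pairs" and qf: "(q, f) \<in> pairs" and eq: "M p e = M q f"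
    have p: "p permutes A" and e: "e \<in> A \<rightarrow>\<^sub>E Z" and q: "q permutes A" and f: "f \<in> A \<rightarrow>\<^sub>E Z"
      using pe qf by (auto simp: pairs_def)
    have "perm_of n (M p e) = p" "perm_of n (M q f) = q"
      by (intro perm_of_mono_mat p q pairs_entry(2)[OF e] pairs_entry(2)[OF f]; assumption)+
    then have pq: "p = q" using eq by simp
    have "e j = f j" if "j \<in> A" for j
    proof -
      have "M p e $$ (p j, j) = M q f $$ (p j, j)" using eq by simp
      then show ?thesis using that permutes_less[OF p, of j] by (simp add: mono_mat_index pq)
    qed
    then have "e = f" by (rule PiE_ext[OF e f])
    with pq show "p = q \<and> e = f" by simp
  qed
  show "(\<lambda>(p, e). M p e) ` pairs = Gn n \<zeta>"
  proof (intro equalityI subsetI)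
    fix x assume "x \<in> (\<lambda>(p, e). M p e) ` pairs"
    then show "x \<in> Gn n \<zeta>" by (auto simp: pairs_def intro!: M_in_Gn)
  next
    fix x assume x: "x \<in> Gn n \<zeta>"
    then have c: "x \<in> carrier_mat n n"
      and row: "\<And>i. i < n \<Longrightarrow> \<exists>!j. j < n \<and> x $$ (i, j) \<noteq> 0"
      and col: "\<And>j. j < n \<Longrightarrow> \<exists>!i. i < n \<and> x $$ (i, j) \<noteq> 0"
      and ent: "\<And>i j. i < n \<Longrightarrow> j < n \<Longrightarrow> x $$ (i, j) \<noteq> 0 \<Longrightarrow> x $$ (i, j) \<in> Z"
      unfolding Gn_def range_zeta by auto
    define p where "p = (\<lambda>j. if j < n then THE i. i < n \<and> x $$ (i, j) \<noteq> 0 else j)"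
    have pj: "p j < n" "x $$ (p j, j) \<noteq> 0" if "j < n" for j
      using theI'[OF col[OF that]] that by (auto simp: p_def)
    have pu: "i = p j" if "i < n" "j < n" "x $$ (i, j) \<noteq> 0" for i j
      using col[OF that(2)] pj[OF that(2)] that by blast
    have "inj_on p A"
    proof (rule inj_onI)
      fix i j assume "i \<in> A" "j \<in> A" "p i = p j"
      then show "i = j" using pj[of i] pj[of j] row[of "p j"] by auto
    qed
    moreover have "p ` A \<subseteq> A" using pj by auto
    ultimately have "bij_betw p A A" by (simp add: bij_betw_def endo_inj_surj)
    then have p: "p permutes A" by (rule bij_imp_permutes) (simp add: p_def)
    define e where "e = restrict (\<lambda>j. x $$ (p j, j)) A"
    have e: "e \<in> A \<rightarrow>\<^sub>E Z" using pj ent by (auto simp: e_def)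
    have "x = M p e"
    proof (rule eq_matI)
      fix i j assume "i < dim_row (M p e)" "j < dim_col (M p e)"
      then have "i < n" "j < n" by (simp_all add: mono_mat_def)
      then show "x $$ (i, j) = M p e $$ (i, j)" using pu[of i j] by (auto simp: mono_mat_index e_def)
    qed (use c in \<open>simp_all add: mono_mat_def\<close>)
    then show "x \<in> (\<lambda>(p, e). M p e) ` pairs" using p e by (force simp: pairs_def)
  qed
qed

lemma finite_entries: "finite S \<Longrightarrow> finite (S \<rightarrow>\<^sub>E Z)"
  by (intro finite_PiE) (auto simp: Z_facts)

lemma sum_Gn: "(\<Sum>x\<in>Gn n \<zeta>. F x) = (\<Sum>p | p permutes A. \<Sum>e\<in>A \<rightarrow>\<^sub>E Z. F (M p e))"
proof -
  have "(\<Sum>x\<in>Gn n \<zeta>. F x) = (\<Sum>x\<in>pairs. F ((\<lambda>(p, e). M p e) x))"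
    by (rule sum.reindex_bij_betw[OF Gn_bij, symmetric])
  also have "\<dots> = (\<Sum>p | p permutes A. \<Sum>e\<in>A \<rightarrow>\<^sub>E Z. F (M p e))"
    unfolding pairs_def by (subst sum.cartesian_product) (simp add: case_prod_beta)
  finally show ?thesis .
qed

lemma finite_Gn: "finite (Gn n \<zeta>)"
  using bij_betw_finite[OF Gn_bij] by (simp add: pairs_def finite_entries finite_permutations)

lemma card_Gn: "card (Gn n \<zeta>) = fact n * r ^ n"
proof -
  have "card (Gn n \<zeta>) = card pairs" by (rule bij_betw_same_card[OF Gn_bij, symmetric])
  also have "\<dots> = fact n * r ^ n"
    by (simp add: pairs_def card_cartesian_product card_permutations card_PiE Z_facts)
  finally show ?thesis .
qed

lemma Gn_cases:
  assumes "x \<in> Gn n \<zeta>"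
  obtains p e where "p permutes A" "e \<in> A \<rightarrow>\<^sub>E Z" "x = M p e"
  using assms bij_betw_imp_surj_on[OF Gn_bij] by (force simp: pairs_def)

lemma type_of_M:
  assumes "p permutes A" "e \<in> A \<rightarrow>\<^sub>E Z"
  shows "type_of r n \<zeta> (M p e) =
    map (\<lambda>j. image_mset card (mset_set {C \<in> orbits p A. prod e C = \<zeta> ^ j})) [0..<r]"
  using assms pairs_entry(2)[OF assms(2)] by (intro type_of_mono_mat) auto

lemma ell_M:
  assumes "p permutes A" "e \<in> A \<rightarrow>\<^sub>E Z"
  shows "ell r n \<zeta> (M p e) = card {C \<in> orbits p A. prod e C = 1}"
  unfolding ell_def type_of_M[OF assms] using r2 by (simp add: nth_map)

lemma ell_le: "x \<in> Gn n \<zeta> \<Longrightarrow> ell r n \<zeta> x \<le> n"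
proof (elim Gn_cases)
  fix p e assume pe: "p permutes A" "e \<in> A \<rightarrow>\<^sub>E Z" "x = M p e"
  have "card {C \<in> orbits p A. prod e C = 1} \<le> card (orbits p A)"
    by (intro card_mono finite_orbits) auto
  also have "\<dots> \<le> card A" unfolding orbits_def by (rule card_image_le) simp
  finally show ?thesis by (simp add: pe ell_M)
qed

section \<open>Sums over tuples of entries\<close>

lemma sum_PiE_insert:
  assumes "x \<notin> S"
  shows "(\<Sum>e\<in>insert x S \<rightarrow>\<^sub>E Z. F e) = (\<Sum>z\<in>Z. \<Sum>e\<in>S \<rightarrow>\<^sub>E Z. F (e(x := z)))"
proof -
  have "inj_on (\<lambda>(y, g). g(x := y)) (Z \<times> (S \<rightarrow>\<^sub>E Z))"
    using inj_combinator[OF assms, of "\<lambda>_. Z"] by simp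
  from sum.reindex[OF this, of F] show ?thesis
    unfolding PiE_insert_eq by (simp add: sum.cartesian_product case_prod_beta comp_def)
qed

text \<open>Entries at disjoint positions are independent, so a sum of products factors when each
  factor reads its own positions only.\<close>

lemma sum_PiE_Un:
  fixes \<phi> \<psi> :: "('b \<Rightarrow> complex) \<Rightarrow> complex"
  assumes "finite C" "C \<inter> B = {}"
    and "\<And>e e'. (\<And>i. i \<in> C \<Longrightarrow> e i = e' i) \<Longrightarrow> \<phi> e = \<phi> e'"
    and "\<And>e e'. (\<And>i. i \<in> B \<Longrightarrow> e i = e' i) \<Longrightarrow> \<psi> e = \<psi> e'"
  shows "(\<Sum>e\<in>C \<union> B \<rightarrow>\<^sub>E Z. \<phi> e * \<psi> e) = (\<Sum>e\<in>C \<rightarrow>\<^sub>E Z. \<phi> e) * (\<Sum>e\<in>B \<rightarrow>\<^sub>E Z. \<psi> e)"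
  using assms(1-3)
proof (induction C arbitrary: \<phi> rule: finite_induct)
  case empty
  define c where "c = \<phi> (\<lambda>x. undefined)"
  have "\<phi> e = c" for e unfolding c_def by (rule empty.prems) simp
  then show ?case by (simp add: sum_distrib_left)
next
  case (insert x C)
  have xB: "x \<notin> B" "C \<inter> B = {}" "x \<notin> C \<union> B"
    using insert.hyps(2) insert.prems(1) by blast+
  have "(\<Sum>e\<in>insert x C \<union> B \<rightarrow>\<^sub>E Z. \<phi> e * \<psi> e) = (\<Sum>z\<in>Z. \<Sum>e\<in>C \<union> B \<rightarrow>\<^sub>E Z. \<phi> (e(x := z)) * \<psi> (e(x := z)))"
    unfolding Un_insert_left by (rule sum_PiE_insert[OF xB(3)])
  also have "\<dots> = (\<Sum>z\<in>Z. \<Sum>e\<in>C \<union> B \<rightarrow>\<^sub>E Z. \<phi> (e(x := z)) * \<psi> e)"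
  proof (rule sum.cong[OF refl], rule sum.cong[OF refl])
    fix z and e :: "'b \<Rightarrow> complex"
    have "\<psi> (e(x := z)) = \<psi> e" by (rule assms(4)) (use xB in auto)
    then show "\<phi> (e(x := z)) * \<psi> (e(x := z)) = \<phi> (e(x := z)) * \<psi> e" by simp
  qed
  also have "\<dots> = (\<Sum>z\<in>Z. (\<Sum>e\<in>C \<rightarrow>\<^sub>E Z. \<phi> (e(x := z))) * (\<Sum>e\<in>B \<rightarrow>\<^sub>E Z. \<psi> e))"
  proof (rule sum.cong[OF refl], rule insert.IH[OF xB(2)])
    fix z and e e' :: "'b \<Rightarrow> complex" assume "\<And>i. i \<in> C \<Longrightarrow> e i = e' i"
    then show "\<phi> (e(x := z)) = \<phi> (e'(x := z))" by (intro insert.prems(2)) auto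
  qed
  also have "\<dots> = (\<Sum>e\<in>insert x C \<rightarrow>\<^sub>E Z. \<phi> e) * (\<Sum>e\<in>B \<rightarrow>\<^sub>E Z. \<psi> e)"
    unfolding sum_PiE_insert[OF insert.hyps(2)] by (simp add: sum_distrib_right)
  finally show ?case .
qed

text \<open>The product of independent uniform elements of \<open>Z\<close> is uniform, each value
  arising from r^(m - 1) tuples of length m.\<close>

lemma sum_PiE_prod:
  fixes f :: "complex \<Rightarrow> complex"
  assumes "finite C" "C \<noteq> {}"
  shows "(\<Sum>e\<in>C \<rightarrow>\<^sub>E Z. f (prod e C)) = of_nat r ^ (card C - 1) * (\<Sum>z\<in>Z. f z)"
  using assms
proof (induction C arbitrary: f rule: finite_ne_induct)
  case (singleton x)
  then show ?case using sum_PiE_insert[of x "{}" "\<lambda>e. f (prod e {x})"] by simp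
next
  case (insert x C)
  have "(\<Sum>e\<in>insert x C \<rightarrow>\<^sub>E Z. f (prod e (insert x C))) =
      (\<Sum>z\<in>Z. \<Sum>e\<in>C \<rightarrow>\<^sub>E Z. f (z * prod e C))"
    unfolding sum_PiE_insert[OF insert.hyps(3)]
    by (intro sum.cong refl) (use insert.hyps in \<open>auto intro!: arg_cong[of _ _ f] prod.cong\<close>)
  also have "\<dots> = (\<Sum>z\<in>Z. of_nat r ^ (card C - 1) * (\<Sum>y\<in>Z. f (z * y)))"
    by (rule sum.cong[OF refl]) (rule insert.IH[of "\<lambda>y. f (z * y)" for z])
  also have "\<dots> = (\<Sum>z\<in>Z. of_nat r ^ (card C - 1) * (\<Sum>y\<in>Z. f y))"
  proof (rule sum.cong[OF refl])
    fix z assume z: "z \<in> Z"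
    have "(\<Sum>y\<in>Z. f (z * y)) = (\<Sum>y\<in>Z. f y)"
      by (rule sum.reindex_bij_witness[of _ "\<lambda>y. inverse z * y" "\<lambda>y. z * y"])
        (use z in \<open>auto simp: Z_mult Z_inverse Z_nz\<close>)
    then show "of_nat r ^ (card C - 1) * (\<Sum>y\<in>Z. f (z * y)) = of_nat r ^ (card C - 1) * (\<Sum>y\<in>Z. f y)" by simp
  qed
  also have "\<dots> = of_nat r ^ (card (insert x C) - 1) * (\<Sum>z\<in>Z. f z)"
  proof -
    have "card C = Suc (card C - 1)" using insert.hyps by (simp add: card_gt_0_iff)
    then have "(of_nat r :: complex) ^ card C = of_nat r * of_nat r ^ (card C - 1)" by (metis power_Suc)
    then show ?thesis using insert.hyps by (simp add: Z_facts mult.assoc)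
  qed
  finally show ?case .
qed

lemma sum_PiE_orbits:
  fixes f :: "complex \<Rightarrow> complex"
  assumes "finite P" "\<And>C. C \<in> P \<Longrightarrow> finite C \<and> C \<noteq> {}"
    "\<And>C D. C \<in> P \<Longrightarrow> D \<in> P \<Longrightarrow> C \<noteq> D \<Longrightarrow> C \<inter> D = {}"
  shows "(\<Sum>e\<in>\<Union>P \<rightarrow>\<^sub>E Z. \<Prod>C\<in>P. f (prod e C)) = (\<Prod>C\<in>P. of_nat r ^ (card C - 1) * (\<Sum>z\<in>Z. f z))"
  using assms
proof (induction P rule: finite_induct)
  case (insert C P)
  have dj: "C \<inter> \<Union>P = {}" using insert.prems(2) insert.hyps(2) by blast
  have "(\<Sum>e\<in>\<Union>(insert C P) \<rightarrow>\<^sub>E Z. \<Prod>D\<in>insert C P. f (prod e D)) =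
      (\<Sum>e\<in>C \<union> \<Union>P \<rightarrow>\<^sub>E Z. f (prod e C) * (\<Prod>D\<in>P. f (prod e D)))"
    using insert.hyps by simp
  also have "\<dots> = (\<Sum>e\<in>C \<rightarrow>\<^sub>E Z. f (prod e C)) * (\<Sum>e\<in>\<Union>P \<rightarrow>\<^sub>E Z. \<Prod>D\<in>P. f (prod e D))"
  proof (rule sum_PiE_Un[OF _ dj])
    show "finite C" using insert.prems(1) by blast
    fix e e' :: "_ \<Rightarrow> complex"
    show "f (prod e C) = f (prod e' C)" if "\<And>i. i \<in> C \<Longrightarrow> e i = e' i"
      using that by (simp cong: prod.cong)
    show "(\<Prod>D\<in>P. f (prod e D)) = (\<Prod>D\<in>P. f (prod e' D))" if "\<And>i. i \<in> \<Union>P \<Longrightarrow> e i = e' i"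
    proof (intro prod.cong refl arg_cong[of _ _ f])
      fix D i assume "D \<in> P" "i \<in> D" then show "e i = e' i" using that by blast
    qed
  qed
  also have "(\<Sum>e\<in>\<Union>P \<rightarrow>\<^sub>E Z. \<Prod>D\<in>P. f (prod e D)) = (\<Prod>D\<in>P. of_nat r ^ (card D - 1) * (\<Sum>z\<in>Z. f z))"
    using insert.prems by (intro insert.IH) blast+
  also have "(\<Sum>e\<in>C \<rightarrow>\<^sub>E Z. f (prod e C)) = of_nat r ^ (card C - 1) * (\<Sum>z\<in>Z. f z)"
    using insert.prems(1) by (intro sum_PiE_prod) auto
  finally show ?case using insert.hyps by simp
qed simp

text \<open>
  \<open>(r k + 1)\<^sup>\<ell>\<close> is a product over the cycles, so a character of the product of all entries can be
  distributed over the cycles.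
\<close>

lemma character_sum:
  fixes h :: "complex \<Rightarrow> complex"
  assumes p: "p permutes A" and one: "h 1 = 1" and mult: "\<And>x y. h (x * y) = h x * h y"
    and sum: "(\<Sum>z\<in>Z. h z) = of_nat (r * d)"
  shows "(\<Sum>e\<in>A \<rightarrow>\<^sub>E Z. h (prod e A) * of_nat (r * k + 1) ^ ell r n \<zeta> (M p e)) =
    of_nat r ^ n * of_nat (k + d) ^ cyc p A"
proof -
  let ?f = "\<lambda>z. h z * (if z = 1 then of_nat (r * k + 1) else 1)"
  have fin: "finite (orbits p A)" by (simp add: finite_orbits)
  have h_prod: "h (prod g S) = (\<Prod>i\<in>S. h (g i))" if "finite S" for g :: "nat set \<Rightarrow> complex" and S
    using that by (induction S rule: finite_induct) (simp_all add: one mult)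
  have "(\<Sum>e\<in>A \<rightarrow>\<^sub>E Z. h (prod e A) * of_nat (r * k + 1) ^ ell r n \<zeta> (M p e)) =
      (\<Sum>e\<in>A \<rightarrow>\<^sub>E Z. \<Prod>C\<in>orbits p A. ?f (prod e C))"
  proof (rule sum.cong[OF refl])
    fix e assume e: "e \<in> A \<rightarrow>\<^sub>E Z"
    have "prod e A = prod e (\<Union>(orbits p A))" by (simp add: Union_orbits[OF p])
    also have "\<dots> = (prod \<circ> prod) e (orbits p A)"
      using finite_orbit_mem[OF p] orbits_disjoint[OF p] by (intro prod.Union_disjoint) auto
    finally have "h (prod e A) = (\<Prod>C\<in>orbits p A. h (prod e C))" by (simp add: h_prod[OF fin])
    moreover have "(of_nat (r * k + 1) :: complex) ^ ell r n \<zeta> (M p e) =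
        (\<Prod>C\<in>orbits p A. if prod e C = 1 then of_nat (r * k + 1) else 1)"
      unfolding ell_M[OF p e] using fin by (simp add: prod.If_cases Int_def)
    ultimately show "h (prod e A) * of_nat (r * k + 1) ^ ell r n \<zeta> (M p e) = (\<Prod>C\<in>orbits p A. ?f (prod e C))"
      by (simp only: prod.distrib)
  qed
  also have "\<dots> = (\<Sum>e\<in>\<Union>(orbits p A) \<rightarrow>\<^sub>E Z. \<Prod>C\<in>orbits p A. ?f (prod e C))"
    by (simp add: Union_orbits[OF p])
  also have "\<dots> = (\<Prod>C\<in>orbits p A. of_nat r ^ (card C - 1) * (\<Sum>z\<in>Z. ?f z))"
    using finite_orbit_mem[OF p] orbits_disjoint[OF p] orbits_nonempty_mem[of _ p A] fin
    by (intro sum_PiE_orbits) auto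
  \<comment> \<open>On a single cycle the character sum contributes r d, and the value r k + 1 in
    place of 1 at z = 1 adds r k. So the trivial character, with d = 1, raises k by one, and the
    others, with d = 0, do not.\<close>
  also have "(\<Sum>z\<in>Z. ?f z) = of_nat r * of_nat (k + d)"
  proof -
    have "(\<Sum>z\<in>Z. ?f z) = (\<Sum>z\<in>Z. h z + (if z = 1 then of_nat (r * k) else 0))"
      by (rule sum.cong[OF refl]) (simp add: one algebra_simps)
    then show ?thesis using Z_facts by (simp add: sum.distrib sum algebra_simps)
  qed
  also have "(\<Prod>C\<in>orbits p A. (of_nat r :: complex) ^ (card C - 1) * (of_nat r * of_nat (k + d))) =
      (\<Prod>C\<in>orbits p A. of_nat r ^ card C * of_nat (k + d))"
  proof (rule prod.cong[OF refl])
    fix C assume "C \<in> orbits p A"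
    then have "0 < card C" by (intro card_orbits_pos[OF p]) auto
    then show "(of_nat r :: complex) ^ (card C - 1) * (of_nat r * of_nat (k + d)) = of_nat r ^ card C * of_nat (k + d)"
      by (cases "card C") auto
  qed
  also have "\<dots> = of_nat r ^ n * of_nat (k + d) ^ cyc p A"
    using card_eq_sum_orbits[OF p] A_facts by (simp add: prod.distrib cyc_def flip: power_sum)
  finally show ?thesis .
qed

end

section \<open>Conjugacy classes\<close>

lemma orbits_eq_singleton_iff:
  assumes "p permutes S" "finite S" "S \<noteq> {}"
  shows "orbits p S = {S} \<longleftrightarrow> S \<in> orbits p S" "cyc p S = 1 \<longleftrightarrow> orbits p S = {S}"
proof -
  have sub: "C = S" if "S \<in> orbits p S" "C \<in> orbits p S" for C
  proof (rule ccontr)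
    assume "C \<noteq> S"
    then have "C \<inter> S = {}" using orbits_disjoint[OF assms(1,2)] that by blast
    moreover have "C \<subseteq> S" "C \<noteq> {}" using that Union_orbits[OF assms(1,2)] orbits_nonempty_mem by blast+
    ultimately show False by blast
  qed
  show "orbits p S = {S} \<longleftrightarrow> S \<in> orbits p S" using sub by blast
  show "cyc p S = 1 \<longleftrightarrow> orbits p S = {S}"
  proof
    assume "cyc p S = 1"
    then obtain C where "orbits p S = {C}" unfolding cyc_def by (metis card_1_singletonE)
    then show "orbits p S = {S}" using Union_orbits[OF assms(1,2)] by simp
  qed (simp add: cyc_def)
qed

lemma full_cycles_iff:
  assumes "finite S" "S \<noteq> {}"
  shows "c \<in> full_cycles S \<longleftrightarrow> c permutes S \<and> S \<in> orbits c S"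
  unfolding full_cycles_def using orbits_eq_singleton_iff[OF _ assms, of c] by auto

text \<open>Formulated through the set of cycles, the condition can be compared with the type of a
  matrix. On two points the set of cycles is the same for both markings.\<close>

lemma near_full_cycles_iff:
  assumes A: "finite A" "2 \<le> card A"
  shows "(i, d) \<in> near_full_cycles A \<longleftrightarrow> i \<in> A \<and> d permutes A \<and> orbits d A = {{i}, A - {i}}"
proof
  assume l: "(i, d) \<in> near_full_cycles A"
  then have i: "i \<in> A" and d: "d permutes A - {i}" "cyc d (A - {i}) = 1"
    by (auto simp: near_full_cycles_def full_cycles_def)
  have ins: "insert i (A - {i}) = A" using i by blast
  have "card (A - {i}) \<noteq> 0" using A i by simp
  then have "A - {i} \<noteq> {}" by (metis card.empty)
  then have "orbits d (A - {i}) = {A - {i}}" using orbits_eq_singleton_iff(2)[OF d(1)] d(2) A(1) by simp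
  then have "orbits d A = {{i}, A - {i}}" using orbits_insert_fixed(1)[OF d(1), of i] ins by simp
  then show "i \<in> A \<and> d permutes A \<and> orbits d A = {{i}, A - {i}}"
    using i permutes_subset[OF d(1), of A] by auto
next
  assume r: "i \<in> A \<and> d permutes A \<and> orbits d A = {{i}, A - {i}}"
  then have i: "i \<in> A" and d: "d permutes A" and o: "orbits d A = {{i}, A - {i}}" by auto
  have ins: "insert i (A - {i}) = A" using i by blast
  have "card (A - {i}) \<noteq> 0" using A i by simp
  then have ne: "A - {i} \<noteq> {}" by (metis card.empty)
  have "orbit d i = {i}" by (rule orbits_mem_eq[OF d A(1)]) (use o in auto)
  then have di: "d i = i" by (simp add: orbit_eq_singleton_iff)
  have d': "d permutes A - {i}" by (rule permutes_superset[OF d]) (use di in auto)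
  have "A - {i} \<in> orbits d A" using o by simp
  then have "A - {i} = {i} \<or> A - {i} \<in> orbits d (A - {i})"
    using orbits_insert_fixed(1)[OF d', of i] ins by auto
  then have "A - {i} \<in> orbits d (A - {i})" by blast
  then show "(i, d) \<in> near_full_cycles A"
    using full_cycles_iff[OF _ ne, of d] A(1) d' i by (simp add: near_full_cycles_def)
qed

lemma image_mset_set_eq_single:
  assumes "finite N"
  shows "image_mset f (mset_set N) = {#m#} \<longleftrightarrow> (\<exists>C. N = {C} \<and> f C = m)"
proof
  assume e: "image_mset f (mset_set N) = {#m#}"
  then have "size (image_mset f (mset_set N)) = 1" by simp
  then have "card N = 1" by simp
  then obtain C where "N = {C}" by (metis card_1_singletonE)
  then show "\<exists>C. N = {C} \<and> f C = m" using e by simp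
qed auto

lemma image_mset_set_eq_pair:
  assumes "finite N"
  shows "image_mset f (mset_set N) = {#a, b#} \<longleftrightarrow> (\<exists>C D. C \<noteq> D \<and> N = {C, D} \<and> f C = a \<and> f D = b)"
proof
  assume e: "image_mset f (mset_set N) = {#a, b#}"
  then have "size (image_mset f (mset_set N)) = 2" by simp
  then have "card N = 2" by simp
  then obtain C D where "N = {C, D}" "C \<noteq> D" by (meson card_2_iff)
  moreover from this e have "{#f C, f D#} = {#a, b#}" by simp
  then have "f C = a \<and> f D = b \<or> f C = b \<and> f D = a" by (auto simp: add_eq_conv_ex)
  ultimately show "\<exists>C D. C \<noteq> D \<and> N = {C, D} \<and> f C = a \<and> f D = b" by (metis insert_commute)
qed auto

context monomial_group begin

abbreviation cycles_with :: "(nat \<Rightarrow> nat) \<Rightarrow> (nat \<Rightarrow> complex) \<Rightarrow> nat \<Rightarrow> nat set set" where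
  "cycles_with p e j \<equiv> {C \<in> orbits p A. prod e C = \<zeta> ^ j}"

lemma finite_cycles_with: "finite (cycles_with p e j)"
  by (rule finite_subset[OF _ finite_orbits[of A p]]) auto

lemma zeta_power_eq_iff: "i < r \<Longrightarrow> j < r \<Longrightarrow> \<zeta> ^ i = \<zeta> ^ j \<longleftrightarrow> i = j"
  using zeta_inj by (auto simp: inj_on_def)

lemma Kpad_iff:
  assumes "p permutes A" "e \<in> A \<rightarrow>\<^sub>E Z" "length lam \<le> r"
  shows "M p e \<in> Kpad r n \<zeta> lam \<longleftrightarrow>
    (\<forall>j<r. image_mset card (mset_set (cycles_with p e j)) = (if j < length lam then lam ! j else {#}))"
proof -
  have "M p e \<in> Gn n \<zeta>" using assms by (intro M_in_Gn) auto
  then show ?thesis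
    unfolding Kpad_def conj_class_def using assms(3)
    by (auto simp: type_of_M[OF assms(1,2)] list_eq_iff_nth_eq nth_append)
qed

section \<open>The conjugacy classes of the five sequences\<close>

definition K_full :: "complex \<Rightarrow> complex mat set" where
  "K_full z = (\<lambda>(c, e). M c e) ` (full_cycles A \<times> {e \<in> A \<rightarrow>\<^sub>E Z. prod e A = z})"

lemma full_orbit:
  assumes "p permutes A" "C \<in> orbits p A" "card C = n"
  shows "C = A" "p \<in> full_cycles A"
proof -
  have "C \<subseteq> A" using Union_orbits[OF assms(1)] assms(2) by auto
  then show "C = A" using assms(3) by (simp add: card_subset_eq)
  then show "p \<in> full_cycles A" using full_cycles_iff[OF A_facts(1,2)] assms by simp
qed

lemma full_cycles_orbits:
  assumes "p \<in> full_cycles A" shows "p permutes A" "orbits p A = {A}"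
  using assms orbits_eq_singleton_iff(2)[OF _ A_facts(1,2), of p] by (auto simp: full_cycles_def)

lemma Kpad_eqI:
  assumes "length lam \<le> r"
    and "\<And>p e. p permutes A \<Longrightarrow> e \<in> A \<rightarrow>\<^sub>E Z \<Longrightarrow>
      (\<forall>j<r. image_mset card (mset_set (cycles_with p e j)) = (if j < length lam then lam ! j else {#})) \<longleftrightarrow> (p, e) \<in> S"
    and "S \<subseteq> pairs"
  shows "Kpad r n \<zeta> lam = (\<lambda>(p, e). M p e) ` S"
proof (intro equalityI subsetI)
  fix x assume x: "x \<in> Kpad r n \<zeta> lam"
  then have "x \<in> Gn n \<zeta>" by (simp add: Kpad_def conj_class_def)
  then obtain p e where pe: "p permutes A" "e \<in> A \<rightarrow>\<^sub>E Z" "x = M p e" by (rule Gn_cases)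
  then have "(p, e) \<in> S" using x Kpad_iff[OF pe(1,2) assms(1)] assms(2)[OF pe(1,2)] by simp
  then show "x \<in> (\<lambda>(p, e). M p e) ` S" using pe(3) by force
next
  fix x assume "x \<in> (\<lambda>(p, e). M p e) ` S"
  then obtain p e where pe: "(p, e) \<in> S" "x = M p e" by auto
  then have "p permutes A" "e \<in> A \<rightarrow>\<^sub>E Z" using assms(3) by (auto simp: pairs_def)
  then show "x \<in> Kpad r n \<zeta> lam" using pe Kpad_iff[OF _ _ assms(1)] assms(2) by simp
qed

text \<open>A part of size n exhausts all points, so the cycle that carries it is the only one. The
  instances t = 0 and t = 1 are the full cycles with product 1 and with product
  \<open>\<zeta>\<close>.\<close>

lemma Kpad_full:
  assumes t: "t < r" and lam: "length lam = Suc t" "\<And>j. j \<le> t \<Longrightarrow> lam ! j = (if j = t then {#n#} else {#})"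
  shows "Kpad r n \<zeta> lam = K_full (\<zeta> ^ t)"
  unfolding K_full_def
proof (rule Kpad_eqI)
  show "length lam \<le> r" using t lam by simp
  show "full_cycles A \<times> {e \<in> A \<rightarrow>\<^sub>E Z. prod e A = \<zeta> ^ t} \<subseteq> pairs"
    by (auto simp: pairs_def full_cycles_def)
  fix p e assume p: "p permutes A" and e: "e \<in> A \<rightarrow>\<^sub>E Z"
  have lj: "(if j < length lam then lam ! j else {#}) = (if j = t then {#n#} else {#})" for j
    using lam by (cases "j \<le> t") auto
  show "(\<forall>j<r. image_mset card (mset_set (cycles_with p e j)) = (if j < length lam then lam ! j else {#})) \<longleftrightarrow>
    (p, e) \<in> full_cycles A \<times> {e \<in> A \<rightarrow>\<^sub>E Z. prod e A = \<zeta> ^ t}"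
    unfolding lj
  proof
    assume "\<forall>j<r. image_mset card (mset_set (cycles_with p e j)) = (if j = t then {#n#} else {#})"
    then have "image_mset card (mset_set (cycles_with p e t)) = {#n#}" using t by simp
    then obtain C where C: "cycles_with p e t = {C}" "card C = n"
      unfolding image_mset_set_eq_single[OF finite_cycles_with] by blast
    then have "C \<in> cycles_with p e t" by simp
    then have "C \<in> orbits p A" "prod e C = \<zeta> ^ t" by auto
    then show "(p, e) \<in> full_cycles A \<times> {e \<in> A \<rightarrow>\<^sub>E Z. prod e A = \<zeta> ^ t}"
      using full_orbit[OF p _ C(2)] e by simp
  next
    assume "(p, e) \<in> full_cycles A \<times> {e \<in> A \<rightarrow>\<^sub>E Z. prod e A = \<zeta> ^ t}"
    then have o: "orbits p A = {A}" and pr: "prod e A = \<zeta> ^ t" using full_cycles_orbits by auto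
    have "cycles_with p e j = (if j = t then {A} else {})" if "j < r" for j
      using zeta_power_eq_iff[OF t that] by (auto simp: o pr)
    then show "\<forall>j<r. image_mset card (mset_set (cycles_with p e j)) = (if j = t then {#n#} else {#})"
      by (auto simp: A_facts)
  qed
qed

lemma Kpad_full_cases: "Kpad r n \<zeta> [{#n#}] = K_full 1" "Kpad r n \<zeta> [{#}, {#n#}] = K_full \<zeta>"
proof -
  show "Kpad r n \<zeta> [{#n#}] = K_full 1" using Kpad_full[of 0 "[{#n#}]"] r2 by simp
  have "[{#}, {#n#}] ! j = (if j = 1 then {#n#} else {#})" if "j \<le> 1" for j
    using that by (cases j) auto
  then show "Kpad r n \<zeta> [{#}, {#n#}] = K_full \<zeta>" using Kpad_full[of 1 "[{#}, {#n#}]"] r2 by simp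
qed

lemma near_orbits:
  assumes n2: "2 \<le> n" and x: "(i, d) \<in> near_full_cycles A"
  shows "i \<in> A" "d permutes A" "orbits d A = {{i}, A - {i}}" "{i} \<noteq> A - {i}" "card (A - {i}) = n - 1"
  using near_full_cycles_iff[of A i d] x n2 A_facts by auto

text \<open>Cycles of lengths n - 1 and 1 leave no room for a third. Their distinctness is a
  hypothesis because the two lengths agree when n = 2.\<close>

lemma near_orbitsI:
  assumes n2: "2 \<le> n" and d: "d permutes A" and C: "C \<in> orbits d A" "card C = n - 1"
    and D: "D \<in> orbits d A" "card D = 1" "C \<noteq> D"
  obtains i where "(i, d) \<in> near_full_cycles A" "D = {i}" "C = A - {i}"
proof -
  obtain i where i: "D = {i}" using D(2) by (metis card_1_singletonE)
  have iA: "i \<in> A" and CA: "C \<subseteq> A" using Union_orbits[OF d] C D i by auto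
  have "C \<inter> D = {}" using orbits_disjoint[OF d _ C(1) D(1) D(3)] by simp
  then have "C \<subseteq> A - {i}" using CA i by auto
  moreover have "card (A - {i}) = n - 1" using iA by simp
  ultimately have CC: "C = A - {i}" using C(2) by (intro card_subset_eq) auto
  have "orbits d A = {{i}, A - {i}}"
  proof (intro equalityI subsetI)
    fix E assume E: "E \<in> orbits d A"
    show "E \<in> {{i}, A - {i}}"
    proof (rule ccontr)
      assume "E \<notin> {{i}, A - {i}}"
      then have "E \<inter> C = {}" "E \<inter> D = {}"
        using orbits_disjoint[OF d _ E C(1)] orbits_disjoint[OF d _ E D(1)] i CC by auto
      moreover have "E \<subseteq> A" "E \<noteq> {}" using E Union_orbits[OF d] orbits_nonempty_mem[OF E] by auto
      ultimately show False using i CC by blast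
    qed
  qed (use C D i CC in auto)
  then have "(i, d) \<in> near_full_cycles A" using near_full_cycles_iff[of A i d] iA d n2 by simp
  then show thesis using i CC by (rule that)
qed

text \<open>The marked point can be recovered from the pair, for n = 2 because its entry is
  \<open>\<zeta>\<close> and the other one is 1. In \<open>near_one_pairs\<close> it is ambiguous
  when n = 2.\<close>

definition near_zeta_pairs :: "((nat \<Rightarrow> nat) \<times> (nat \<Rightarrow> complex)) set" where
  "near_zeta_pairs = {(d, e). \<exists>i. (i, d) \<in> near_full_cycles A \<and> e \<in> A \<rightarrow>\<^sub>E Z \<and> e i = \<zeta> \<and> prod e (A - {i}) = 1}"

definition near_one_pairs :: "((nat \<Rightarrow> nat) \<times> (nat \<Rightarrow> complex)) set" where
  "near_one_pairs = {(d, e). \<exists>i. (i, d) \<in> near_full_cycles A \<and> e \<in> A \<rightarrow>\<^sub>E Z \<and> e i = 1 \<and> prod e (A - {i}) = 1}"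

lemma near_pairs: "near_zeta_pairs \<subseteq> pairs" "near_one_pairs \<subseteq> pairs"
  using near_full_cycle_permutes[of _ A] by (force simp: near_zeta_pairs_def near_one_pairs_def pairs_def)+

lemma Kpad_near_zeta:
  assumes n2: "2 \<le> n"
  shows "Kpad r n \<zeta> [{#n - 1#}, {#1#}] = (\<lambda>(p, e). M p e) ` near_zeta_pairs"
proof (rule Kpad_eqI[OF _ _ near_pairs(1)])
  show "length [{#n - 1#}, {#1#}] \<le> r" using r2 by simp
  fix p e assume p: "p permutes A" and e: "e \<in> A \<rightarrow>\<^sub>E Z"
  have lj: "(if j < length [{#n - 1#}, {#1 :: nat#}] then [{#n - 1#}, {#1#}] ! j else {#}) =
      (if j = 0 then {#n - 1#} else if j = 1 then {#1#} else {#})" for j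
    by (cases j; cases "j - 1") auto
  show "(\<forall>j<r. image_mset card (mset_set (cycles_with p e j)) =
      (if j < length [{#n - 1#}, {#1#}] then [{#n - 1#}, {#1#}] ! j else {#})) \<longleftrightarrow> (p, e) \<in> near_zeta_pairs"
    unfolding lj
  proof
    assume l: "\<forall>j<r. image_mset card (mset_set (cycles_with p e j)) =
      (if j = 0 then {#n - 1#} else if j = 1 then {#1#} else {#})"
    have "image_mset card (mset_set (cycles_with p e 0)) = {#n - 1#}"
      using l[rule_format, of 0] r2 by simp
    then obtain C where C: "cycles_with p e 0 = {C}" "card C = n - 1"
      unfolding image_mset_set_eq_single[OF finite_cycles_with] by blast
    have "image_mset card (mset_set (cycles_with p e 1)) = {#1#}"
      using l[rule_format, of 1] r2 by simp
    then obtain D where D: "cycles_with p e 1 = {D}" "card D = 1"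
      unfolding image_mset_set_eq_single[OF finite_cycles_with] by blast
    have "C \<in> cycles_with p e 0" "D \<in> cycles_with p e 1" using C D by simp_all
    then have CD: "C \<in> orbits p A" "prod e C = 1" "D \<in> orbits p A" "prod e D = \<zeta>" by auto
    \<comment> \<open>The products 1 and \<open>\<zeta>\<close> tell the two cycles apart even when
      both have length 1.\<close>
    then have "C \<noteq> D" using Z_facts(5) by auto
    then obtain i where "(i, p) \<in> near_full_cycles A" "D = {i}" "C = A - {i}"
      using near_orbitsI[OF n2 p CD(1) C(2) CD(3) D(2)] by blast
    then show "(p, e) \<in> near_zeta_pairs" using CD e by (auto simp: near_zeta_pairs_def)
  next
    assume "(p, e) \<in> near_zeta_pairs"
    then obtain i where i: "(i, p) \<in> near_full_cycles A" "e i = \<zeta>" "prod e (A - {i}) = 1"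
      by (auto simp: near_zeta_pairs_def)
    note no = near_orbits[OF n2 i(1)]
    have "cycles_with p e j = (if j = 0 then {A - {i}} else if j = 1 then {{i}} else {})" if "j < r" for j
    proof -
      have "1 = \<zeta> ^ j \<longleftrightarrow> j = 0" "\<zeta> = \<zeta> ^ j \<longleftrightarrow> j = 1"
        using zeta_power_eq_iff[of 0 j] zeta_power_eq_iff[of 1 j] that r2 by auto
      then show ?thesis unfolding no(3) using i(2,3) no(4) by auto
    qed
    then show "\<forall>j<r. image_mset card (mset_set (cycles_with p e j)) =
      (if j = 0 then {#n - 1#} else if j = 1 then {#1#} else {#})"
      using no(5) by simp
  qed
qed

lemma Kpad_near_one:
  assumes n2: "2 \<le> n"
  shows "Kpad r n \<zeta> [{#n - 1, 1#}] = (\<lambda>(p, e). M p e) ` near_one_pairs"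
proof (rule Kpad_eqI[OF _ _ near_pairs(2)])
  show "length [{#n - 1, 1#}] \<le> r" using r2 by simp
  fix p e assume p: "p permutes A" and e: "e \<in> A \<rightarrow>\<^sub>E Z"
  have lj: "(if j < length [{#n - 1, 1#}] then [{#n - 1, 1#}] ! j else {#}) =
      (if j = 0 then {#n - 1, 1#} else {#})" for j
    by (cases j) auto
  show "(\<forall>j<r. image_mset card (mset_set (cycles_with p e j)) =
      (if j < length [{#n - 1, 1#}] then [{#n - 1, 1#}] ! j else {#})) \<longleftrightarrow> (p, e) \<in> near_one_pairs"
    unfolding lj
  proof
    assume l: "\<forall>j<r. image_mset card (mset_set (cycles_with p e j)) = (if j = 0 then {#n - 1, 1#} else {#})"
    have "image_mset card (mset_set (cycles_with p e 0)) = {#n - 1, 1#}"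
      using l[rule_format, of 0] r2 by simp
    then obtain C D where C: "C \<noteq> D" "cycles_with p e 0 = {C, D}" "card C = n - 1" "card D = 1"
      unfolding image_mset_set_eq_pair[OF finite_cycles_with] by blast
    have "C \<in> cycles_with p e 0" "D \<in> cycles_with p e 0" using C by simp_all
    then have CD: "C \<in> orbits p A" "prod e C = 1" "D \<in> orbits p A" "prod e D = 1" by auto
    then obtain i where "(i, p) \<in> near_full_cycles A" "D = {i}" "C = A - {i}"
      using near_orbitsI[OF n2 p CD(1) C(3) CD(3) C(4) C(1)] by blast
    then show "(p, e) \<in> near_one_pairs" using CD e by (auto simp: near_one_pairs_def)
  next
    assume "(p, e) \<in> near_one_pairs"
    then obtain i where i: "(i, p) \<in> near_full_cycles A" "e i = 1" "prod e (A - {i}) = 1"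
      by (auto simp: near_one_pairs_def)
    note no = near_orbits[OF n2 i(1)]
    have "cycles_with p e j = (if j = 0 then {A - {i}, {i}} else {})" if "j < r" for j
    proof -
      have "1 = \<zeta> ^ j \<longleftrightarrow> j = 0" using zeta_power_eq_iff[of 0 j] that r2 by auto
      then show ?thesis unfolding no(3) using i(2,3) by auto
    qed
    then show "\<forall>j<r. image_mset card (mset_set (cycles_with p e j)) = (if j = 0 then {#n - 1, 1#} else {#})"
      using no(4,5) by auto
  qed
qed

section \<open>Counting tuples of entries by their products\<close>

lemma card_entries_prod:
  assumes "finite C" "C \<noteq> {}" "z \<in> Z"
  shows "card {e \<in> C \<rightarrow>\<^sub>E Z. prod e C = z} = r ^ (card C - 1)"
proof -
  have "(of_nat (card {e \<in> C \<rightarrow>\<^sub>E Z. prod e C = z}) :: complex) = (\<Sum>e\<in>C \<rightarrow>\<^sub>E Z. if prod e C = z then 1 else 0)"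
    using finite_entries[OF assms(1)] by (simp add: sum.If_cases Int_def)
  also have "\<dots> = of_nat r ^ (card C - 1) * (\<Sum>y\<in>Z. if y = z then 1 else 0)"
    by (rule sum_PiE_prod[OF assms(1,2)])
  also have "\<dots> = of_nat (r ^ (card C - 1))" using assms(3) Z_facts by simp
  finally show ?thesis by (simp only: of_nat_eq_iff)
qed

lemma card_entries_split:
  assumes n2: "2 \<le> n" and i: "i \<in> A" and y: "y \<in> Z"
  shows "card {e \<in> A \<rightarrow>\<^sub>E Z. e i = y \<and> prod e (A - {i}) = 1} = r ^ (n - 2)"
proof -
  define B where "B = A - {i}"
  have A: "A = insert i B" "i \<notin> B" "finite B" using i by (auto simp: B_def)
  have cB: "card B = n - 1" using i by (simp add: B_def)
  then have B: "B \<noteq> {}" using n2 by auto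
  have "card {e \<in> A \<rightarrow>\<^sub>E Z. e i = y \<and> prod e B = 1} = card {e \<in> B \<rightarrow>\<^sub>E Z. prod e B = 1}"
  proof (rule bij_betw_same_card, rule bij_betw_byWitness[where f' = "\<lambda>e. e(i := y)"])
    let ?f = "\<lambda>e. restrict e B :: nat \<Rightarrow> complex"
    show "\<forall>e\<in>{e \<in> A \<rightarrow>\<^sub>E Z. e i = y \<and> prod e B = 1}. (?f e)(i := y) = e"
    proof
      fix e assume "e \<in> {e \<in> A \<rightarrow>\<^sub>E Z. e i = y \<and> prod e B = 1}"
      then show "(?f e)(i := y) = e" by (auto simp: fun_eq_iff A(1) PiE_def extensional_def)
    qed
    show "\<forall>e\<in>{e \<in> B \<rightarrow>\<^sub>E Z. prod e B = 1}. ?f (e(i := y)) = e"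
      using A(2) by (auto simp: fun_eq_iff PiE_def extensional_def restrict_def)
    show "?f ` {e \<in> A \<rightarrow>\<^sub>E Z. e i = y \<and> prod e B = 1} \<subseteq> {e \<in> B \<rightarrow>\<^sub>E Z. prod e B = 1}"
      by (auto simp: A(1))
    show "(\<lambda>e. e(i := y)) ` {e \<in> B \<rightarrow>\<^sub>E Z. prod e B = 1} \<subseteq> {e \<in> A \<rightarrow>\<^sub>E Z. e i = y \<and> prod e B = 1}"
    proof clarify
      fix e assume e: "e \<in> B \<rightarrow>\<^sub>E Z" "prod e B = 1"
      have "prod (e(i := y)) B = prod e B" by (rule prod.cong) (use A(2) in auto)
      moreover have "e(i := y) \<in> A \<rightarrow>\<^sub>E Z" unfolding A(1) using e(1) y by (auto simp: PiE_def extensional_def)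
      ultimately show "e(i := y) \<in> A \<rightarrow>\<^sub>E Z \<and> (e(i := y)) i = y \<and> prod (e(i := y)) B = 1" using e by simp
    qed
  qed
  also have "\<dots> = r ^ (n - 2)" using card_entries_prod[OF A(3) B Z_facts(3)] cB by (simp add: numeral_2_eq_2)
  finally show ?thesis by (simp only: B_def)
qed

end

section \<open>The Gram matrix\<close>

text \<open>The expectation under \<open>indep_uniform\<close>, unfolded into nested finite means
  that can be evaluated one class at a time.\<close>

primrec averages :: "'a set list \<Rightarrow> ('a list \<Rightarrow> real) \<Rightarrow> real" where
  "averages [] F = F []"
| "averages (K # Ks) F = (\<Sum>k\<in>K. averages Ks (\<lambda>ks. F (k # ks))) / real (card K)"

text \<open>Finiteness of the support is proved along with the formula because the expectation of a
  bind uses it at every step of the induction.\<close>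

lemma expectation_indep_uniform:
  assumes "\<And>K. K \<in> set Ks \<Longrightarrow> finite K \<and> K \<noteq> {}"
  shows "measure_pmf.expectation (indep_uniform Ks) F = averages Ks F"
    and "finite (set_pmf (indep_uniform Ks))"
proof -
  have "measure_pmf.expectation (indep_uniform Ks) F = averages Ks F \<and> finite (set_pmf (indep_uniform Ks))"
    using assms
  proof (induction Ks arbitrary: F)
    case (Cons K Ks)
    then have K: "finite K" "K \<noteq> {}" by auto
    have IH: "measure_pmf.expectation (indep_uniform Ks) F = averages Ks F" "finite (set_pmf (indep_uniform Ks))" for F
      using Cons.IH Cons.prems by auto
    have e: "indep_uniform (K # Ks) = pmf_of_set K \<bind> (\<lambda>k. map_pmf (\<lambda>ks. k # ks) (indep_uniform Ks))"
      by (simp add: pair_pmf_def map_bind_pmf map_pmf_def bind_assoc_pmf bind_return_pmf)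
    have "measure_pmf.expectation (indep_uniform (K # Ks)) F =
        (\<Sum>k\<in>K. measure_pmf.expectation (map_pmf (\<lambda>ks. k # ks) (indep_uniform Ks)) F /\<^sub>R real (card K))"
      unfolding e by (rule pmf_expectation_bind_pmf_of_set) (use K IH(2) in auto)
    also have "\<dots> = averages (K # Ks) F"
      using IH(1) by (simp add: sum_distrib_left divide_inverse_commute)
    finally have "measure_pmf.expectation (indep_uniform (K # Ks)) F = averages (K # Ks) F" .
    moreover have "finite (set_pmf (indep_uniform (K # Ks)))"
      unfolding e using K IH(2) by simp
    ultimately show ?case by blast
  qed simp
  then show "measure_pmf.expectation (indep_uniform Ks) F = averages Ks F"
    "finite (set_pmf (indep_uniform Ks))" by auto
qed

lemma averages_cong:
  "(\<And>ks. list_all2 (\<in>) ks Ks \<Longrightarrow> F ks = G ks) \<Longrightarrow> averages Ks F = averages Ks G"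
proof (induction Ks arbitrary: F G)
  case (Cons K Ks)
  have "averages Ks (\<lambda>ks. F (k # ks)) = averages Ks (\<lambda>ks. G (k # ks))" if "k \<in> K" for k
    by (rule Cons.IH) (rule Cons.prems, simp add: that)
  then show ?case by simp
qed simp

lemma averages_sum: "averages Ks (\<lambda>ks. \<Sum>i\<in>I. F i ks) = (\<Sum>i\<in>I. averages Ks (F i))"
proof (induction Ks arbitrary: F)
  case (Cons K Ks)
  then show ?case by (simp add: sum_divide_distrib) (rule sum.swap)
qed simp

lemma averages_cmult: "averages Ks (\<lambda>ks. c * F ks) = c * averages Ks F"
proof (induction Ks arbitrary: F)
  case (Cons K Ks)
  have "averages Ks (\<lambda>ks. c * F (k # ks)) = c * averages Ks (\<lambda>ks. F (k # ks))" for k by (rule Cons.IH)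
  then show ?case by (simp add: sum_distrib_left)
qed simp

lemma averages_add: "averages Ks (\<lambda>ks. F ks + G ks) = averages Ks F + averages Ks G"
proof (induction Ks arbitrary: F G)
  case (Cons K Ks)
  have "averages Ks (\<lambda>ks. F (k # ks) + G (k # ks)) =
    averages Ks (\<lambda>ks. F (k # ks)) + averages Ks (\<lambda>ks. G (k # ks))" for k by (rule Cons.IH)
  then show ?case by (simp add: sum.distrib add_divide_distrib)
qed simp

context monomial_group begin

text \<open>On the group, \<open>prm\<close> is a homomorphism to the symmetric group, and
  \<open>prd\<close> below is one to \<open>Z\<close>. Once the first class is averaged, the
  remaining factors enter only through these two values.\<close>

definition prm :: "complex mat \<Rightarrow> nat \<Rightarrow> nat" where "prm = perm_of n"

definition prd :: "complex mat \<Rightarrow> complex" where "prd x = (\<Prod>j<n. x $$ (prm x j, j))"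

lemma prm_M:
  assumes "p permutes A" "\<And>j. j < n \<Longrightarrow> e j \<in> Z"
  shows "prm (M p e) = p" "prd (M p e) = prod e A"
proof -
  show p: "prm (M p e) = p" unfolding prm_def using assms Z_nz by (intro perm_of_mono_mat) auto
  show "prd (M p e) = prod e A" unfolding prd_def p
    using permutes_less[OF assms(1)] by (intro prod.cong) (auto simp: mono_mat_index)
qed

lemma Gn_mult:
  assumes "x \<in> Gn n \<zeta>" "y \<in> Gn n \<zeta>"
  shows "x * y \<in> Gn n \<zeta>" "prm (x * y) = prm x \<circ> prm y" "prd (x * y) = prd x * prd y"
proof -
  obtain p e where x: "p permutes A" "e \<in> A \<rightarrow>\<^sub>E Z" "x = M p e" by (rule Gn_cases[OF assms(1)])
  obtain q f where y: "q permutes A" "f \<in> A \<rightarrow>\<^sub>E Z" "y = M q f" by (rule Gn_cases[OF assms(2)])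
  have ef: "e j \<in> Z" "f j \<in> Z" if "j < n" for j using x(2) y(2) that by auto
  have xy: "x * y = M (p \<circ> q) (\<lambda>j. e (q j) * f j)" unfolding x(3) y(3) by (rule mono_mat_mult[OF y(1)])
  have pq: "(p \<circ> q) permutes A" by (rule permutes_compose[OF y(1) x(1)])
  have en: "e (q j) * f j \<in> Z" if "j < n" for j
    using that ef permutes_less[OF y(1)] by (intro Z_mult) auto
  show "x * y \<in> Gn n \<zeta>" unfolding xy using pq en by (rule M_in_Gn)
  have px: "prm x = p" "prd x = prod e A" "prm y = q" "prd y = prod f A"
    unfolding x(3) y(3) using x(1) y(1) ef by (simp_all add: prm_M)
  show "prm (x * y) = prm x \<circ> prm y"
    unfolding xy px using pq en by (simp add: prm_M)
  have "(\<Prod>j<n. e (q j)) = prod e A" by (rule prod.permute[OF y(1), symmetric, unfolded comp_def])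
  then show "prd (x * y) = prd x * prd y"
    unfolding xy px using pq en by (simp add: prm_M prod.distrib)
qed

lemma one_Gn: "1\<^sub>m n \<in> Gn n \<zeta>" "prm (1\<^sub>m n) = id" "prd (1\<^sub>m n) = 1"
proof -
  have o: "1\<^sub>m n = M id (\<lambda>_. 1)" by (rule eq_matI) (auto simp: mono_mat_def)
  show "1\<^sub>m n \<in> Gn n \<zeta>" "prm (1\<^sub>m n) = id" "prd (1\<^sub>m n) = 1"
    unfolding o using Z_facts(3) permutes_id[of A] by (simp_all add: M_in_Gn prm_M)
qed

lemma Gn_carrier: "x \<in> Gn n \<zeta> \<Longrightarrow> x \<in> carrier_mat n n"
  by (simp add: Gn_def)

lemma prd_in_Z: "x \<in> Gn n \<zeta> \<Longrightarrow> prd x \<in> Z"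
proof (elim Gn_cases)
  fix p e assume p: "p permutes A" "e \<in> A \<rightarrow>\<^sub>E Z" "x = M p e"
  then have "prd x = prod e A" by (auto intro: prm_M(2))
  then show "prd x \<in> Z" using p(2) by (auto intro: Z_prod)
qed

lemma Gn_left_inj:
  assumes "g \<in> Gn n \<zeta>"
  shows "inj_on (\<lambda>x. g * x) (Gn n \<zeta>)"
proof -
  obtain p e where g: "p permutes A" "e \<in> A \<rightarrow>\<^sub>E Z" "g = M p e" by (rule Gn_cases[OF assms])
  let ?h = "M (pinv p) (\<lambda>j. inverse (e (pinv p j)))"
  have "?h * g = M (pinv p \<circ> p) (\<lambda>j. inverse (e (pinv p (p j))) * e j)"
    unfolding g(3) by (rule mono_mat_mult[OF g(1)])
  also have "\<dots> = M id (\<lambda>_. 1)"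
    unfolding permutes_inv_o[OF g(1)] using pairs_entry(2)[OF g(2)]
    by (intro mono_mat_cong) (simp add: permutes_inverses[OF g(1)])
  also have "\<dots> = 1\<^sub>m n" by (rule eq_matI) (auto simp: mono_mat_def)
  finally have hg: "?h * g = 1\<^sub>m n" .
  have "?h * (g * x) = x" if "x \<in> Gn n \<zeta>" for x
  proof -
    have "?h * (g * x) = (?h * g) * x"
      by (rule assoc_mult_mat[symmetric]) (use Gn_carrier[OF assms] Gn_carrier[OF that] mono_mat_carrier in auto)
    then show ?thesis unfolding hg using Gn_carrier[OF that] by simp
  qed
  then show ?thesis by (rule inj_on_inverseI)
qed

section \<open>Averaging over the first class\<close>

lemma sum_K_image:
  assumes "S \<subseteq> pairs"
  shows "(\<Sum>k\<in>(\<lambda>(p, e). M p e) ` S. F k) = (\<Sum>(p, e)\<in>S. F (M p e))"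
    and "card ((\<lambda>(p, e). M p e) ` S) = card S" "(\<lambda>(p, e). M p e) ` S \<subseteq> Gn n \<zeta>"
proof -
  have i: "inj_on (\<lambda>(p, e). M p e) S"
    using bij_betw_imp_inj_on[OF Gn_bij] assms by (rule inj_on_subset)
  show "(\<Sum>k\<in>(\<lambda>(p, e). M p e) ` S. F k) = (\<Sum>(p, e)\<in>S. F (M p e))"
    by (subst sum.reindex[OF i]) (simp add: case_prod_beta comp_def)
  show "card ((\<lambda>(p, e). M p e) ` S) = card S" by (rule card_image[OF i])
  show "(\<lambda>(p, e). M p e) ` S \<subseteq> Gn n \<zeta>"
    using bij_betw_imp_surj_on[OF Gn_bij] assms by blast
qed

lemma K_full_pairs: "full_cycles A \<times> {e \<in> A \<rightarrow>\<^sub>E Z. prod e A = z} \<subseteq> pairs"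
  by (auto simp: pairs_def full_cycles_def)

lemma sum_K_full:
  "(\<Sum>k\<in>K_full z. F k) = (\<Sum>c\<in>full_cycles A. \<Sum>e | e \<in> A \<rightarrow>\<^sub>E Z \<and> prod e A = z. F (M c e))"
  unfolding K_full_def sum_K_image(1)[OF K_full_pairs] by (subst sum.cartesian_product) simp

text \<open>The shift \<open>d\<close> of \<open>character_sum\<close> for the character given by
  the s-th power.\<close>

definition delta :: "nat \<Rightarrow> nat" where "delta s = (if s = 0 then 1 else 0)"

text \<open>For a fixed full cycle \<open>c\<close>, the left factors with entry product 1 carry
  \<open>y\<close> exactly once to each matrix with permutation \<open>c \<circ> prm y\<close> and
  the entry product of \<open>y\<close>. Expanding this constraint in the characters of
  \<open>Z\<close> makes \<open>character_sum\<close> applicable, and \<open>y\<close> enters only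
  through \<open>prm\<close> and \<open>prd\<close>.\<close>

lemma first_average:
  assumes "y \<in> Gn n \<zeta>"
  shows "(\<Sum>k\<in>K_full 1. of_nat (r * l + 1) ^ ell r n \<zeta> (k * y) :: complex) =
    of_nat r ^ (n - 1) * (\<Sum>s<r. inverse (prd y) ^ s * (\<Sum>c\<in>full_cycles A. of_nat (l + delta s) ^ cyc (c \<circ> prm y) A))"
proof -
  obtain q f where y: "q permutes A" "f \<in> A \<rightarrow>\<^sub>E Z" "y = M q f" by (rule Gn_cases[OF assms])
  have f: "f j \<in> Z" if "j < n" for j using y(2) that by auto
  define w where "w = prod f A"
  have w: "w \<in> Z" unfolding w_def using f by (intro Z_prod) auto
  have py: "prm y = q" "prd y = w" using f y by (simp_all add: prm_M w_def)
  let ?L = "\<lambda>p e. of_nat (r * l + 1) ^ ell r n \<zeta> (M p e) :: complex"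
  have inner: "(\<Sum>e | e \<in> A \<rightarrow>\<^sub>E Z \<and> prod e A = 1. of_nat (r * l + 1) ^ ell r n \<zeta> (M c e * y)) =
      of_nat r ^ (n - 1) * (\<Sum>s<r. inverse w ^ s * of_nat (l + delta s) ^ cyc (c \<circ> q) A)"
    if c: "c \<in> full_cycles A" for c
  proof -
    have cp: "c permutes A" using c by (simp add: full_cycles_def)
    have cq: "(c \<circ> q) permutes A" by (rule permutes_compose[OF y(1) cp])
    have qi: "pinv q permutes A" by (rule permutes_inv[OF y(1)])
    have "(\<Sum>e | e \<in> A \<rightarrow>\<^sub>E Z \<and> prod e A = 1. of_nat (r * l + 1) ^ ell r n \<zeta> (M c e * y)) =
        (\<Sum>e | e \<in> A \<rightarrow>\<^sub>E Z \<and> prod e A = w. ?L (c \<circ> q) e)"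
    \<comment> \<open>Column j of the product matrix has the entry \<open>e (q j) * f j\<close>; the
      inverse map removes \<open>f\<close> and then the permutation \<open>q\<close>.\<close>
    proof (rule sum.reindex_bij_witness[of _
          "\<lambda>e. restrict (\<lambda>j. e (pinv q j) * inverse (f (pinv q j))) A" "\<lambda>e. restrict (\<lambda>j. e (q j) * f j) A"])
      fix e assume "e \<in> {e. e \<in> A \<rightarrow>\<^sub>E Z \<and> prod e A = 1}"
      then have e: "e \<in> A \<rightarrow>\<^sub>E Z" "prod e A = 1" by auto
      let ?e' = "restrict (\<lambda>j. e (q j) * f j) A"
      show "restrict (\<lambda>j. ?e' (pinv q j) * inverse (f (pinv q j))) A = e"
      proof (rule PiE_ext[of _ A "\<lambda>_. UNIV"])
        fix j assume j: "j \<in> A"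
        then have "pinv q j < n" using permutes_less[OF qi] by simp
        then show "restrict (\<lambda>j. ?e' (pinv q j) * inverse (f (pinv q j))) A j = e j"
          using j f[of "pinv q j"] Z_nz by (simp add: permutes_inverses[OF y(1)])
      qed (use e in auto)
      have "(\<Prod>j<n. e (q j)) = prod e A" by (rule prod.permute[OF y(1), symmetric, unfolded comp_def])
      then have "prod ?e' A = w" using e(2) by (simp add: prod.distrib w_def)
      moreover have "?e' \<in> A \<rightarrow>\<^sub>E Z"
        using e f permutes_less[OF y(1)] by (auto intro!: Z_mult)
      ultimately show "?e' \<in> {e. e \<in> A \<rightarrow>\<^sub>E Z \<and> prod e A = w}" by simp
      have "M c e * y = M (c \<circ> q) (\<lambda>j. e (q j) * f j)" unfolding y(3) by (rule mono_mat_mult[OF y(1)])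
      also have "\<dots> = M (c \<circ> q) ?e'" by (rule mono_mat_cong) simp
      finally show "?L (c \<circ> q) ?e' = of_nat (r * l + 1) ^ ell r n \<zeta> (M c e * y)" by simp
    next
      fix e assume "e \<in> {e. e \<in> A \<rightarrow>\<^sub>E Z \<and> prod e A = w}"
      then have e: "e \<in> A \<rightarrow>\<^sub>E Z" "prod e A = w" by auto
      let ?e' = "restrict (\<lambda>j. e (pinv q j) * inverse (f (pinv q j))) A"
      show "restrict (\<lambda>j. ?e' (q j) * f j) A = e"
      proof (rule PiE_ext[of _ A "\<lambda>_. UNIV"])
        fix j assume j: "j \<in> A"
        then have "q j < n" using permutes_less[OF y(1)] by simp
        then show "restrict (\<lambda>j. ?e' (q j) * f j) A j = e j"
          using j f[of j] Z_nz by (simp add: permutes_inverses[OF y(1)])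
      qed (use e in auto)
      have "(\<Prod>j<n. e (pinv q j) * inverse (f (pinv q j))) = (\<Prod>j<n. e j * inverse (f j))"
        by (rule prod.permute[OF qi, symmetric, unfolded comp_def])
      moreover have "(\<Prod>j<n. inverse (f j)) = inverse w"
        using prod_inversef[of f A] by (simp add: comp_def w_def)
      ultimately have "prod ?e' A = w * inverse w" using e(2) by (simp add: prod.distrib)
      then have "prod ?e' A = 1" using w Z_nz by simp
      moreover have "?e' \<in> A \<rightarrow>\<^sub>E Z"
        unfolding restrict_PiE_iff using e f permutes_less[OF qi]
        by (intro ballI Z_mult Z_inverse) auto
      ultimately show "?e' \<in> {e. e \<in> A \<rightarrow>\<^sub>E Z \<and> prod e A = 1}" by simp
    qed
    also have "\<dots> = (\<Sum>e\<in>A \<rightarrow>\<^sub>E Z. if prod e A = w then ?L (c \<circ> q) e else 0)"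
      unfolding Collect_conj_eq Collect_mem_eq
      using finite_entries[of A] by (simp add: sum.If_cases Int_def)
    also have "\<dots> = (\<Sum>e\<in>A \<rightarrow>\<^sub>E Z. (\<Sum>s<r. (prod e A * inverse w) ^ s) / of_nat r * ?L (c \<circ> q) e)"
    proof (rule sum.cong[OF refl])
      fix e assume "e \<in> A \<rightarrow>\<^sub>E Z"
      then have h: "prod e A * inverse w \<in> Z" using w by (intro Z_mult Z_inverse Z_prod) auto
      have h': "prod e A * inverse w = 1 \<longleftrightarrow> prod e A = w"
        using w Z_nz by (auto simp: field_simps)
      show "(if prod e A = w then ?L (c \<circ> q) e else 0) =
          (\<Sum>s<r. (prod e A * inverse w) ^ s) / of_nat r * ?L (c \<circ> q) e"
        unfolding delta_one_Fourier[OF h] h' using r2 by simp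
    qed
    also have "\<dots> = (\<Sum>e\<in>A \<rightarrow>\<^sub>E Z. \<Sum>s<r. inverse w ^ s / of_nat r * (prod e A ^ s * ?L (c \<circ> q) e))"
      unfolding sum_divide_distrib sum_distrib_right
      by (intro sum.cong refl) (simp only: power_mult_distrib divide_inverse mult_ac)
    also have "\<dots> = (\<Sum>s<r. inverse w ^ s / of_nat r * (\<Sum>e\<in>A \<rightarrow>\<^sub>E Z. prod e A ^ s * ?L (c \<circ> q) e))"
      unfolding sum_distrib_left by (rule sum.swap)
    also have "\<dots> = (\<Sum>s<r. inverse w ^ s / of_nat r * (of_nat r ^ n * of_nat (l + delta s) ^ cyc (c \<circ> q) A))"
    proof (rule sum.cong[OF refl])
      fix s assume "s \<in> {..<r}"
      then have "(\<Sum>z\<in>Z. z ^ s) = of_nat (r * delta s)" by (simp add: sum_Z_power delta_def)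
      from character_sum[OF cq _ _ this, of l]
      show "inverse w ^ s / of_nat r * (\<Sum>e\<in>A \<rightarrow>\<^sub>E Z. prod e A ^ s * ?L (c \<circ> q) e) =
        inverse w ^ s / of_nat r * (of_nat r ^ n * of_nat (l + delta s) ^ cyc (c \<circ> q) A)"
        by (simp add: power_mult_distrib)
    qed
    also have "\<dots> = of_nat r ^ (n - 1) * (\<Sum>s<r. inverse w ^ s * of_nat (l + delta s) ^ cyc (c \<circ> q) A)"
    proof -
      have "(of_nat r :: complex) ^ n = of_nat r * of_nat r ^ (n - 1)" using n1 by (cases n) auto
      then show ?thesis using r2 unfolding sum_distrib_left by (intro sum.cong refl) simp
    qed
    finally show ?thesis .
  qed
  have "(\<Sum>k\<in>K_full 1. of_nat (r * l + 1) ^ ell r n \<zeta> (k * y) :: complex) =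
      (\<Sum>c\<in>full_cycles A. of_nat r ^ (n - 1) * (\<Sum>s<r. inverse w ^ s * of_nat (l + delta s) ^ cyc (c \<circ> q) A))"
    unfolding sum_K_full by (rule sum.cong[OF refl]) (rule inner)
  also have "\<dots> = of_nat r ^ (n - 1) * (\<Sum>s<r. inverse w ^ s * (\<Sum>c\<in>full_cycles A. of_nat (l + delta s) ^ cyc (c \<circ> q) A))"
    unfolding sum_distrib_left by (rule sum.swap)
  finally show ?thesis unfolding py .
qed

definition R_sum :: "nat \<Rightarrow> nat \<Rightarrow> (nat \<Rightarrow> nat) \<Rightarrow> real" where
  "R_sum a b \<sigma> = (\<Sum>p | p permutes A. \<Sum>c\<in>full_cycles A. real a ^ cyc p A * real b ^ cyc (c \<circ> (\<sigma> \<circ> p)) A)"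

text \<open>The sum of the nontrivial characters \<open>z ^ s\<close>, 0 < s < r, at an element of
  \<open>Z\<close>.\<close>

definition twist :: "complex \<Rightarrow> real" where "twist z = (if z = 1 then real r - 1 else - 1)"

text \<open>The s-th character of the product splits into a factor from \<open>g\<close> and one
  that weights the entries of \<open>x\<close>. Hence both bases are raised by one for s = 0 and
  left alone otherwise; the nontrivial characters share one value and their coefficients add up to
  \<open>twist\<close>.\<close>

lemma sum_first_class:
  assumes g: "g \<in> Gn n \<zeta>"
  shows "(\<Sum>k1\<in>K_full 1. \<Sum>x\<in>Gn n \<zeta>. real (r * k + 1) ^ ell r n \<zeta> x * real (r * l + 1) ^ ell r n \<zeta> (k1 * (g * x))) =
    real r ^ (n - 1) * real r ^ n * (R_sum (k + 1) (l + 1) (prm g) + twist (prd g) * R_sum k l (prm g))"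
    (is "?S = ?T")
proof -
  define z where "z = inverse (prd g)"
  have zZ: "z \<in> Z" unfolding z_def by (intro Z_inverse prd_in_Z g)
  let ?ck = "\<lambda>x. of_nat (r * k + 1) ^ ell r n \<zeta> x :: complex"
  let ?U = "\<lambda>s \<sigma>. \<Sum>c\<in>full_cycles A. of_nat (l + delta s) ^ cyc (c \<circ> \<sigma>) A :: complex"
  have "complex_of_real ?S = (\<Sum>x\<in>Gn n \<zeta>. ?ck x * (\<Sum>k1\<in>K_full 1. of_nat (r * l + 1) ^ ell r n \<zeta> (k1 * (g * x))))"
    unfolding sum_distrib_left by (subst sum.swap) simp
  also have "\<dots> = (\<Sum>x\<in>Gn n \<zeta>. of_nat r ^ (n - 1) *
      (\<Sum>s<r. z ^ s * (inverse (prd x) ^ s * ?ck x * ?U s (prm g \<circ> prm x))))"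
  proof (rule sum.cong[OF refl])
    fix x assume x: "x \<in> Gn n \<zeta>"
    show "?ck x * (\<Sum>k1\<in>K_full 1. of_nat (r * l + 1) ^ ell r n \<zeta> (k1 * (g * x))) = of_nat r ^ (n - 1) *
      (\<Sum>s<r. z ^ s * (inverse (prd x) ^ s * ?ck x * ?U s (prm g \<circ> prm x)))"
      unfolding first_average[OF Gn_mult(1)[OF g x]] Gn_mult(2,3)[OF g x]
      by (simp add: sum_distrib_left z_def power_mult_distrib mult_ac)
  qed
  also have "\<dots> = of_nat r ^ (n - 1) * (\<Sum>s<r. z ^ s * (\<Sum>x\<in>Gn n \<zeta>. inverse (prd x) ^ s * ?ck x * ?U s (prm g \<circ> prm x)))"
    unfolding sum_distrib_left by (rule sum.swap)
  also have "\<dots> = of_nat r ^ (n - 1) * (\<Sum>s<r. z ^ s * (of_nat r ^ n * of_real (R_sum (k + delta s) (l + delta s) (prm g))))"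
  proof (intro arg_cong2[of _ _ _ _ "(*)"] refl sum.cong)
    fix s assume "s \<in> {..<r}"
    then have h: "(\<Sum>z\<in>Z. inverse z ^ s) = of_nat (r * delta s)"
      unfolding sum_Z_inverse[of "\<lambda>z. z ^ s"] by (simp add: sum_Z_power delta_def)
    have "(\<Sum>x\<in>Gn n \<zeta>. inverse (prd x) ^ s * ?ck x * ?U s (prm g \<circ> prm x)) =
        (\<Sum>p | p permutes A. (\<Sum>e\<in>A \<rightarrow>\<^sub>E Z. inverse (prod e A) ^ s * ?ck (M p e)) * ?U s (prm g \<circ> p))"
      unfolding sum_Gn sum_distrib_right
    proof (rule sum.cong[OF refl], rule sum.cong[OF refl])
      fix p e assume "p \<in> {p. p permutes A}" "e \<in> A \<rightarrow>\<^sub>E Z"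
      then have "prm (M p e) = p" "prd (M p e) = prod e A" by (auto intro!: prm_M)
      then show "inverse (prd (M p e)) ^ s * ?ck (M p e) * ?U s (prm g \<circ> prm (M p e)) =
        inverse (prod e A) ^ s * ?ck (M p e) * ?U s (prm g \<circ> p)" by (simp only:)
    qed
    also have "\<dots> = (\<Sum>p | p permutes A. of_nat r ^ n * of_nat (k + delta s) ^ cyc p A * ?U s (prm g \<circ> p))"
    proof (rule sum.cong[OF refl])
      fix p assume "p \<in> {p. p permutes A}"
      then have "p permutes A" by simp
      from character_sum[OF this _ _ h, of k]
      show "(\<Sum>e\<in>A \<rightarrow>\<^sub>E Z. inverse (prod e A) ^ s * ?ck (M p e)) * ?U s (prm g \<circ> p) =
        of_nat r ^ n * of_nat (k + delta s) ^ cyc p A * ?U s (prm g \<circ> p)"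
        by (simp add: power_mult_distrib)
    qed
    also have "\<dots> = of_nat r ^ n * of_real (R_sum (k + delta s) (l + delta s) (prm g))"
      by (simp add: R_sum_def sum_distrib_left mult.assoc)
    finally show "(\<Sum>x\<in>Gn n \<zeta>. inverse (prd x) ^ s * ?ck x * ?U s (prm g \<circ> prm x)) =
      of_nat r ^ n * of_real (R_sum (k + delta s) (l + delta s) (prm g))" .
  qed
  also have "(\<Sum>s<r. z ^ s * (of_nat r ^ n * of_real (R_sum (k + delta s) (l + delta s) (prm g)))) =
      of_nat r ^ n * (of_real (R_sum (k + 1) (l + 1) (prm g)) + of_real (twist (prd g)) * of_real (R_sum k l (prm g)))"
  proof -
    let ?X = "of_real (R_sum (k + 1) (l + 1) (prm g)) :: complex" and ?Y = "of_real (R_sum k l (prm g)) :: complex"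
    have "(\<Sum>s<r. z ^ s * (of_nat r ^ n * of_real (R_sum (k + delta s) (l + delta s) (prm g)))) =
        (\<Sum>s<r. of_nat r ^ n * (z ^ s * ?Y + (if s = 0 then ?X - ?Y else 0)))"
      by (rule sum.cong[OF refl]) (simp add: delta_def algebra_simps)
    also have "\<dots> = of_nat r ^ n * ((\<Sum>s<r. z ^ s) * ?Y + (?X - ?Y))"
      unfolding sum_distrib_left[symmetric] sum.distrib sum_distrib_right[symmetric] using r2 by simp
    also have "(\<Sum>s<r. z ^ s) = of_real (twist (prd g)) + 1"
      unfolding delta_one_Fourier[OF zZ] by (simp add: twist_def z_def)
    finally show ?thesis by (simp add: algebra_simps)
  qed
  also have "of_nat r ^ (n - 1) * (of_nat r ^ n * (of_real (R_sum (k + 1) (l + 1) (prm g)) +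
      of_real (twist (prd g)) * of_real (R_sum k l (prm g)))) = complex_of_real ?T"
    by simp
  finally show ?thesis by (simp only: of_real_eq_iff)
qed

end

lemma two_point_complements:
  assumes "i \<in> S" "S - {i} = {j}" "j \<noteq> i"
  shows "{{j}, S - {j}} = {{i}, S - {i}}"
proof -
  have "S = {i, j}" using assms by auto
  then have "S - {j} = {i}" using assms(3) by auto
  then show ?thesis using assms(2) by auto
qed

context monomial_group begin

text \<open>Left multiplication by \<open>g\<close> is injective, so an intersection number counts
  the \<open>x\<close> with prescribed \<open>ell\<close> at \<open>x\<close> and at
  \<open>g * x\<close>; the double sum sorts the group by these two values.\<close>

lemma sum_Cset_card:
  fixes a b :: real
  assumes g: "g \<in> Gn n \<zeta>"
  shows "(\<Sum>i=0..n. \<Sum>j=0..n. a ^ i * b ^ j * real (card ((\<lambda>c. g * c) ` Cset r n \<zeta> i \<inter> Cset r n \<zeta> j))) =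
    (\<Sum>x\<in>Gn n \<zeta>. a ^ ell r n \<zeta> x * b ^ ell r n \<zeta> (g * x))"
proof -
  let ?l = "ell r n \<zeta>"
  have "a ^ i * b ^ j * real (card ((\<lambda>c. g * c) ` Cset r n \<zeta> i \<inter> Cset r n \<zeta> j)) =
      (\<Sum>x\<in>Gn n \<zeta>. if i = ?l x then (if j = ?l (g * x) then a ^ i * b ^ j else 0) else 0)" for i j
  proof -
    have "(\<lambda>c. g * c) ` Cset r n \<zeta> i \<inter> Cset r n \<zeta> j =
        (\<lambda>c. g * c) ` {x \<in> Gn n \<zeta>. i = ?l x \<and> j = ?l (g * x)}"
      using Gn_mult(1)[OF g] by (auto simp: Cset_def)
    then have "card ((\<lambda>c. g * c) ` Cset r n \<zeta> i \<inter> Cset r n \<zeta> j) = card {x \<in> Gn n \<zeta>. i = ?l x \<and> j = ?l (g * x)}"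
      using card_image[OF inj_on_subset[OF Gn_left_inj[OF g]], of "{x \<in> Gn n \<zeta>. i = ?l x \<and> j = ?l (g * x)}"] by auto
    moreover have "(\<Sum>x\<in>Gn n \<zeta>. if i = ?l x then (if j = ?l (g * x) then a ^ i * b ^ j else 0) else 0) =
        (\<Sum>x\<in>Gn n \<zeta>. if i = ?l x \<and> j = ?l (g * x) then a ^ i * b ^ j else 0)"
      by (rule sum.cong[OF refl]) simp
    moreover have "\<dots> = (\<Sum>x\<in>{x \<in> Gn n \<zeta>. i = ?l x \<and> j = ?l (g * x)}. a ^ i * b ^ j)"
      by (rule sum.inter_filter[symmetric, OF finite_Gn])
    ultimately show ?thesis by (simp only: sum_constant mult.commute)
  qed
  then have "(\<Sum>i=0..n. \<Sum>j=0..n. a ^ i * b ^ j * real (card ((\<lambda>c. g * c) ` Cset r n \<zeta> i \<inter> Cset r n \<zeta> j))) =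
      (\<Sum>i=0..n. \<Sum>j=0..n. \<Sum>x\<in>Gn n \<zeta>. if i = ?l x then (if j = ?l (g * x) then a ^ i * b ^ j else 0) else 0)"
    by simp
  also have "\<dots> = (\<Sum>i=0..n. \<Sum>x\<in>Gn n \<zeta>. \<Sum>j=0..n. if i = ?l x then (if j = ?l (g * x) then a ^ i * b ^ j else 0) else 0)"
    by (intro sum.cong refl sum.swap)
  also have "\<dots> = (\<Sum>x\<in>Gn n \<zeta>. \<Sum>i=0..n. \<Sum>j=0..n. if i = ?l x then (if j = ?l (g * x) then a ^ i * b ^ j else 0) else 0)"
    by (rule sum.swap)
  also have "\<dots> = (\<Sum>x\<in>Gn n \<zeta>. a ^ ?l x * b ^ ?l (g * x))"
  proof (rule sum.cong[OF refl])
    fix x assume x: "x \<in> Gn n \<zeta>"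
    have l: "?l x \<le> n" "?l (g * x) \<le> n" using ell_le x Gn_mult(1)[OF g x] by auto
    have "(\<Sum>i=0..n. \<Sum>j=0..n. if i = ?l x then (if j = ?l (g * x) then a ^ i * b ^ j else 0) else 0) =
        (\<Sum>i=0..n. if i = ?l x then (\<Sum>j=0..n. if j = ?l (g * x) then a ^ i * b ^ j else 0) else 0)"
      by (rule sum.cong[OF refl]) simp
    then show "(\<Sum>i=0..n. \<Sum>j=0..n. if i = ?l x then (if j = ?l (g * x) then a ^ i * b ^ j else 0) else 0) =
      a ^ ?l x * b ^ ?l (g * x)" using l by simp
  qed
  finally show ?thesis .
qed

text \<open>Up to the order of the group, the pairing of the powers with bases r k + 1 and r l + 1
  for a single sequence of classes.\<close>

definition tot :: "complex mat set list \<Rightarrow> nat \<Rightarrow> nat \<Rightarrow> real" where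
  "tot Ks k l = (\<Sum>i=0..n. \<Sum>j=0..n. real (r * k + 1) ^ i * real (r * l + 1) ^ j *
    mu_seq n Ks (Cset r n \<zeta> i) (Cset r n \<zeta> j))"

abbreviation mprod :: "complex mat list \<Rightarrow> complex mat" where "mprod ks \<equiv> foldr (*) ks (1\<^sub>m n)"

lemma mprod_Gn:
  assumes "\<And>K. K \<in> set Ks \<Longrightarrow> K \<subseteq> Gn n \<zeta>" "list_all2 (\<in>) ks Ks"
  shows "mprod ks \<in> Gn n \<zeta>"
  using assms(2,1)
proof (induction rule: list_all2_induct)
  case Nil
  then show ?case by (simp add: one_Gn)
next
  case (Cons k ks K Ks)
  then have "k \<in> Gn n \<zeta>" "mprod ks \<in> Gn n \<zeta>" by auto
  then show ?case by (simp add: Gn_mult)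
qed

lemma tot_eq:
  assumes "\<And>K. K \<in> set Ks \<Longrightarrow> K \<noteq> {} \<and> K \<subseteq> Gn n \<zeta>"
  shows "tot Ks k l = averages Ks (\<lambda>ks. \<Sum>x\<in>Gn n \<zeta>.
    real (r * k + 1) ^ ell r n \<zeta> x * real (r * l + 1) ^ ell r n \<zeta> (mprod ks * x))"
proof -
  have "finite K \<and> K \<noteq> {}" if "K \<in> set Ks" for K
    using assms[OF that] finite_Gn finite_subset by blast
  then have "mu_seq n Ks X Y = averages Ks (\<lambda>ks. real (card ((\<lambda>c. mprod ks * c) ` X \<inter> Y)))" for X Y
    unfolding mu_seq_def by (rule expectation_indep_uniform(1))
  then have "tot Ks k l = averages Ks (\<lambda>ks. \<Sum>i=0..n. \<Sum>j=0..n. real (r * k + 1) ^ i * real (r * l + 1) ^ j *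
      real (card ((\<lambda>c. mprod ks * c) ` Cset r n \<zeta> i \<inter> Cset r n \<zeta> j)))"
    unfolding tot_def averages_sum averages_cmult by simp
  also have "\<dots> = averages Ks (\<lambda>ks. \<Sum>x\<in>Gn n \<zeta>.
      real (r * k + 1) ^ ell r n \<zeta> x * real (r * l + 1) ^ ell r n \<zeta> (mprod ks * x))"
    by (rule averages_cong, rule sum_Cset_card, rule mprod_Gn) (use assms in auto)
  finally show ?thesis .
qed

section \<open>Permutations of uniform elements of the classes\<close>

lemma sum_K_full_prm:
  assumes "z \<in> Z"
  shows "(\<Sum>k\<in>K_full z. F (prm k)) = real r ^ (n - 1) * (\<Sum>c\<in>full_cycles A. F c :: real)"
    and "real (card (K_full z)) = real r ^ (n - 1) * real (card (full_cycles A))"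
proof -
  have g: "(\<Sum>k\<in>K_full z. F (prm k)) = real r ^ (n - 1) * (\<Sum>c\<in>full_cycles A. F c)" for F :: "(nat \<Rightarrow> nat) \<Rightarrow> real"
  proof -
    have "(\<Sum>k\<in>K_full z. F (prm k)) = (\<Sum>c\<in>full_cycles A. \<Sum>e | e \<in> A \<rightarrow>\<^sub>E Z \<and> prod e A = z. F c)"
      unfolding sum_K_full
      by (intro sum.cong refl arg_cong[of _ _ F] prm_M(1)) (auto simp: full_cycles_def)
    also have "\<dots> = (\<Sum>c\<in>full_cycles A. real r ^ (n - 1) * F c)"
      using card_entries_prod[OF A_facts(1,2) assms] by simp
    finally show ?thesis by (simp only: sum_distrib_left)
  qed
  then show "(\<Sum>k\<in>K_full z. F (prm k)) = real r ^ (n - 1) * (\<Sum>c\<in>full_cycles A. F c)" .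
  from g[of "\<lambda>_. 1"] show "real (card (K_full z)) = real r ^ (n - 1) * real (card (full_cycles A))" by simp
qed

lemma card_full_pos: "0 < card (full_cycles A)"
  using card_full_cycles[OF A_facts(1,2)] by (metis fact_nonzero gr0I of_nat_0)

lemma K_full_Gn:
  assumes "z \<in> Z"
  shows "K_full z \<subseteq> Gn n \<zeta>" "K_full z \<noteq> {}" "k \<in> K_full z \<Longrightarrow> prd k = z"
proof -
  show "K_full z \<subseteq> Gn n \<zeta>" unfolding K_full_def by (rule sum_K_image(3)[OF K_full_pairs])
  show "K_full z \<noteq> {}" using sum_K_full_prm(2)[OF assms] card_full_pos r2 by auto
  show "prd k = z" if "k \<in> K_full z"
  proof -
    obtain c e where "c permutes A" "e \<in> A \<rightarrow>\<^sub>E Z" "prod e A = z" "k = M c e"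
      using \<open>k \<in> K_full z\<close> by (auto simp: K_full_def full_cycles_def)
    then show ?thesis using prm_M(2)[of c e] by auto
  qed
qed

text \<open>All five sequences begin with the full cycles of product 1. Averaging over them absorbs
  the entries of the remaining factors except for their product, which is the constant
  \<open>z\<close>.\<close>

lemma tot_Cons:
  assumes "\<forall>K\<in>set Ks. K \<noteq> {} \<and> K \<subseteq> Gn n \<zeta>"
    and z: "\<forall>ks. list_all2 (\<in>) ks Ks \<longrightarrow> prd (mprod ks) = z"
  shows "tot (K_full 1 # Ks) k l = real r ^ n / real (card (full_cycles A)) *
    (averages Ks (\<lambda>ks. R_sum (k + 1) (l + 1) (prm (mprod ks))) + twist z * averages Ks (\<lambda>ks. R_sum k l (prm (mprod ks))))"
proof -
  have K1: "K_full 1 \<noteq> {} \<and> K_full 1 \<subseteq> Gn n \<zeta>" using K_full_Gn[OF Z_facts(3)] by blast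
  let ?F = "\<lambda>g. \<Sum>x\<in>Gn n \<zeta>. real (r * k + 1) ^ ell r n \<zeta> x * real (r * l + 1) ^ ell r n \<zeta> (g * x)"
  have "tot (K_full 1 # Ks) k l = averages (K_full 1 # Ks) (\<lambda>ks. ?F (mprod ks))"
    by (rule tot_eq) (use assms(1) K1 in auto)
  also have "\<dots> = averages Ks (\<lambda>ks. \<Sum>k1\<in>K_full 1. ?F (k1 * mprod ks)) / real (card (K_full 1))"
  proof -
    have m: "mprod (k1 # ks) = k1 * mprod ks" for k1 ks by simp
    show ?thesis
      unfolding averages_sum[of Ks "\<lambda>k1 ks. ?F (k1 * mprod ks)" "K_full 1"] by (simp only: averages.simps m)
  qed
  also have "averages Ks (\<lambda>ks. \<Sum>k1\<in>K_full 1. ?F (k1 * mprod ks)) =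
      averages Ks (\<lambda>ks. real r ^ (n - 1) * real r ^ n *
        (R_sum (k + 1) (l + 1) (prm (mprod ks)) + twist z * R_sum k l (prm (mprod ks))))"
  proof (rule averages_cong)
    fix ks assume ks: "list_all2 (\<in>) ks Ks"
    have g: "mprod ks \<in> Gn n \<zeta>" by (rule mprod_Gn[OF _ ks]) (use assms(1) in auto)
    have "(\<Sum>k1\<in>K_full 1. ?F (k1 * mprod ks)) = (\<Sum>k1\<in>K_full 1. \<Sum>x\<in>Gn n \<zeta>.
        real (r * k + 1) ^ ell r n \<zeta> x * real (r * l + 1) ^ ell r n \<zeta> (k1 * (mprod ks * x)))"
    proof (intro sum.cong refl)
      fix k1 x assume "k1 \<in> K_full 1" "x \<in> Gn n \<zeta>"
      then have "(k1 * mprod ks) * x = k1 * (mprod ks * x)"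
        using K1 g by (intro assoc_mult_mat[of _ n n _ n _ n] Gn_carrier) auto
      then show "real (r * k + 1) ^ ell r n \<zeta> x * real (r * l + 1) ^ ell r n \<zeta> (k1 * mprod ks * x) =
        real (r * k + 1) ^ ell r n \<zeta> x * real (r * l + 1) ^ ell r n \<zeta> (k1 * (mprod ks * x))" by (simp only:)
    qed
    then show "(\<Sum>k1\<in>K_full 1. ?F (k1 * mprod ks)) = real r ^ (n - 1) * real r ^ n *
        (R_sum (k + 1) (l + 1) (prm (mprod ks)) + twist z * R_sum k l (prm (mprod ks)))"
      unfolding sum_first_class[OF g] z[rule_format, OF ks] .
  qed
  also have "\<dots> = real r ^ (n - 1) * real r ^ n * (averages Ks (\<lambda>ks. R_sum (k + 1) (l + 1) (prm (mprod ks))) +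
      twist z * averages Ks (\<lambda>ks. R_sum k l (prm (mprod ks))))"
    by (simp only: averages_cmult averages_add)
  finally show ?thesis
    unfolding sum_K_full_prm(2)[OF Z_facts(3)] using r2 by simp
qed

text \<open>Stated with means, so that the multiplicities on the two sides may differ, and with an
  index set \<open>X\<close>, so that marked cycles can serve as the model.\<close>

definition equidistributed :: "complex mat set \<Rightarrow> ('x \<Rightarrow> nat \<Rightarrow> nat) \<Rightarrow> 'x set \<Rightarrow> bool" where
  "equidistributed K h X \<longleftrightarrow> K \<noteq> {} \<and> K \<subseteq> Gn n \<zeta> \<and>
    (\<forall>F :: _ \<Rightarrow> real. (\<Sum>k\<in>K. F (prm k)) / real (card K) = (\<Sum>x\<in>X. F (h x)) / real (card X))"

lemma equidistributedD:
  "equidistributed K h X \<Longrightarrow> (\<Sum>k\<in>K. F (prm k)) / real (card K) = (\<Sum>x\<in>X. F (h x)) / real (card X)"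
  by (simp add: equidistributed_def)

lemma equidistributedI:
  assumes "K \<noteq> {}" "K \<subseteq> Gn n \<zeta>" "0 < \<kappa>"
    and s: "\<And>F :: _ \<Rightarrow> real. (\<Sum>k\<in>K. F (prm k)) = \<kappa> * (\<Sum>x\<in>X. F (h x))"
  shows "equidistributed K h X"
proof -
  have "real (card K) = \<kappa> * real (card X)" using s[of "\<lambda>_. 1"] by simp
  then show ?thesis using assms by (simp add: equidistributed_def)
qed

lemma equidistributed_full:
  assumes "z \<in> Z"
  shows "equidistributed (K_full z) id (full_cycles A)"
  by (rule equidistributedI[of _ "real r ^ (n - 1)"])
    (use K_full_Gn[OF assms] sum_K_full_prm(1)[OF assms] r2 in auto)

text \<open>For n = 2 the only permutation that occurs is the identity, marked at either point; for
  larger n the marked point is the only fixed one.\<close>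

lemma near_mult:
  assumes n2: "2 \<le> n" and x: "x \<in> near_full_cycles A"
  shows "card {y \<in> near_full_cycles A. snd y = snd x} = (if n = 2 then 2 else 1)"
proof -
  obtain i d where x': "x = (i, d)" "(i, d) \<in> near_full_cycles A" using x by (cases x) auto
  note no = near_orbits[OF n2 x'(2)]
  have s: "{y \<in> near_full_cycles A. snd y = snd x} = (\<lambda>j. (j, d)) ` {j \<in> A. {{j}, A - {j}} = {{i}, A - {i}}}"
  proof -
    have "(j, d) \<in> near_full_cycles A \<longleftrightarrow> j \<in> A \<and> {{j}, A - {j}} = {{i}, A - {i}}" for j
      using near_full_cycles_iff[of A j d] n2 no(2,3) A_facts by metis
    then have "{j \<in> A. {{j}, A - {j}} = {{i}, A - {i}}} = {j. (j, d) \<in> near_full_cycles A}" by simp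
    then show ?thesis by (force simp: x')
  qed
  have c: "{j \<in> A. {{j}, A - {j}} = {{i}, A - {i}}} = (if n = 2 then A else {i})"
  proof (cases "n = 2")
    case True
    have "{{j}, A - {j}} = {{i}, A - {i}}" if "j \<in> A" for j
    proof (cases "j = i")
      case False
      have "card (A - {i}) = 1" using no(5) True by simp
      then obtain a where a: "A - {i} = {a}" by (rule card_1_singletonE)
      have "j \<in> A - {i}" using that False by simp
      then have "A - {i} = {j}" unfolding a by simp
      from two_point_complements[OF no(1) this False] show ?thesis .
    qed simp
    then show ?thesis using True by auto
  next
    case False
    have "j = i" if "j \<in> A" "{{j}, A - {j}} = {{i}, A - {i}}" for j
    proof -
      have "{j} \<in> {{j}, A - {j}}" by simp
      then have "{j} = {i} \<or> {j} = A - {i}" unfolding that(2) by simp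
      moreover have "{j} \<noteq> A - {i}"
      proof
        assume "{j} = A - {i}"
        then have "card {j} = n - 1" using no(5) by simp
        then show False using False n2 by simp
      qed
      ultimately show ?thesis by simp
    qed
    then show ?thesis using False no(1) by auto
  qed
  have "card ((\<lambda>j. (j, d)) ` {j \<in> A. {{j}, A - {j}} = {{i}, A - {i}}}) = card {j \<in> A. {{j}, A - {j}} = {{i}, A - {i}}}"
    by (rule card_image) (auto intro: inj_onI)
  then show ?thesis unfolding s c using A_facts by simp
qed

lemma finite_near: "finite (near_full_cycles A)"
  unfolding near_full_cycles_def by (auto intro!: finite_full_cycles)

lemma near_nonempty:
  assumes "2 \<le> n" shows "0 < card (near_full_cycles A)"
proof -
  have "fact (n - 2) * fact n \<noteq> (0 :: real)" by simp
  then show ?thesis using card_factorizations[OF A_facts(1)] assms A_facts(3) by (metis gr0I mult_zero_right of_nat_0)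
qed

text \<open>Both cycles have product 1, so the condition can be stated over all cycles without the
  marked point. This exhibits the pairs as a disjoint union over distinct permutations.\<close>

lemma near_pairs_eq:
  assumes n2: "2 \<le> n"
  shows "near_one_pairs = {(d, e). d \<in> snd ` near_full_cycles A \<and> e \<in> A \<rightarrow>\<^sub>E Z \<and> (\<forall>C\<in>orbits d A. prod e C = 1)}"
proof (intro equalityI subsetI)
  fix x assume "x \<in> near_one_pairs"
  then obtain i d e where x: "x = (d, e)" "(i, d) \<in> near_full_cycles A" "e \<in> A \<rightarrow>\<^sub>E Z" "e i = 1" "prod e (A - {i}) = 1"
    unfolding near_one_pairs_def by blast
  then have "d \<in> snd ` near_full_cycles A" by force
  then show "x \<in> {(d, e). d \<in> snd ` near_full_cycles A \<and> e \<in> A \<rightarrow>\<^sub>E Z \<and> (\<forall>C\<in>orbits d A. prod e C = 1)}"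
    using x near_orbits(3)[OF n2 x(2)] by simp
next
  fix x assume "x \<in> {(d, e). d \<in> snd ` near_full_cycles A \<and> e \<in> A \<rightarrow>\<^sub>E Z \<and> (\<forall>C\<in>orbits d A. prod e C = 1)}"
  then obtain i d e where x: "x = (d, e)" "(i, d) \<in> near_full_cycles A" "e \<in> A \<rightarrow>\<^sub>E Z" "\<forall>C\<in>orbits d A. prod e C = 1"
    by auto
  then have "e i = 1" "prod e (A - {i}) = 1" using near_orbits(3)[OF n2 x(2)] by auto
  then show "x \<in> near_one_pairs" using x unfolding near_one_pairs_def by blast
qed

text \<open>Every permutation that occurs has the same number of entry tuples and the same number
  \<open>m\<close> of markings, so marked cycles may replace the class as far as means are
  concerned.\<close>

lemma equidistributed_near_one:
  assumes n2: "2 \<le> n"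
  defines "K \<equiv> (\<lambda>(p, e). M p e) ` near_one_pairs"
  shows "equidistributed K snd (near_full_cycles A)" and "\<And>k. k \<in> K \<Longrightarrow> prd k = 1"
proof -
  let ?N = "near_full_cycles A"
  define m :: real where "m = (if n = 2 then 2 else 1)"
  have g: "(\<Sum>k\<in>K. F (prm k)) = real r ^ (n - 2) / m * (\<Sum>x\<in>?N. F (snd x))" for F :: "(nat \<Rightarrow> nat) \<Rightarrow> real"
  proof -
    let ?E = "\<lambda>d. {e \<in> A \<rightarrow>\<^sub>E Z. \<forall>C\<in>orbits d A. prod e C = 1}"
    have S: "near_one_pairs = (SIGMA d:snd ` ?N. ?E d)" unfolding near_pairs_eq[OF n2] by auto
    have "(\<Sum>k\<in>K. F (prm k)) = (\<Sum>(d, e)\<in>near_one_pairs. F (prm (M d e)))"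
      unfolding K_def by (rule sum_K_image(1)[OF near_pairs(2)])
    also have "\<dots> = (\<Sum>(d, e)\<in>near_one_pairs. F d)"
    proof (rule sum.cong[OF refl])
      fix x assume "x \<in> near_one_pairs"
      then have "x \<in> pairs" using near_pairs(2) by blast
      then show "(case x of (d, e) \<Rightarrow> F (prm (M d e))) = (case x of (d, e) \<Rightarrow> F d)"
        by (auto simp: pairs_def intro!: arg_cong[of _ _ F] prm_M(1))
    qed
    also have "\<dots> = (\<Sum>d\<in>snd ` ?N. \<Sum>e\<in>?E d. F d)"
      unfolding S by (rule sum.Sigma[symmetric]) (use finite_near finite_entries[of A] in auto)
    also have "\<dots> = (\<Sum>d\<in>snd ` ?N. real r ^ (n - 2) * F d)"
    proof (rule sum.cong[OF refl])
      fix d assume "d \<in> snd ` ?N"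
      then obtain i where i: "(i, d) \<in> ?N" by auto
      have "?E d = {e \<in> A \<rightarrow>\<^sub>E Z. e i = 1 \<and> prod e (A - {i}) = 1}"
        unfolding near_orbits(3)[OF n2 i] by auto
      then have "card (?E d) = r ^ (n - 2)"
        using card_entries_split[OF n2 near_orbits(1)[OF n2 i] Z_facts(3)] by simp
      then show "(\<Sum>e\<in>?E d. F d) = real r ^ (n - 2) * F d" by simp
    qed
    also have "\<dots> = real r ^ (n - 2) * (\<Sum>d\<in>snd ` ?N. F d)" by (simp only: sum_distrib_left)
    also have "m * (\<Sum>d\<in>snd ` ?N. F d) = (\<Sum>x\<in>?N. F (snd x))"
    proof -
      have "(\<Sum>x\<in>?N. F (snd x)) = (\<Sum>d\<in>snd ` ?N. \<Sum>x | x \<in> ?N \<and> snd x = d. F (snd x))"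
        by (rule sum.image_gen[OF finite_near])
      also have "\<dots> = (\<Sum>d\<in>snd ` ?N. m * F d)"
      proof (rule sum.cong[OF refl])
        fix d assume "d \<in> snd ` ?N"
        then obtain x where x: "x \<in> ?N" "snd x = d" by auto
        have "real (card {y \<in> ?N. snd y = d}) = m" using near_mult[OF n2 x(1)] by (simp add: m_def x(2))
        then show "(\<Sum>x | x \<in> ?N \<and> snd x = d. F (snd x)) = m * F d" by simp
      qed
      finally show ?thesis by (simp only: sum_distrib_left)
    qed
    then have "(\<Sum>d\<in>snd ` ?N. F d) = (\<Sum>x\<in>?N. F (snd x)) / m" by (simp add: m_def field_simps)
    finally show ?thesis by simp
  qed
  have k0: "0 < real r ^ (n - 2) / m" using r2 by (simp add: m_def)
  have "K \<noteq> {}"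
  proof
    assume "K = {}"
    then have "real r ^ (n - 2) / m * real (card ?N) = 0" using g[of "\<lambda>_. 1"] by simp
    moreover have "0 < real r ^ (n - 2) / m * real (card ?N)"
      using k0 near_nonempty[OF n2] by (intro mult_pos_pos) auto
    ultimately show False by linarith
  qed
  moreover have "K \<subseteq> Gn n \<zeta>" unfolding K_def by (rule sum_K_image(3)[OF near_pairs(2)])
  ultimately show "equidistributed K snd ?N" using k0 g by (rule equidistributedI)
  show "prd k = 1" if k: "k \<in> K" for k
  proof -
    obtain i d e where x: "k = M d e" "(i, d) \<in> ?N" "e \<in> A \<rightarrow>\<^sub>E Z" "e i = 1" "prod e (A - {i}) = 1"
      using k unfolding K_def near_one_pairs_def by auto
    have "prod e A = e i * prod e (A - {i})" by (rule prod.remove) (use near_orbits(1)[OF n2 x(2)] in auto)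
    moreover have "prd k = prod e A" unfolding x(1) using near_orbits(2)[OF n2 x(2)] x(3) by (intro prm_M(2)) auto
    ultimately show ?thesis using x by simp
  qed
qed

text \<open>Here the marking is visible in the pair, also for n = 2, so the class corresponds one to
  one to marked cycles with tuples.\<close>

lemma equidistributed_near_zeta:
  assumes n2: "2 \<le> n"
  defines "K \<equiv> (\<lambda>(p, e). M p e) ` near_zeta_pairs"
  shows "equidistributed K snd (near_full_cycles A)" and "\<And>k. k \<in> K \<Longrightarrow> prd k = \<zeta>"
proof -
  let ?N = "near_full_cycles A"
  let ?E = "\<lambda>x. {e \<in> A \<rightarrow>\<^sub>E Z. e (fst x) = \<zeta> \<and> prod e (A - {fst x}) = 1}"
  let ?f = "\<lambda>(x, e :: nat \<Rightarrow> complex). (snd x, e)"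
  have S: "near_zeta_pairs = ?f ` (SIGMA x:?N. ?E x)"
  proof (intro equalityI subsetI)
    fix y assume "y \<in> near_zeta_pairs"
    then obtain i d e where y: "y = (d, e)" "(i, d) \<in> ?N" "e \<in> A \<rightarrow>\<^sub>E Z" "e i = \<zeta>" "prod e (A - {i}) = 1"
      unfolding near_zeta_pairs_def by blast
    have "((i, d), e) \<in> (SIGMA x:?N. ?E x)" using y by simp
    moreover have "y = ?f ((i, d), e)" using y by simp
    ultimately show "y \<in> ?f ` (SIGMA x:?N. ?E x)" by (rule rev_image_eqI)
  next
    fix y assume "y \<in> ?f ` (SIGMA x:?N. ?E x)"
    then obtain i d e where "(i, d) \<in> ?N" "e \<in> ?E (i, d)" "y = (d, e)" by auto
    then show "y \<in> near_zeta_pairs" unfolding near_zeta_pairs_def by auto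
  qed
  have inj: "inj_on ?f (SIGMA x:?N. ?E x)"
  proof (rule inj_onI)
    fix y y' assume y: "y \<in> (SIGMA x:?N. ?E x)" "y' \<in> (SIGMA x:?N. ?E x)" "?f y = ?f y'"
    obtain i d e where yi: "y = ((i, d), e)" by (metis surj_pair)
    obtain j d' e' where yj: "y' = ((j, d'), e')" by (metis surj_pair)
    have i: "(i, d) \<in> ?N" "e i = \<zeta>" "prod e (A - {i}) = 1"
      and j: "(j, d') \<in> ?N" "e' j = \<zeta>" "prod e' (A - {j}) = 1"
      and eq: "d = d'" "e = e'"
      using y unfolding yi yj by simp_all
    have "{{i}, A - {i}} = {{j}, A - {j}}"
      using near_orbits(3)[OF n2 i(1)] near_orbits(3)[OF n2 j(1)] eq by simp
    moreover have "{i} \<in> {{i}, A - {i}}" by simp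
    ultimately have "{i} = {j} \<or> {i} = A - {j}" by simp
    \<comment> \<open>The two markings could only trade places when n = 2, and then
      \<open>e i\<close> would be both \<open>\<zeta>\<close> and 1.\<close>
    moreover have "{i} \<noteq> A - {j}"
    proof
      assume "{i} = A - {j}"
      then have "prod e {i} = 1" using j eq by simp
      then show False using i Z_facts(5) by simp
    qed
    ultimately show "y = y'" using eq yi yj by simp
  qed
  have g: "(\<Sum>k\<in>K. F (prm k)) = real r ^ (n - 2) * (\<Sum>x\<in>?N. F (snd x))" for F :: "(nat \<Rightarrow> nat) \<Rightarrow> real"
  proof -
    have "(\<Sum>k\<in>K. F (prm k)) = (\<Sum>(d, e)\<in>near_zeta_pairs. F (prm (M d e)))"
      unfolding K_def by (rule sum_K_image(1)[OF near_pairs(1)])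
    also have "\<dots> = (\<Sum>(d, e)\<in>near_zeta_pairs. F d)"
    proof (rule sum.cong[OF refl])
      fix x assume "x \<in> near_zeta_pairs"
      then have "x \<in> pairs" using near_pairs(1) by blast
      then show "(case x of (d, e) \<Rightarrow> F (prm (M d e))) = (case x of (d, e) \<Rightarrow> F d)"
        by (auto simp: pairs_def intro!: arg_cong[of _ _ F] prm_M(1))
    qed
    also have "\<dots> = (\<Sum>(x, e)\<in>(SIGMA x:?N. ?E x). F (snd x))"
      unfolding S by (subst sum.reindex[OF inj]) (simp add: case_prod_beta comp_def)
    also have "\<dots> = (\<Sum>x\<in>?N. \<Sum>e\<in>?E x. F (snd x))"
      by (rule sum.Sigma[symmetric]) (use finite_near finite_entries[of A] in auto)
    also have "\<dots> = (\<Sum>x\<in>?N. real r ^ (n - 2) * F (snd x))"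
    proof (rule sum.cong[OF refl])
      fix x assume "x \<in> ?N"
      then have "fst x \<in> A" using near_orbits(1)[OF n2, of "fst x" "snd x"] by simp
      then have "card (?E x) = r ^ (n - 2)" by (rule card_entries_split[OF n2 _ Z_facts(4)])
      then show "(\<Sum>e\<in>?E x. F (snd x)) = real r ^ (n - 2) * F (snd x)" by simp
    qed
    finally show ?thesis by (simp only: sum_distrib_left)
  qed
  have k0: "0 < real r ^ (n - 2)" using r2 by simp
  have "K \<noteq> {}"
  proof
    assume "K = {}"
    then have "real r ^ (n - 2) * real (card ?N) = 0" using g[of "\<lambda>_. 1"] by simp
    then show False using near_nonempty[OF n2] r2 by simp
  qed
  moreover have "K \<subseteq> Gn n \<zeta>" unfolding K_def by (rule sum_K_image(3)[OF near_pairs(1)])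
  ultimately show "equidistributed K snd ?N" using k0 g by (rule equidistributedI)
  show "prd k = \<zeta>" if k: "k \<in> K" for k
  proof -
    obtain i d e where x: "k = M d e" "(i, d) \<in> ?N" "e \<in> A \<rightarrow>\<^sub>E Z" "e i = \<zeta>" "prod e (A - {i}) = 1"
      using k unfolding K_def near_zeta_pairs_def by auto
    have "prod e A = e i * prod e (A - {i})" by (rule prod.remove) (use near_orbits(1)[OF n2 x(2)] in auto)
    moreover have "prd k = prod e A" unfolding x(1) using near_orbits(2)[OF n2 x(2)] x(3) by (intro prm_M(2)) auto
    ultimately show ?thesis using x by simp
  qed
qed

section \<open>Evaluation of the five sequences\<close>

lemma averages_equidistributed:
  assumes K: "equidistributed K h X" and Ks: "\<And>K. K \<in> set Ks \<Longrightarrow> K \<subseteq> Gn n \<zeta>"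
  shows "averages (K # Ks) (\<lambda>ks. G (prm (mprod ks))) =
    (\<Sum>x\<in>X. averages Ks (\<lambda>ks. G (h x \<circ> prm (mprod ks)))) / real (card X)"
proof -
  have "averages (K # Ks) (\<lambda>ks. G (prm (mprod ks))) =
      (\<Sum>k\<in>K. averages Ks (\<lambda>ks. G (prm k \<circ> prm (mprod ks)))) / real (card K)"
    unfolding averages.simps
  proof (intro arg_cong2[of _ _ _ _ "(/)"] sum.cong refl averages_cong)
    fix k ks assume k: "k \<in> K" and ks: "list_all2 (\<in>) ks Ks"
    have "k \<in> Gn n \<zeta>" using k K by (auto simp: equidistributed_def)
    moreover have "mprod ks \<in> Gn n \<zeta>" by (rule mprod_Gn[OF _ ks]) (rule Ks)
    ultimately show "G (prm (mprod (k # ks))) = G (prm k \<circ> prm (mprod ks))" by (simp add: Gn_mult)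
  qed
  also have "\<dots> = (\<Sum>x\<in>X. averages Ks (\<lambda>ks. G (h x \<circ> prm (mprod ks)))) / real (card X)"
    by (rule equidistributedD[OF K, of "\<lambda>\<sigma>. averages Ks (\<lambda>ks. G (\<sigma> \<circ> prm (mprod ks)))"])
  finally show ?thesis .
qed

lemma averages_single:
  assumes "equidistributed K h X"
  shows "averages [K] (\<lambda>ks. G (prm (mprod ks))) = (\<Sum>x\<in>X. G (h x)) / real (card X)"
  by (subst averages_equidistributed[OF assms]) (simp_all add: one_Gn)

definition hook_gram :: "nat \<Rightarrow> nat \<Rightarrow> real" where
  "hook_gram a b = (\<Sum>i<n. real ((a + (n - 1 - i)) choose n) * real ((b + (n - 1 - i)) choose n))"

text \<open>The factors are the means of a^cyc and b^cyc over the symmetric group; those of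
  \<open>alt_pair\<close> are the means weighted by the sign.\<close>

definition sym_pair :: "nat \<Rightarrow> nat \<Rightarrow> real" where "sym_pair a b = real ((a + n - 1) choose n) * real ((b + n - 1) choose n)"

definition alt_pair :: "nat \<Rightarrow> nat \<Rightarrow> real" where "alt_pair a b = real (a choose n) * real (b choose n)"

lemma tot_two_full:
  assumes z: "z \<in> Z"
  shows "tot [K_full 1, K_full z] k l = real r ^ n * fact n * (hook_gram (k + 1) (l + 1) + twist z * hook_gram k l)"
proof -
  note eq = equidistributed_full[OF z]
  have K: "\<forall>K\<in>set [K_full z]. K \<noteq> {} \<and> K \<subseteq> Gn n \<zeta>"
    using K_full_Gn[OF z] by auto
  define F where "F = real (card (full_cycles A))"
  have F0: "F \<noteq> 0" using card_full_pos by (simp add: F_def)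
  have F: "F = fact (n - 1)" using card_full_cycles[OF A_facts(1,2)] by (simp add: F_def)
  have av: "averages [K_full z] (\<lambda>ks. R_sum a b (prm (mprod ks))) = fact n * F * hook_gram a b" for a b
  proof -
    have "(\<Sum>c2\<in>full_cycles A. R_sum a b c2) = fact n * (F * F) * hook_gram a b"
      unfolding R_sum_def F hook_gram_def sum_two_full_cycles[OF A_facts(1,2), unfolded A_facts(3), symmetric]
      by (subst sum.swap) (intro sum.cong refl sum.swap)
    then show ?thesis
      unfolding averages_single[OF eq] id_apply F_def[symmetric] using F0 by simp
  qed
  have pz: "\<forall>ks. list_all2 (\<in>) ks [K_full z] \<longrightarrow> prd (mprod ks) = z"
  proof (intro allI impI)
    fix ks assume ks: "list_all2 (\<in>) ks [K_full z]"
    obtain k where k: "k \<in> K_full z" "ks = [k]"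
      using ks unfolding list_all2_Cons2 list_all2_Nil2 by blast
    moreover from k have "k \<in> Gn n \<zeta>" using K_full_Gn(1)[OF z] by blast
    ultimately show "prd (mprod ks) = z" using K_full_Gn(3)[OF z] one_Gn by (simp add: Gn_mult)
  qed
  show ?thesis
    unfolding tot_Cons[OF K pz] av F_def[symmetric] using F0 by (simp add: field_simps)
qed

lemma tot_full_near:
  assumes n2: "2 \<le> n" and eq: "equidistributed K snd (near_full_cycles A)" and z: "\<forall>k\<in>K. prd k = z"
  shows "tot [K_full 1, K] k l = real r ^ n * fact n *
    (sym_pair (k + 1) (l + 1) - alt_pair (k + 1) (l + 1) + twist z * (sym_pair k l - alt_pair k l))"
proof -
  have K: "\<forall>L\<in>set [K]. L \<noteq> {} \<and> L \<subseteq> Gn n \<zeta>"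
    using eq by (auto simp: equidistributed_def)
  define F where "F = real (card (full_cycles A))"
  define N where "N = real (card (near_full_cycles A))"
  have F0: "F \<noteq> 0" and N0: "N \<noteq> 0" using card_full_pos near_nonempty[OF n2] by (simp_all add: F_def N_def)
  have av: "averages [K] (\<lambda>ks. R_sum a b (prm (mprod ks))) = fact n * F * (sym_pair a b - alt_pair a b)" for a b
  proof -
    have "(\<Sum>x\<in>near_full_cycles A. R_sum a b (snd x)) = fact n * (F * N) * (sym_pair a b - alt_pair a b)"
      unfolding R_sum_def F_def N_def sym_pair_def alt_pair_def
        sum_full_near[OF A_facts(1), unfolded A_facts(3), OF n2, symmetric]
      by (subst sum.swap) (intro sum.cong refl sum.swap)
    then show ?thesis
      unfolding averages_single[OF eq] N_def[symmetric] using N0 by simp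
  qed
  have pz: "\<forall>ks. list_all2 (\<in>) ks [K] \<longrightarrow> prd (mprod ks) = z"
  proof (intro allI impI)
    fix ks assume ks: "list_all2 (\<in>) ks [K]"
    obtain k where k: "k \<in> K" "ks = [k]"
      using ks unfolding list_all2_Cons2 list_all2_Nil2 by blast
    moreover from k have "k \<in> Gn n \<zeta>" using K by auto
    ultimately show "prd (mprod ks) = z" using z one_Gn by (simp add: Gn_mult)
  qed
  show ?thesis
    unfolding tot_Cons[OF K pz] av F_def[symmetric] using F0 by (simp add: field_simps)
qed

lemma tot_two_full_two_near:
  assumes n2: "2 \<le> n" and eq: "equidistributed K snd (near_full_cycles A)" "equidistributed L snd (near_full_cycles A)"
    and z: "\<forall>k\<in>K. prd k = z" "\<forall>k\<in>L. prd k = 1"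
  shows "tot [K_full 1, K_full 1, K, L] k l = real r ^ n * fact n *
    (sym_pair (k + 1) (l + 1) + alt_pair (k + 1) (l + 1) + twist z * (sym_pair k l + alt_pair k l))"
proof -
  note eq1 = equidistributed_full[OF Z_facts(3)]
  have KG: "K \<subseteq> Gn n \<zeta>" "L \<subseteq> Gn n \<zeta>" "K \<noteq> {}" "L \<noteq> {}" using eq by (auto simp: equidistributed_def)
  have K: "\<forall>H\<in>set [K_full 1, K, L]. H \<noteq> {} \<and> H \<subseteq> Gn n \<zeta>"
    using KG K_full_Gn[OF Z_facts(3)] by auto
  define F where "F = real (card (full_cycles A))"
  define N where "N = real (card (near_full_cycles A))"
  have F0: "F \<noteq> 0" and N0: "N \<noteq> 0" using card_full_pos near_nonempty[OF n2] by (simp_all add: F_def N_def)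
  let ?N = "near_full_cycles A"
  have av: "averages [K_full 1, K, L] (\<lambda>ks. R_sum a b (prm (mprod ks))) = fact n * F * (sym_pair a b + alt_pair a b)" for a b
  proof -
    \<comment> \<open>The sums are reordered until they stand as in
      \<open>sum_two_full_two_near\<close>.\<close>
    have "(\<Sum>c2\<in>full_cycles A. \<Sum>x\<in>?N. \<Sum>y\<in>?N. R_sum a b (c2 \<circ> (snd x \<circ> snd y))) =
        (\<Sum>c2\<in>full_cycles A. \<Sum>x\<in>?N. \<Sum>p | p permutes A. \<Sum>c1\<in>full_cycles A. \<Sum>y\<in>?N.
          real a ^ cyc p A * real b ^ cyc (c1 \<circ> (c2 \<circ> (snd x \<circ> (snd y \<circ> p)))) A)"
      unfolding R_sum_def comp_assoc
      by (rule sum.cong[OF refl], rule sum.cong[OF refl], subst sum.swap) (intro sum.cong refl sum.swap)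
    also have "\<dots> = (\<Sum>c2\<in>full_cycles A. \<Sum>p | p permutes A. \<Sum>c1\<in>full_cycles A. \<Sum>x\<in>?N. \<Sum>y\<in>?N.
          real a ^ cyc p A * real b ^ cyc (c1 \<circ> (c2 \<circ> (snd x \<circ> (snd y \<circ> p)))) A)"
      by (rule sum.cong[OF refl], subst sum.swap) (intro sum.cong refl sum.swap)
    also have "\<dots> = (\<Sum>p | p permutes A. \<Sum>c1\<in>full_cycles A. \<Sum>c2\<in>full_cycles A. \<Sum>x\<in>?N. \<Sum>y\<in>?N.
          real a ^ cyc p A * real b ^ cyc (c1 \<circ> (c2 \<circ> (snd x \<circ> (snd y \<circ> p)))) A)"
      by (subst sum.swap) (intro sum.cong refl sum.swap)
    also have "\<dots> = fact n * ((F * F) * (N * N)) * (sym_pair a b + alt_pair a b)"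
      unfolding F_def N_def sym_pair_def alt_pair_def
      by (rule sum_two_full_two_near[OF A_facts(1), unfolded A_facts(3), OF n2])
    finally have s: "(\<Sum>c2\<in>full_cycles A. \<Sum>x\<in>?N. \<Sum>y\<in>?N. R_sum a b (c2 \<circ> (snd x \<circ> snd y))) =
        fact n * ((F * F) * (N * N)) * (sym_pair a b + alt_pair a b)" .
    have "averages [K_full 1, K, L] (\<lambda>ks. R_sum a b (prm (mprod ks))) =
        (\<Sum>c2\<in>full_cycles A. averages [K, L] (\<lambda>ks. R_sum a b (id c2 \<circ> prm (mprod ks)))) / F"
      unfolding F_def by (rule averages_equidistributed[OF eq1]) (use KG in auto)
    also have "\<dots> = (\<Sum>c2\<in>full_cycles A. (\<Sum>x\<in>?N. averages [L] (\<lambda>ks. R_sum a b (id c2 \<circ> (snd x \<circ> prm (mprod ks))))) / N) / F"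
      unfolding N_def
      by (subst averages_equidistributed[OF eq(1), of "[L]" "\<lambda>\<sigma>. R_sum a b (id c2 \<circ> \<sigma>)" for c2]) (use KG in auto)
    also have "\<dots> = (\<Sum>c2\<in>full_cycles A. (\<Sum>x\<in>?N. (\<Sum>y\<in>?N. R_sum a b (c2 \<circ> (snd x \<circ> snd y))) / N) / N) / F"
      unfolding N_def
      by (subst averages_equidistributed[OF eq(2), of "[]" "\<lambda>\<sigma>. R_sum a b (id c2 \<circ> (snd x \<circ> \<sigma>))" for c2 x])
        (auto simp: one_Gn)
    also have "\<dots> = (\<Sum>c2\<in>full_cycles A. \<Sum>x\<in>?N. \<Sum>y\<in>?N. R_sum a b (c2 \<circ> (snd x \<circ> snd y))) / (N * N * F)"
      by (simp add: sum_divide_distrib mult_ac)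
    finally show ?thesis unfolding s using F0 N0 by simp
  qed
  have pz: "\<forall>ks. list_all2 (\<in>) ks [K_full 1, K, L] \<longrightarrow> prd (mprod ks) = z"
  proof (intro allI impI)
    fix ks assume ks: "list_all2 (\<in>) ks [K_full 1, K, L]"
    obtain k1 k2 k3 where k: "k1 \<in> K_full 1" "k2 \<in> K" "k3 \<in> L" "ks = [k1, k2, k3]"
      using ks unfolding list_all2_Cons2 list_all2_Nil2 by blast
    moreover from k have g: "k1 \<in> Gn n \<zeta>" "k2 \<in> Gn n \<zeta>" "k3 \<in> Gn n \<zeta>"
      using K_full_Gn(1)[OF Z_facts(3)] KG by auto
    moreover have "prd k1 = 1" by (rule K_full_Gn(3)[OF Z_facts(3) k(1)])
    ultimately show "prd (mprod ks) = z" using z one_Gn by (simp add: Gn_mult)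
  qed
  show ?thesis
    unfolding tot_Cons[OF K pz] av F_def[symmetric] using F0 by (simp add: field_simps)
qed

definition gram :: "nat \<Rightarrow> nat \<Rightarrow> real" where
  "gram k l = (\<Sum>b\<le>n. real ((n + k - b) choose n) * real ((n + l - b) choose n))"

text \<open>Lowering both bases by one corresponds to raising b by one. Thus each of the two hook
  sums misses one end of \<open>gram\<close>, and the two ends are values of \<open>alt_pair\<close>
  and \<open>sym_pair\<close>.\<close>

lemma gram_split:
  defines "D \<equiv> \<lambda>k l b. real ((n + k - b) choose n) * real ((n + l - b) choose n)"
  shows "gram k l = hook_gram (k + 1) (l + 1) + D k l n" "gram k l = D k l 0 + hook_gram k l"
    "sym_pair (k + 1) (l + 1) = D k l 0" "alt_pair k l = D k l n"
    "alt_pair (k + 1) (l + 1) = D k l (n - 1)" "sym_pair k l = D k l 1"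
proof -
  have q: "hook_gram (k + 1) (l + 1) = (\<Sum>i<n. D k l i)"
    unfolding hook_gram_def D_def
  proof (rule sum.cong[OF refl])
    fix i assume "i \<in> {..<n}"
    then have "k + 1 + (n - 1 - i) = n + k - i" "l + 1 + (n - 1 - i) = n + l - i" by auto
    then show "real (k + 1 + (n - 1 - i) choose n) * real (l + 1 + (n - 1 - i) choose n) =
      real (n + k - i choose n) * real (n + l - i choose n)" by (simp only:)
  qed
  have q': "hook_gram k l = (\<Sum>i<n. D k l (Suc i))"
    unfolding hook_gram_def D_def
  proof (rule sum.cong[OF refl])
    fix i assume "i \<in> {..<n}"
    then have "k + (n - 1 - i) = n + k - Suc i" "l + (n - 1 - i) = n + l - Suc i" by auto
    then show "real (k + (n - 1 - i) choose n) * real (l + (n - 1 - i) choose n) =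
      real (n + k - Suc i choose n) * real (n + l - Suc i choose n)" by (simp only:)
  qed
  have g: "gram k l = (\<Sum>b<Suc n. D k l b)" by (simp only: gram_def D_def lessThan_Suc_atMost)
  show "gram k l = hook_gram (k + 1) (l + 1) + D k l n" unfolding g q by simp
  show "gram k l = D k l 0 + hook_gram k l" unfolding g q' by (rule sum.lessThan_Suc_shift)
  show "sym_pair (k + 1) (l + 1) = D k l 0" "alt_pair k l = D k l n" "sym_pair k l = D k l 1"
    by (simp_all add: sym_pair_def alt_pair_def D_def add.commute)
  have "n + k - (n - 1) = k + 1" "n + l - (n - 1) = l + 1" using n1 by auto
  then show "alt_pair (k + 1) (l + 1) = D k l (n - 1)" by (simp only: alt_pair_def D_def)
qed

text \<open>For n \<ge> 2 the first two sequences contribute half of each hook sum. In the other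
  three the weights cancel \<open>alt_pair\<close> at the raised bases and \<open>sym_pair\<close>
  at the unraised ones, and half of each missing end remains.\<close>

lemma gram_mu:
  "(\<Sum>i=0..n. \<Sum>j=0..n. real (r * k + 1) ^ i * real (r * l + 1) ^ j * mu r n \<zeta> (Cset r n \<zeta> i) (Cset r n \<zeta> j)) =
    fact n * real r ^ n * gram k l"
proof -
  note gs = gram_split[of k l]
  have r0: "real r \<noteq> 0" using r2 by simp
  have tw: "twist 1 = real r - 1" "twist \<zeta> = - 1" using Z_facts(5) by (simp_all add: twist_def)
  have t1: "tot (seq1 r n \<zeta>) k l = real r ^ n * fact n * (hook_gram (k + 1) (l + 1) + (real r - 1) * hook_gram k l)"
    unfolding seq1_def Kpad_full_cases tot_two_full[OF Z_facts(3)] tw ..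
  have t2: "tot (seq2 r n \<zeta>) k l = real r ^ n * fact n * (hook_gram (k + 1) (l + 1) - hook_gram k l)"
    unfolding seq2_def Kpad_full_cases tot_two_full[OF Z_facts(4)] tw by simp
  show ?thesis
  proof (cases "n = 1")
    case True
    have "(\<Sum>i=0..n. \<Sum>j=0..n. real (r * k + 1) ^ i * real (r * l + 1) ^ j * mu r n \<zeta> (Cset r n \<zeta> i) (Cset r n \<zeta> j)) =
        2 / real r * tot (seq1 r n \<zeta>) k l + (real r - 2) / real r * tot (seq2 r n \<zeta>) k l"
      unfolding tot_def sum_distrib_left sum.distrib[symmetric]
      by (intro sum.cong refl) (simp add: mu_def True distrib_left mult_ac)
    also have "\<dots> = fact n * real r ^ n * (hook_gram (k + 1) (l + 1) + hook_gram k l)"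
    proof -
      have alg: "2 / real r * (g * (x + (real r - 1) * y)) + (real r - 2) / real r * (g * (x - y)) = g * (x + y)"
        for g x y :: real using r0 by (simp add: field_simps)
      show ?thesis unfolding t1 t2 alg by (simp only: mult.commute[of "fact n"])
    qed
    \<comment> \<open>With a single point the only hook is the trivial one, so the two hook sums
      already provide both terms of \<open>gram\<close>.\<close>
    also have "hook_gram (k + 1) (l + 1) = sym_pair (k + 1) (l + 1)" unfolding hook_gram_def sym_pair_def using True by simp
    finally show ?thesis unfolding gs(2,3) .
  next
    case False
    then have n2: "2 \<le> n" using n1 by simp
    have z3: "\<forall>k\<in>(\<lambda>(p, e). M p e) ` near_zeta_pairs. prd k = \<zeta>"
      using equidistributed_near_zeta(2)[OF n2] by blast
    have z4: "\<forall>k\<in>(\<lambda>(p, e). M p e) ` near_one_pairs. prd k = 1"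
      using equidistributed_near_one(2)[OF n2] by blast
    note e3 = equidistributed_near_zeta(1)[OF n2] z3 and e4 = equidistributed_near_one(1)[OF n2] z4
    have t3: "tot (seq3 r n \<zeta>) k l = real r ^ n * fact n *
        (sym_pair (k + 1) (l + 1) - alt_pair (k + 1) (l + 1) - (sym_pair k l - alt_pair k l))"
      unfolding seq3_def Kpad_full_cases Kpad_near_zeta[OF n2] tot_full_near[OF n2 e3] tw by simp
    have t4: "tot (seq4 r n \<zeta>) k l = real r ^ n * fact n *
        (sym_pair (k + 1) (l + 1) + alt_pair (k + 1) (l + 1) + (real r - 1) * (sym_pair k l + alt_pair k l))"
      unfolding seq4_def Kpad_full_cases Kpad_near_one[OF n2] tot_two_full_two_near[OF n2 e4(1) e4(1) e4(2) e4(2)] tw ..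
    have t5: "tot (seq5 r n \<zeta>) k l = real r ^ n * fact n *
        (sym_pair (k + 1) (l + 1) + alt_pair (k + 1) (l + 1) - (sym_pair k l + alt_pair k l))"
      unfolding seq5_def Kpad_full_cases Kpad_near_one[OF n2] Kpad_near_zeta[OF n2]
        tot_two_full_two_near[OF n2 e3(1) e4(1) e3(2) e4(2)] tw by simp
    have "(\<Sum>i=0..n. \<Sum>j=0..n. real (r * k + 1) ^ i * real (r * l + 1) ^ j * mu r n \<zeta> (Cset r n \<zeta> i) (Cset r n \<zeta> j)) =
        1 / real r * tot (seq1 r n \<zeta>) k l + (real r - 2) / (2 * real r) * tot (seq2 r n \<zeta>) k l +
        1 / 4 * tot (seq3 r n \<zeta>) k l + 1 / (2 * real r) * tot (seq4 r n \<zeta>) k l +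
        (real r - 2) / (4 * real r) * tot (seq5 r n \<zeta>) k l"
      unfolding tot_def sum_distrib_left sum.distrib[symmetric]
      by (intro sum.cong refl) (simp only: mu_def False if_False distrib_left mult_ac)
    also have "\<dots> = fact n * real r ^ n * ((hook_gram (k + 1) (l + 1) + alt_pair k l) / 2 + (sym_pair (k + 1) (l + 1) + hook_gram k l) / 2)"
    proof -
      \<comment> \<open>Here \<open>x\<close>, \<open>y\<close> are the two hook sums,
        \<open>h\<close>, \<open>e\<close> the symmetric and alternating pairs at the raised bases,
        and \<open>h'\<close>, \<open>e'\<close> those at the unraised ones; the coefficients of
        \<open>e\<close> and \<open>h'\<close> vanish.\<close>
      have alg: "1 / real r * (g * (x + (real r - 1) * y)) + (real r - 2) / (2 * real r) * (g * (x - y)) +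
          1 / 4 * (g * (h - e - (h' - e'))) + 1 / (2 * real r) * (g * (h + e + (real r - 1) * (h' + e'))) +
          (real r - 2) / (4 * real r) * (g * (h + e - (h' + e'))) = g * ((x + e') / 2 + (h + y) / 2)"
        for g x y h e h' e' :: real using r0 by (simp add: field_simps)
      show ?thesis unfolding t1 t2 t3 t4 t5 alg by (simp only: mult.commute[of "fact n"])
    qed
    also have "(hook_gram (k + 1) (l + 1) + alt_pair k l) / 2 + (sym_pair (k + 1) (l + 1) + hook_gram k l) / 2 = gram k l"
      unfolding gs(3,4) gs(1,2)[symmetric] by simp
    finally show ?thesis .
  qed
qed

end

section \<open>The Gram--Schmidt process\<close>

text \<open>The coefficient of x^m in (1 - x)^(n+1) (1 - x)^(-n-1) = 1, obtained from the
  Vandermonde identity with a negative upper index.\<close>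

lemma binomial_convolution:
  "(\<Sum>t=0..m. (- 1) ^ t * of_nat (Suc n choose t) * of_nat ((n + (m - t)) choose n)) = (if m = 0 then 1 else 0 :: complex)"
proof -
  have neg: "(- of_nat (Suc n) :: complex) gchoose j = (- 1) ^ j * of_nat ((n + j) choose n)" for j
  proof -
    have "(- of_nat (Suc n) :: complex) gchoose j = (- 1) ^ j * ((of_nat (Suc n) + of_nat j - 1) gchoose j)"
      by (rule gbinomial_minus)
    also have "(of_nat (Suc n) + of_nat j - 1 :: complex) = of_nat (n + j)" by simp
    also have "(of_nat (n + j) :: complex) gchoose j = of_nat ((n + j) choose j)" by (rule binomial_gbinomial[symmetric])
    also have "(n + j) choose j = (n + j) choose n" by (subst binomial_symmetric) simp_all
    finally show ?thesis .
  qed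
  have "(\<Sum>t=0..m. (of_nat (Suc n) gchoose t) * ((- of_nat (Suc n)) gchoose (m - t))) =
      ((of_nat (Suc n) + - of_nat (Suc n) :: complex) gchoose m)"
    by (rule gbinomial_Vandermonde)
  then have "(- 1) ^ m * (\<Sum>t=0..m. (of_nat (Suc n) gchoose t) * ((- of_nat (Suc n)) gchoose (m - t))) =
      (if m = 0 then 1 else 0 :: complex)"
    by (cases m) simp_all
  moreover have "(- 1) ^ m * (\<Sum>t=0..m. (of_nat (Suc n) gchoose t) * ((- of_nat (Suc n)) gchoose (m - t))) =
      (\<Sum>t=0..m. (- 1) ^ t * of_nat (Suc n choose t) * of_nat ((n + (m - t)) choose n) :: complex)"
    unfolding sum_distrib_left
  proof (rule sum.cong[OF refl])
    fix t assume "t \<in> {0..m}"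
    then have e: "(- 1) ^ m * (- 1) ^ (m - t) = ((- 1) ^ t :: complex)"
      by (simp add: minus_one_power_iff)
    show "(- 1) ^ m * ((of_nat (Suc n) gchoose t) * ((- of_nat (Suc n)) gchoose (m - t))) =
      ((- 1) ^ t * of_nat (Suc n choose t) * of_nat ((n + (m - t)) choose n) :: complex)"
      unfolding neg binomial_gbinomial[symmetric] e[symmetric] by (simp only: mult_ac)
  qed
  ultimately show ?thesis by simp
qed

text \<open>The triangular Toeplitz matrix of (1 - x)^(n+1); its inverse is the one of (1 -
  x)^(-n-1), with binomial entries.\<close>

definition foulkes_coeff :: "nat \<Rightarrow> nat \<Rightarrow> nat \<Rightarrow> complex" where
  "foulkes_coeff n i j = (if j \<le> i then (- 1) ^ (i - j) * of_nat (Suc n choose (i - j)) else 0)"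

lemma foulkes_coeff_inverse:
  assumes "i \<le> n" "b \<le> n"
  shows "(\<Sum>j=0..n. foulkes_coeff n i j * of_nat ((n + j - b) choose n)) = (if i = b then 1 else 0)"
proof (cases "i < b")
  case True
  have "foulkes_coeff n i j * of_nat ((n + j - b) choose n) = 0" for j
  proof (cases "j \<le> i")
    case True
    \<comment> \<open>Entries above the diagonal vanish because the upper index drops below n;
      \<open>b \<le> n\<close> keeps the subtraction exact.\<close>
    then have "n + j - b < n" using \<open>i < b\<close> assms by simp
    then show ?thesis by (simp add: binomial_eq_0)
  qed (simp add: foulkes_coeff_def)
  then have "(\<Sum>j=0..n. foulkes_coeff n i j * of_nat ((n + j - b) choose n)) = 0"
    by (intro sum.neutral ballI)
  then show ?thesis using True by simp
next
  case False
  have "(\<Sum>j=0..n. foulkes_coeff n i j * of_nat ((n + j - b) choose n)) =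
      (\<Sum>j=b..i. foulkes_coeff n i j * of_nat ((n + j - b) choose n))"
  proof (rule sum.mono_neutral_right)
    show "\<forall>j\<in>{0..n} - {b..i}. foulkes_coeff n i j * of_nat ((n + j - b) choose n) = 0"
    proof
      fix j assume "j \<in> {0..n} - {b..i}"
      then have "i < j \<or> n + j - b < n" using assms by auto
      then show "foulkes_coeff n i j * of_nat ((n + j - b) choose n) = 0"
        by (auto simp: foulkes_coeff_def binomial_eq_0)
    qed
  qed (use assms in auto)
  also have "\<dots> = (\<Sum>t=0..i - b. (- 1) ^ t * of_nat (Suc n choose t) * of_nat ((n + ((i - b) - t)) choose n))"
    by (rule sum.reindex_bij_witness[of _ "\<lambda>t. i - t" "\<lambda>j. i - j"])
      (use False in \<open>auto simp: foulkes_coeff_def\<close>)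
  also have "\<dots> = (if i = b then 1 else 0)" unfolding binomial_convolution using False by auto
  finally show ?thesis .
qed

text \<open>The relation in the other order reads off the coordinates of a Foulkes character; this
  one reassembles a function from its coordinates.\<close>

lemma foulkes_coeff_inverse':
  assumes "k \<le> n" "j \<le> n"
  shows "(\<Sum>i=0..n. of_nat ((n + k - i) choose n) * foulkes_coeff n i j) = (if k = j then 1 else 0)"
proof (cases "k < j")
  case True
  have "of_nat ((n + k - i) choose n) * foulkes_coeff n i j = 0" if "i \<in> {0..n}" for i
  proof (cases "j \<le> i")
    case True
    then have "n + k - i < n" using \<open>k < j\<close> that by simp
    then show ?thesis by (simp add: binomial_eq_0)
  qed (simp add: foulkes_coeff_def)
  then have "(\<Sum>i=0..n. of_nat ((n + k - i) choose n) * foulkes_coeff n i j) = 0"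
    by (intro sum.neutral ballI)
  then show ?thesis using True by simp
next
  case False
  have "(\<Sum>i=0..n. of_nat ((n + k - i) choose n) * foulkes_coeff n i j) =
      (\<Sum>i=j..k. of_nat ((n + k - i) choose n) * foulkes_coeff n i j)"
  proof (rule sum.mono_neutral_right)
    show "\<forall>i\<in>{0..n} - {j..k}. of_nat ((n + k - i) choose n) * foulkes_coeff n i j = 0"
    proof
      fix i assume "i \<in> {0..n} - {j..k}"
      then have "i < j \<or> n + k - i < n" using assms by auto
      then show "of_nat ((n + k - i) choose n) * foulkes_coeff n i j = 0"
        by (auto simp: foulkes_coeff_def binomial_eq_0)
    qed
  qed (use assms in auto)
  also have "\<dots> = (\<Sum>t=0..k - j. (- 1) ^ t * of_nat (Suc n choose t) * of_nat ((n + ((k - j) - t)) choose n))"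
    by (rule sum.reindex_bij_witness[of _ "\<lambda>t. j + t" "\<lambda>i. i - j"])
      (use False in \<open>auto simp: foulkes_coeff_def\<close>)
  also have "\<dots> = (if k = j then 1 else 0)" unfolding binomial_convolution using False by auto
  finally show ?thesis .
qed

text \<open>\<open>L j t\<close> is the coefficient at x^t of the j-th Lagrange polynomial, an entry
  of the inverse Vandermonde matrix. With n + 1 nodes the interpolant of x^s is x^s itself.\<close>

lemma power_interpolation:
  fixes y :: "nat \<Rightarrow> complex"
  assumes "inj_on y {..n}"
  obtains L :: "nat \<Rightarrow> nat \<Rightarrow> complex"
    where "\<forall>s\<le>n. \<forall>t\<le>n. (\<Sum>j=0..n. L j t * y j ^ s) = (if s = t then 1 else 0)"
proof -
  define P where "P = (\<lambda>j. Polynomial.smult (inverse (\<Prod>i\<in>{..n} - {j}. y j - y i)) (\<Prod>i\<in>{..n} - {j}. [:- y i, 1:]))"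
  have deg: "degree (P j) \<le> n" if "j \<le> n" for j
  proof -
    have "degree (P j) \<le> degree (\<Prod>i\<in>{..n} - {j}. [:- y i, 1:])" unfolding P_def by (rule degree_smult_le)
    also have "\<dots> = (\<Sum>i\<in>{..n} - {j}. degree [:- y i, 1:])" by (rule degree_prod_eq_sum_degree) simp
    also have "\<dots> = n" using that by simp
    finally show ?thesis .
  qed
  have val: "poly (P j) (y i) = (if i = j then 1 else 0)" if "i \<le> n" "j \<le> n" for i j
  proof (cases "i = j")
    case True
    have "(\<Prod>i\<in>{..n} - {j}. y j - y i) \<noteq> 0"
      using assms that by (auto simp: inj_on_def)
    then show ?thesis using True by (simp add: P_def poly_prod)
  next
    case False
    then have "(\<Prod>k\<in>{..n} - {j}. y i - y k) = 0" using that by (intro prod_zero bexI[of _ i]) auto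
    then show ?thesis using False by (simp add: P_def poly_prod)
  qed
  have "(\<Sum>j=0..n. coeff (P j) t * y j ^ s) = (if s = t then 1 else 0)" if st: "s \<le> n" "t \<le> n" for s t
  proof -
    have "(\<Sum>j=0..n. Polynomial.smult (y j ^ s) (P j)) = monom 1 s"
    proof (rule poly_eqI_degree[where A = "y ` {..n}"])
      have c: "card (y ` {..n}) = Suc n" using card_image[OF assms] by simp
      have "degree (\<Sum>j=0..n. Polynomial.smult (y j ^ s) (P j)) \<le> n"
        by (rule degree_sum_le) (use deg le_trans[OF degree_smult_le] in auto)
      then show "degree (\<Sum>j=0..n. Polynomial.smult (y j ^ s) (P j)) < card (y ` {..n})" using c by simp
      show "degree (monom (1 :: complex) s) < card (y ` {..n})"
        using c st degree_monom_le[of "1 :: complex" s] by simp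
      fix x assume "x \<in> y ` {..n}"
      then obtain i where i: "i \<le> n" "x = y i" by auto
      have "poly (\<Sum>j=0..n. Polynomial.smult (y j ^ s) (P j)) x = (\<Sum>j=0..n. if i = j then y j ^ s else 0)"
        unfolding poly_sum by (rule sum.cong[OF refl]) (use i val in auto)
      also have "\<dots> = poly (monom 1 s) x" using i by (simp add: poly_monom)
      finally show "poly (\<Sum>j=0..n. Polynomial.smult (y j ^ s) (P j)) x = poly (monom 1 s) x" .
    qed
    then have "coeff (\<Sum>j=0..n. Polynomial.smult (y j ^ s) (P j)) t = coeff (monom 1 s) t" by simp
    then show ?thesis by (simp add: coeff_sum mult.commute)
  qed
  then show thesis by (intro that[of "\<lambda>j t. coeff (P j) t"]) blast
qed

context monomial_group begin

text \<open>A diagonal matrix with i entries 1 and all others equal to \<open>\<zeta>\<close> lies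
  in the class. Nonemptiness is what makes the value chosen by \<open>value_on\<close>
  unique.\<close>

lemma Cset_witness:
  assumes "i \<le> n"
  obtains x where "x \<in> Cset r n \<zeta> i"
proof -
  define e where "e = restrict (\<lambda>j. if j < i then 1 else \<zeta>) A"
  have e: "e \<in> A \<rightarrow>\<^sub>E Z" using Z_facts by (auto simp: e_def)
  have "orbit id j = {j}" for j :: nat by (simp add: orbit_eq_singleton_iff)
  then have o: "orbits id A = (\<lambda>j. {j}) ` A" by (simp add: orbits_def)
  have "{C \<in> orbits id A. prod e C = 1} = (\<lambda>j. {j}) ` {..<i}"
    unfolding o using assms Z_facts(5) by (auto simp: e_def split: if_splits)
  then have "ell r n \<zeta> (M id e) = i"
    using ell_M[OF permutes_id e] by (simp add: card_image)
  moreover have "M id e \<in> Gn n \<zeta>" using e by (intro M_in_Gn permutes_id) auto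
  ultimately show thesis using that by (simp add: Cset_def)
qed

lemma value_on_Cset:
  assumes "f \<in> CF_ell r n \<zeta>" "x \<in> Cset r n \<zeta> i"
  shows "value_on f (Cset r n \<zeta> i) = f x"
  unfolding value_on_def
  by (rule the_equality) (use assms in \<open>auto simp: CF_ell_def Cset_def\<close>)

lemma value_on_linear:
  assumes "f \<in> CF_ell r n \<zeta>" "g \<in> CF_ell r n \<zeta>" "i \<le> n"
  shows "value_on (\<lambda>x. f x + g x) (Cset r n \<zeta> i) = value_on f (Cset r n \<zeta> i) + value_on g (Cset r n \<zeta> i)"
    and "value_on (\<lambda>x. c * f x) (Cset r n \<zeta> i) = c * value_on f (Cset r n \<zeta> i)"
proof -
  obtain x where x: "x \<in> Cset r n \<zeta> i" by (rule Cset_witness[OF assms(3)])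
  have eq: "f y = f z \<and> g y = g z"
    if "y \<in> Gn n \<zeta>" "z \<in> Gn n \<zeta>" "ell r n \<zeta> y = ell r n \<zeta> z" for y z
    using assms(1,2) that unfolding CF_ell_def by blast
  have "(\<lambda>x. f x + g x) \<in> CF_ell r n \<zeta>" "(\<lambda>x. c * f x) \<in> CF_ell r n \<zeta>"
    unfolding CF_ell_def by (auto dest: eq)
  then show "value_on (\<lambda>x. f x + g x) (Cset r n \<zeta> i) = value_on f (Cset r n \<zeta> i) + value_on g (Cset r n \<zeta> i)"
    and "value_on (\<lambda>x. c * f x) (Cset r n \<zeta> i) = c * value_on f (Cset r n \<zeta> i)"
    using assms by (simp_all add: value_on_Cset[OF _ x])
qed

section \<open>Coordinates with respect to the Foulkes characters\<close>

definition base :: "nat \<Rightarrow> complex" where "base j = of_nat (r * j + 1)"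

definition pow_comb :: "(nat \<Rightarrow> complex) \<Rightarrow> complex mat \<Rightarrow> complex" where
  "pow_comb c x = (\<Sum>j=0..n. c j * base j ^ ell r n \<zeta> x)"

text \<open>The coefficients of \<open>pow_comb c\<close> in the Foulkes characters, by
  \<open>pow_comb_eq_foulkes\<close>.\<close>

definition coords :: "(nat \<Rightarrow> complex) \<Rightarrow> nat \<Rightarrow> complex" where
  "coords c b = (\<Sum>j=0..n. c j * of_nat ((n + j - b) choose n))"

lemma value_on_pow_comb:
  assumes "i \<le> n" "\<forall>x\<in>Gn n \<zeta>. f x = pow_comb c x"
  shows "value_on f (Cset r n \<zeta> i) = (\<Sum>j=0..n. c j * base j ^ i)"
proof -
  obtain x where x: "x \<in> Cset r n \<zeta> i" by (rule Cset_witness[OF assms(1)])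
  have "f \<in> CF_ell r n \<zeta>" using assms(2) by (auto simp: CF_ell_def pow_comb_def)
  from value_on_Cset[OF this x] show ?thesis using x assms(2) by (simp add: Cset_def pow_comb_def)
qed

text \<open>\<open>gram\<close> is B times its transpose for the binomial matrix B behind
  \<open>coords\<close>, and the factor n! r^n in \<open>gram_mu\<close> is the order of the group.
  In coordinates the form is therefore the standard Hermitian one, which gives orthonormality and
  positivity at once.\<close>

lemma ell_inner_pow_comb:
  assumes f: "\<forall>x\<in>Gn n \<zeta>. f x = pow_comb c x" and g: "\<forall>x\<in>Gn n \<zeta>. g x = pow_comb d x"
  shows "ell_inner r n \<zeta> f g = (\<Sum>b=0..n. coords c b * cnj (coords d b))"
proof -
  let ?m = "\<lambda>i j. complex_of_real (mu r n \<zeta> (Cset r n \<zeta> i) (Cset r n \<zeta> j))"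
  have cb: "cnj (base j) = base j" for j by (simp add: base_def)
  have "(\<Sum>i=0..n. \<Sum>j=0..n. value_on f (Cset r n \<zeta> i) * cnj (value_on g (Cset r n \<zeta> j)) * ?m i j) =
      (\<Sum>i=0..n. \<Sum>j=0..n. \<Sum>k=0..n. \<Sum>l=0..n. c k * cnj (d l) * (base k ^ i * base l ^ j * ?m i j))"
  proof (intro sum.cong refl)
    fix i j assume ij: "i \<in> {0..n}" "j \<in> {0..n}"
    have "value_on f (Cset r n \<zeta> i) * cnj (value_on g (Cset r n \<zeta> j)) =
        (\<Sum>k=0..n. c k * base k ^ i) * (\<Sum>l=0..n. cnj (d l) * base l ^ j)"
      using ij by (simp add: value_on_pow_comb[OF _ f] value_on_pow_comb[OF _ g] cb)
    also have "\<dots> = (\<Sum>k=0..n. \<Sum>l=0..n. c k * base k ^ i * (cnj (d l) * base l ^ j))" by (rule sum_product)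
    finally have e: "value_on f (Cset r n \<zeta> i) * cnj (value_on g (Cset r n \<zeta> j)) =
      (\<Sum>k=0..n. \<Sum>l=0..n. c k * base k ^ i * (cnj (d l) * base l ^ j))" .
    show "value_on f (Cset r n \<zeta> i) * cnj (value_on g (Cset r n \<zeta> j)) * ?m i j =
      (\<Sum>k=0..n. \<Sum>l=0..n. c k * cnj (d l) * (base k ^ i * base l ^ j * ?m i j))"
      unfolding e sum_distrib_right by (intro sum.cong refl) (simp only: mult_ac)
  qed
  also have "\<dots> = (\<Sum>i=0..n. \<Sum>k=0..n. \<Sum>l=0..n. \<Sum>j=0..n. c k * cnj (d l) * (base k ^ i * base l ^ j * ?m i j))"
    by (rule sum.cong[OF refl], subst sum.swap) (intro sum.cong refl sum.swap)
  also have "\<dots> = (\<Sum>k=0..n. \<Sum>l=0..n. \<Sum>i=0..n. \<Sum>j=0..n. c k * cnj (d l) * (base k ^ i * base l ^ j * ?m i j))"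
    by (subst sum.swap) (intro sum.cong refl sum.swap)
  also have "\<dots> = (\<Sum>k=0..n. \<Sum>l=0..n. c k * cnj (d l) * of_real (fact n * real r ^ n * gram k l))"
    unfolding sum_distrib_left[symmetric] gram_mu[symmetric] by (simp add: base_def)
  also have "\<dots> = of_nat (card (Gn n \<zeta>)) * (\<Sum>k=0..n. \<Sum>l=0..n. c k * cnj (d l) * of_real (gram k l))"
    by (simp add: card_Gn sum_distrib_left mult_ac)
  finally have "ell_inner r n \<zeta> f g = (\<Sum>k=0..n. \<Sum>l=0..n. c k * cnj (d l) * of_real (gram k l))"
    unfolding ell_inner_def using r2 by (simp add: card_Gn)
  also have "\<dots> = (\<Sum>k=0..n. \<Sum>l=0..n. \<Sum>b=0..n. (c k * of_nat ((n + k - b) choose n)) * cnj (d l * of_nat ((n + l - b) choose n)))"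
    by (intro sum.cong refl) (simp add: gram_def sum_distrib_left atMost_atLeast0 mult_ac)
  also have "\<dots> = (\<Sum>k=0..n. \<Sum>b=0..n. \<Sum>l=0..n. (c k * of_nat ((n + k - b) choose n)) * cnj (d l * of_nat ((n + l - b) choose n)))"
    by (intro sum.cong refl sum.swap)
  also have "\<dots> = (\<Sum>b=0..n. \<Sum>k=0..n. \<Sum>l=0..n. (c k * of_nat ((n + k - b) choose n)) * cnj (d l * of_nat ((n + l - b) choose n)))"
    by (rule sum.swap)
  also have "\<dots> = (\<Sum>b=0..n. coords c b * cnj (coords d b))"
    unfolding coords_def cnj_sum sum_product ..
  finally show ?thesis .
qed

lemma foulkes_eq_pow_comb: "foulkes r n \<zeta> i = pow_comb (foulkes_coeff n i)"
  unfolding foulkes_def pow_comb_def base_def foulkes_coeff_def by (intro ext sum.cong refl) simp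

lemma pow_ell_eq_pow_comb:
  "k \<le> n \<Longrightarrow> pow_ell r n \<zeta> (r * k + 1) = pow_comb (\<lambda>j. if j = k then 1 else 0)"
  by (rule ext) (simp add: pow_ell_def pow_comb_def base_def if_distrib[of "\<lambda>c. c * _"] cong: if_cong)

lemma coords_foulkes: "i \<le> n \<Longrightarrow> b \<le> n \<Longrightarrow> coords (foulkes_coeff n i) b = (if i = b then 1 else 0)"
  unfolding coords_def by (rule foulkes_coeff_inverse)

lemma coords_pow: "k \<le> n \<Longrightarrow> coords (\<lambda>j. if j = k then 1 else 0) b = of_nat ((n + k - b) choose n)"
  by (simp add: coords_def if_distrib[of "\<lambda>c. c * _"] cong: if_cong)

lemma pow_comb_eq_foulkes: "pow_comb c x = (\<Sum>b=0..n. coords c b * foulkes r n \<zeta> b x)"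
proof -
  have "(\<Sum>b=0..n. coords c b * foulkes r n \<zeta> b x) =
      (\<Sum>b=0..n. \<Sum>k=0..n. \<Sum>j=0..n. c k * base j ^ ell r n \<zeta> x * (of_nat ((n + k - b) choose n) * foulkes_coeff n b j))"
    unfolding foulkes_eq_pow_comb pow_comb_def coords_def sum_product by (intro sum.cong refl) (simp only: mult_ac)
  also have "\<dots> = (\<Sum>k=0..n. \<Sum>b=0..n. \<Sum>j=0..n. c k * base j ^ ell r n \<zeta> x * (of_nat ((n + k - b) choose n) * foulkes_coeff n b j))"
    by (rule sum.swap)
  also have "\<dots> = (\<Sum>k=0..n. \<Sum>j=0..n. \<Sum>b=0..n. c k * base j ^ ell r n \<zeta> x * (of_nat ((n + k - b) choose n) * foulkes_coeff n b j))"
    by (intro sum.cong refl sum.swap)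
  also have "\<dots> = (\<Sum>k=0..n. \<Sum>j=0..n. c k * base j ^ ell r n \<zeta> x * (if k = j then 1 else 0))"
    unfolding sum_distrib_left[symmetric] by (intro sum.cong refl) (simp add: foulkes_coeff_inverse')
  also have "\<dots> = pow_comb c x"
    unfolding pow_comb_def by (intro sum.cong refl) (simp add: if_distrib[of "\<lambda>c. _ * c"] cong: if_cong)
  finally show ?thesis ..
qed

text \<open>\<open>ell\<close> takes values in 0, ..., n and the n + 1 bases r j + 1 are distinct,
  so the Vandermonde system for the coefficients can be solved.\<close>

lemma CF_ell_pow_comb:
  assumes "f \<in> CF_ell r n \<zeta>"
  obtains c where "\<forall>x\<in>Gn n \<zeta>. f x = pow_comb c x"
proof -
  have "inj_on base {..n}" using r2 by (auto simp: base_def inj_on_def)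
  then obtain L where L: "\<forall>s\<le>n. \<forall>t\<le>n. (\<Sum>j=0..n. L j t * base j ^ s) = (if s = t then 1 else 0)"
    by (rule power_interpolation)
  define F where "F = (\<lambda>t. value_on f (Cset r n \<zeta> t))"
  have "f x = pow_comb (\<lambda>j. \<Sum>t=0..n. F t * L j t) x" if x: "x \<in> Gn n \<zeta>" for x
  proof -
    let ?s = "ell r n \<zeta> x"
    have s: "?s \<le> n" by (rule ell_le[OF x])
    have "pow_comb (\<lambda>j. \<Sum>t=0..n. F t * L j t) x = (\<Sum>j=0..n. \<Sum>t=0..n. F t * (L j t * base j ^ ?s))"
      unfolding pow_comb_def sum_distrib_right by (simp only: mult.assoc)
    also have "\<dots> = (\<Sum>t=0..n. F t * (\<Sum>j=0..n. L j t * base j ^ ?s))"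
      unfolding sum_distrib_left by (rule sum.swap)
    also have "\<dots> = (\<Sum>t=0..n. F t * (if ?s = t then 1 else 0))"
      by (rule sum.cong[OF refl]) (use L s in simp)
    also have "\<dots> = F ?s" using s by (simp add: if_distrib[of "\<lambda>c. _ * c"] cong: if_cong)
    also have "\<dots> = f x" unfolding F_def by (rule value_on_Cset[OF assms]) (simp add: Cset_def x)
    finally show ?thesis ..
  qed
  then show thesis by (intro that[of "\<lambda>j. \<Sum>t=0..n. F t * L j t"]) blast
qed

text \<open>A norm is a sum of squared moduli of coordinates; definiteness holds because a function
  is recovered from its coordinates on the whole group.\<close>

lemma inner_product: "inner_product_on (Gn n \<zeta>) (CF_ell r n \<zeta>) (ell_inner r n \<zeta>)"
  unfolding inner_product_on_def
proof (intro conjI ballI allI impI)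
  let ?V = "CF_ell r n \<zeta>"
  fix f assume f: "f \<in> ?V"
  obtain c where c: "\<forall>x\<in>Gn n \<zeta>. f x = pow_comb c x" by (rule CF_ell_pow_comb[OF f])
  have ff: "ell_inner r n \<zeta> f f = of_real (\<Sum>b=0..n. (cmod (coords c b))\<^sup>2)"
    using ell_inner_pow_comb[OF c c] by (simp only: of_real_sum complex_norm_square)
  show "Im (ell_inner r n \<zeta> f f) = 0" "0 \<le> Re (ell_inner r n \<zeta> f f)"
    unfolding ff by (simp_all add: sum_nonneg)
  show "f x = 0" if z: "ell_inner r n \<zeta> f f = 0" and x: "x \<in> Gn n \<zeta>" for x
  proof -
    have "(\<Sum>b=0..n. (cmod (coords c b))\<^sup>2) = 0" using z unfolding ff by (simp only: of_real_eq_0_iff)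
    then have "\<forall>b\<in>{0..n}. (cmod (coords c b))\<^sup>2 = 0" by (subst (asm) sum_nonneg_eq_0_iff) auto
    then have "\<forall>b\<in>{0..n}. coords c b = 0" by simp
    then show ?thesis unfolding bspec[OF c x] pow_comb_eq_foulkes by simp
  qed
  fix g assume g: "g \<in> ?V"
  obtain d where d: "\<forall>x\<in>Gn n \<zeta>. g x = pow_comb d x" by (rule CF_ell_pow_comb[OF g])
  show "ell_inner r n \<zeta> g f = cnj (ell_inner r n \<zeta> f g)"
    unfolding ell_inner_pow_comb[OF c d] ell_inner_pow_comb[OF d c] by (simp add: mult.commute)
  show "ell_inner r n \<zeta> (\<lambda>x. a * f x) g = a * ell_inner r n \<zeta> f g" for a
    unfolding ell_inner_def sum_distrib_left
    by (intro sum.cong refl) (simp add: value_on_linear(2)[OF f f])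
  fix h assume h: "h \<in> ?V"
  show "ell_inner r n \<zeta> (\<lambda>x. f x + g x) h = ell_inner r n \<zeta> f h + ell_inner r n \<zeta> g h"
    unfolding ell_inner_def sum_distrib_left sum.distrib[symmetric]
    by (intro sum.cong refl) (simp add: value_on_linear(1)[OF f g] algebra_simps)
qed

lemma ell_inner_foulkes:
  assumes "k \<le> n" "i \<le> n"
  shows "ell_inner r n \<zeta> (pow_ell r n \<zeta> (r * k + 1)) (foulkes r n \<zeta> i) = of_nat ((n + k - i) choose n)"
    and "ell_inner r n \<zeta> (foulkes r n \<zeta> i) (foulkes r n \<zeta> i) = 1"
proof -
  have "ell_inner r n \<zeta> (pow_ell r n \<zeta> (r * k + 1)) (foulkes r n \<zeta> i) =
      (\<Sum>b=0..n. coords (\<lambda>j. if j = k then 1 else 0) b * cnj (coords (foulkes_coeff n i) b))"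
    by (rule ell_inner_pow_comb) (intro ballI, simp only: foulkes_eq_pow_comb pow_ell_eq_pow_comb[OF assms(1)])+
  also have "\<dots> = (\<Sum>b=0..n. if i = b then of_nat ((n + k - b) choose n) else 0)"
    by (rule sum.cong[OF refl]) (use assms in \<open>simp add: coords_foulkes coords_pow\<close>)
  finally show "ell_inner r n \<zeta> (pow_ell r n \<zeta> (r * k + 1)) (foulkes r n \<zeta> i) = of_nat ((n + k - i) choose n)"
    using assms by simp
  have "ell_inner r n \<zeta> (foulkes r n \<zeta> i) (foulkes r n \<zeta> i) =
      (\<Sum>b=0..n. coords (foulkes_coeff n i) b * cnj (coords (foulkes_coeff n i) b))"
    by (rule ell_inner_pow_comb) (intro ballI, simp only: foulkes_eq_pow_comb)+
  also have "\<dots> = (\<Sum>b=0..n. if i = b then 1 else 0)"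
    by (rule sum.cong[OF refl]) (use assms in \<open>simp add: coords_foulkes\<close>)
  finally show "ell_inner r n \<zeta> (foulkes r n \<zeta> i) (foulkes r n \<zeta> i) = 1" using assms by simp
qed

text \<open>In the power with base r k + 1 the k-th Foulkes character has coefficient
  \<open>n choose n\<close>, which is 1, and later ones do not occur. Subtracting the projections
  leaves that character itself, already of norm 1, so normalization changes nothing.\<close>

lemma gram_schmidt_foulkes:
  "k \<le> n \<Longrightarrow> gram_schmidt_seq (ell_inner r n \<zeta>) (\<lambda>j. pow_ell r n \<zeta> (r * j + 1)) k = foulkes r n \<zeta> k"
proof (induction k rule: less_induct)
  case (less k)
  let ?ip = "ell_inner r n \<zeta>" and ?v = "\<lambda>j. pow_ell r n \<zeta> (r * j + 1)"
  have "(\<lambda>x. ?v k x - (\<Sum>i<k. ?ip (?v k) (gram_schmidt_seq ?ip ?v i) * gram_schmidt_seq ?ip ?v i x)) = foulkes r n \<zeta> k"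
  proof
    fix x
    have "?v k x = (\<Sum>b=0..n. of_nat ((n + k - b) choose n) * foulkes r n \<zeta> b x)"
      unfolding pow_ell_eq_pow_comb[OF less.prems] pow_comb_eq_foulkes coords_pow[OF less.prems] ..
    also have "\<dots> = (\<Sum>b<Suc k. of_nat ((n + k - b) choose n) * foulkes r n \<zeta> b x)"
      by (rule sum.mono_neutral_right) (use less.prems in \<open>auto simp: binomial_eq_0\<close>)
    finally have v: "?v k x = (\<Sum>i<k. of_nat ((n + k - i) choose n) * foulkes r n \<zeta> i x) + foulkes r n \<zeta> k x" by simp
    have "(\<Sum>i<k. ?ip (?v k) (gram_schmidt_seq ?ip ?v i) * gram_schmidt_seq ?ip ?v i x) =
        (\<Sum>i<k. of_nat ((n + k - i) choose n) * foulkes r n \<zeta> i x)"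
    proof (rule sum.cong[OF refl])
      fix i assume "i \<in> {..<k}"
      then have i: "i < k" "i \<le> n" using less.prems by auto
      show "?ip (?v k) (gram_schmidt_seq ?ip ?v i) * gram_schmidt_seq ?ip ?v i x =
        of_nat ((n + k - i) choose n) * foulkes r n \<zeta> i x"
        unfolding less.IH[OF i] ell_inner_foulkes(1)[OF less.prems i(2)] ..
    qed
    then show "?v k x - (\<Sum>i<k. ?ip (?v k) (gram_schmidt_seq ?ip ?v i) * gram_schmidt_seq ?ip ?v i x) = foulkes r n \<zeta> k x"
      unfolding v by simp
  qed
  then show ?case
    unfolding gram_schmidt_seq.simps[of ?ip ?v k] Let_def
    by (simp only: ell_inner_foulkes(2)[OF less.prems less.prems]) simp
qed

end

theorem theorem3p12:
  fixes r n :: nat and \<zeta> :: complex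
  assumes "r \<ge> 2" and "n \<ge> 1" and "primitive_root_of_unity r \<zeta>"
  shows "inner_product_on (Gn n \<zeta>) (CF_ell r n \<zeta>) (ell_inner r n \<zeta>) \<and>
    (\<forall>i\<le>n. \<forall>x\<in>Gn n \<zeta>.
       gram_schmidt_seq (ell_inner r n \<zeta>) (\<lambda>j. pow_ell r n \<zeta> (r * j + 1)) i x = foulkes r n \<zeta> i x)"
proof -
  interpret monomial_group r n \<zeta> using assms by unfold_locales
  show ?thesis using inner_product gram_schmidt_foulkes by simp
qed

end
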